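(* Let $p\in\mathbb{N}$, $0<T<\infty$, $j=\begin{bmatrix} I_p&0\\0&-I_p\end{bmatrix}$, and let $\beta$ be a $p\times 2p$ matrix function on $[0,T]$ which is two times differentiable with $\beta''\in L_2^{p\times 2p}(0,T)$ and satisfies $$\beta(x)j\beta(x)^*\equiv 0,\qquad \beta'(x)j\beta(x)^*\equiv \mathrm{i}I_p .$$ Let $K$ and $A$ be the operators in $L_2^p(0,T)$ given by $$(Kf)(x)=\mathrm{i}\beta(x)j\int_0^x\beta(t)^*f(t)\,dt,\qquad (Af)(x)=\int_0^x(t-x)f(t)\,dt .$$ Then $K$ is linearly similar to $A$: $$K=VAV^{-1},\qquad (Vf)(x)=u(x)\Big(f(x)+\int_0^x\mathcal{V}(x,t)f(t)\,dt\Big),$$ where $u(x)$ is a $p\times p$ matrix function which is unitary (i.e., $u^*=u^{-1}$) and absolutely continuous on $[0,T]$, and $\mathcal{V}(x,t)$ is a $p\times p$ matrix function with $$\sup_{0\le t\le x\le T}\|\mathcal{V}(x,t)\|<\infty .$$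
   Context: $L_2^p(0,T)$ is the space of square-integrable $\mathbb{C}^p$-valued functions on $(0,T)$; $L_2^{p\times 2p}(0,T)$ is the class of $p\times 2p$ matrix functions with entries in $L_2(0,T)$; $\beta^*$ is the conjugate transpose; $\|\cdot\|$ of a matrix is its operator norm on the Euclidean space. Linear similarity means that $V$ is a bounded operator on $L_2^p(0,T)$ with bounded inverse. *)

theory Defs
  imports "HOL-Analysis.Analysis"
begin

text \<open>
  A \<open>p \<times> 2p\<close> matrix is a \<open>complex ^ ('p + 'p) ^ 'p\<close> with \<open>p = CARD('p)\<close>; the two summands of
  the column index are the two blocks.
\<close>

definition ctranspose :: "complex ^ 'n ^ 'm \<Rightarrow> complex ^ 'm ^ 'n" where
  "ctranspose M = (\<chi> i k. cnj (M $ k $ i))"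

definition jmat :: "complex ^ ('p::finite + 'p) ^ ('p + 'p)" where
  "jmat = (\<chi> a b. if a = b then (case a of Inl _ \<Rightarrow> 1 | Inr _ \<Rightarrow> -1) else 0)"

definition unitary_matrix :: "complex ^ 'n ^ 'n \<Rightarrow> bool" where
  "unitary_matrix U \<longleftrightarrow> ctranspose U ** U = mat 1 \<and> U ** ctranspose U = mat 1"

text \<open>The Euclidean operator norm of a matrix.\<close>

definition opnorm :: "complex ^ 'n ^ 'm \<Rightarrow> real" where
  "opnorm M = onorm (\<lambda>v. M *v v)"

text \<open>
  The intervals of a division are compact, nonempty and pairwise non-overlapping, so
  \<open>Inf k\<close> and \<open>Sup k\<close> are the end points of \<open>k\<close>.
\<close>

definition absolutely_continuous_on :: "real set \<Rightarrow> (real \<Rightarrow> 'a::real_normed_vector) \<Rightarrow> bool" where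
  "absolutely_continuous_on S f \<longleftrightarrow>
    (\<forall>e>0. \<exists>d>0. \<forall>D X. D division_of X \<and> X \<subseteq> S \<and> (\<Sum>k\<in>D. Sup k - Inf k) < d \<longrightarrow>
      (\<Sum>k\<in>D. norm (f (Sup k) - f (Inf k))) < e)"

text \<open>
  Elements of \<open>L\<^sub>2(0,T)\<close> are represented by functions, equality being equality almost everywhere
  on \<open>(0,T)\<close>. An operator is a map on representatives that respects this equality.
\<close>

definition AE_eq :: "real \<Rightarrow> (real \<Rightarrow> 'a) \<Rightarrow> (real \<Rightarrow> 'a) \<Rightarrow> bool" where
  "AE_eq T f g \<longleftrightarrow> (AE x in lebesgue_on {0<..<T}. f x = g x)"

definition L2 :: "real \<Rightarrow> (real \<Rightarrow> 'a::euclidean_space) set" where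
  "L2 T = {f \<in> borel_measurable (lebesgue_on {0<..<T}).
             integrable (lebesgue_on {0<..<T}) (\<lambda>x. (norm (f x))\<^sup>2)}"

definition L2_norm :: "real \<Rightarrow> (real \<Rightarrow> 'a::euclidean_space) \<Rightarrow> real" where
  "L2_norm T f = sqrt (LINT x|lebesgue_on {0<..<T}. (norm (f x))\<^sup>2)"

definition bounded_L2_operator ::
    "real \<Rightarrow> ((real \<Rightarrow> complex ^ 'n) \<Rightarrow> (real \<Rightarrow> complex ^ 'n)) \<Rightarrow> bool" where
  "bounded_L2_operator T F \<longleftrightarrow>
     (\<forall>f\<in>L2 T. F f \<in> L2 T) \<and>
     (\<forall>f\<in>L2 T. \<forall>g\<in>L2 T. AE_eq T f g \<longrightarrow> AE_eq T (F f) (F g)) \<and>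
     (\<forall>f\<in>L2 T. \<forall>g\<in>L2 T. AE_eq T (F (\<lambda>x. f x + g x)) (\<lambda>x. F f x + F g x)) \<and>
     (\<forall>c. \<forall>f\<in>L2 T. AE_eq T (F (\<lambda>x. c *s f x)) (\<lambda>x. c *s F f x)) \<and>
     (\<exists>C. \<forall>f\<in>L2 T. L2_norm T (F f) \<le> C * L2_norm T f)"

text \<open>
  \<open>K = V A V\<^sup>-\<^sup>1\<close> on \<open>L\<^sub>2(0,T)\<close>, where \<open>V\<close> and its two-sided inverse \<open>W\<close> are bounded.
\<close>

definition linearly_similar_via ::
    "real \<Rightarrow> ((real \<Rightarrow> complex ^ 'n) \<Rightarrow> (real \<Rightarrow> complex ^ 'n))
          \<Rightarrow> ((real \<Rightarrow> complex ^ 'n) \<Rightarrow> (real \<Rightarrow> complex ^ 'n))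
          \<Rightarrow> ((real \<Rightarrow> complex ^ 'n) \<Rightarrow> (real \<Rightarrow> complex ^ 'n)) \<Rightarrow> bool" where
  "linearly_similar_via T V K A \<longleftrightarrow>
     bounded_L2_operator T V \<and>
     (\<exists>W. bounded_L2_operator T W \<and>
          (\<forall>f\<in>L2 T. AE_eq T (V (W f)) f \<and> AE_eq T (W (V f)) f) \<and>
          (\<forall>f\<in>L2 T. AE_eq T (K f) (V (A (W f)))))"

definition K_op ::
    "(real \<Rightarrow> complex ^ ('p::finite + 'p) ^ 'p) \<Rightarrow> (real \<Rightarrow> complex ^ 'p) \<Rightarrow> real \<Rightarrow> complex ^ 'p" where
  "K_op \<beta> f x =
     \<i> *s ((\<beta> x ** jmat) *v (LINT t:{0..x}|lebesgue. ctranspose (\<beta> t) *v f t))"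

definition A_op :: "(real \<Rightarrow> complex ^ 'p::finite) \<Rightarrow> real \<Rightarrow> complex ^ 'p" where
  "A_op f x = (LINT t:{0..x}|lebesgue. (t - x) *\<^sub>R f t)"

definition V_op ::
    "(real \<Rightarrow> complex ^ 'p ^ 'p) \<Rightarrow> (real \<Rightarrow> real \<Rightarrow> complex ^ 'p ^ 'p)
      \<Rightarrow> (real \<Rightarrow> complex ^ 'p::finite) \<Rightarrow> real \<Rightarrow> complex ^ 'p" where
  "V_op u \<V> f x = u x *v (f x + (LINT t:{0..x}|lebesgue. \<V> x t *v f t))"

definition volterra_triangle :: "real \<Rightarrow> (real \<times> real) set" where
  "volterra_triangle T = {(x, t). 0 \<le> t \<and> t \<le> x \<and> x \<le> T}"

end

theory Submission
  imports Defs
begin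

text \<open>
  The operator \<open>A\<close> solves \<open>- g'' = f\<close> with \<open>g(0) = g'(0) = 0\<close>. The idea is that, up to a unitary gauge,
  \<open>K\<close> solves the perturbed problem with a potential, and that the two problems are intertwined by a
  transmutation operator.

  Gauge (\<open>J_gauge_exists\<close>). Let \<open>u\<close> solve \<open>u' = (\<i>/2) \<beta>' j \<beta>'\<^sup>* u\<close>, \<open>u(0) = 1\<close>. Then \<open>u\<close> is unitary and
  \<open>b = u\<^sup>* \<beta>\<close> satisfies, besides \<open>b j b\<^sup>* = 0\<close> and \<open>b' j b\<^sup>* = \<i>\<close>, also \<open>b' j b'\<^sup>* = 0\<close>. The rows of
  \<open>b\<close> and \<open>b'\<close> form a frame, and differentiating the relations gives \<open>b'' = a\<^sup>* b\<close> with a square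
  integrable matrix function \<open>a\<close>. By Taylor's formula the operator \<open>K\<^sub>b = u\<^sup>* K u\<close> generated by \<open>b\<close>
  satisfies \<open>K\<^sub>b = A - K\<^sub>b a A\<close> (\<open>J_kernel_equation\<close>).

  Transmutation (\<open>transmutation_operator_exists\<close>). A kernel \<open>v(x,t)\<close> with \<open>v\<^sub>x\<^sub>x - v\<^sub>t\<^sub>t = a(x) v\<close> and
  additional sources \<open>a\<close> on the diagonal satisfies \<open>A v - v A = A a (1 + v) A\<close>. As \<open>a\<close> is only square
  integrable, \<open>v\<close> need not be twice differentiable; therefore \<open>v\<close> is constructed as a superposition of fundamental
  solutions of the wave equation, that is, of multiples of indicator functions of light cones. For a
  single light cone the commutator with \<open>A\<close> is an elementary integral
  (\<open>light_cone_ramp_commutator\<close>), and Fubini's theorem does the rest.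

  Both identities together imply \<open>K\<^sub>b (1 + v) = (1 + v) A\<close> (\<open>similarity_from_commutator\<close>), so
  \<open>V = u (1 + v)\<close> is the required operator: as \<open>v\<close> is a bounded Volterra kernel, \<open>1 + v\<close> has an
  inverse \<open>1 + r\<close> of the same kind (\<open>kernel_two_sided_inverse\<close>). The gauge
  \<open>u\<close>, the kernel \<open>v\<close> and the kernel \<open>r\<close> all come from one fixed point argument in an exponentially
  weighted supremum norm (\<open>volterra_fixed_point\<close>).
\<close>

section \<open>Complex matrices\<close>

lemma L2_set_square: "(L2_set f A)\<^sup>2 = (\<Sum>i\<in>A. (f i)\<^sup>2)"
  by (simp add: L2_set_def sum_nonneg)

lemma norm_matrix_vector_mult_le:
  fixes A :: "complex ^ 'n ^ 'm" and x :: "complex ^ 'n"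
  shows "norm (A *v x) \<le> norm A * norm x"
proof -
  have "norm ((A *v x) $ i) \<le> norm (A $ i) * norm x" for i
  proof -
    have "norm ((A *v x) $ i) \<le> (\<Sum>k\<in>UNIV. \<bar>norm (A $ i $ k)\<bar> * \<bar>norm (x $ k)\<bar>)"
      unfolding matrix_vector_mult_def
      by (simp, rule order_trans[OF norm_sum]) (simp add: norm_mult)
    also have "\<dots> \<le> norm (A $ i) * norm x"
      unfolding norm_vec_def[of "A $ i"] norm_vec_def[of x] by (rule L2_set_mult_ineq)
    finally show ?thesis .
  qed
  then have "norm (A *v x) \<le> L2_set (\<lambda>i. norm (A $ i) * norm x) UNIV"
    unfolding norm_vec_def[of "A *v x"] by (intro L2_set_mono) auto
  also have "\<dots> = norm A * norm x"
    unfolding norm_vec_def[of A] by (simp add: L2_set_left_distrib)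
  finally show ?thesis .
qed

lemma norm_vector_scalar_mult: "norm (c *s (x :: complex ^ 'n)) = norm c * norm x"
  unfolding norm_vec_def by (simp add: norm_mult L2_set_right_distrib)

text \<open>
  The norm of the type of matrices is the Frobenius norm; Cauchy--Schwarz makes it
  submultiplicative, so that no constants appear when kernels are multiplied.
\<close>

lemma norm_matrix_matrix_mult_le:
  fixes A :: "complex ^ 'n ^ 'm" and B :: "complex ^ 'k ^ 'n"
  shows "norm (A ** B) \<le> norm A * norm B"
proof -
  have "norm ((A ** B) $ i) \<le> norm (A $ i) * norm B" for i
  proof -
    have row: "(A ** B) $ i = (\<Sum>k\<in>UNIV. A $ i $ k *s B $ k)"
      by (simp add: vec_eq_iff matrix_matrix_mult_def)
    have "norm ((A ** B) $ i) \<le> (\<Sum>k\<in>UNIV. \<bar>norm (A $ i $ k)\<bar> * \<bar>norm (B $ k)\<bar>)"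
      unfolding row by (rule order_trans[OF norm_sum]) (simp add: norm_vector_scalar_mult)
    also have "\<dots> \<le> norm (A $ i) * norm B"
      unfolding norm_vec_def[of "A $ i"] norm_vec_def[of B] by (rule L2_set_mult_ineq)
    finally show ?thesis .
  qed
  then have "norm (A ** B) \<le> L2_set (\<lambda>i. norm (A $ i) * norm B) UNIV"
    unfolding norm_vec_def[of "A ** B"] by (intro L2_set_mono) auto
  also have "\<dots> = norm A * norm B"
    unfolding norm_vec_def[of A] by (simp add: L2_set_left_distrib)
  finally show ?thesis .
qed

lemma matrix_mult_scaleR_left: "(r *\<^sub>R A) ** B = r *\<^sub>R (A ** (B :: complex ^ 'k ^ 'n))"
  by (simp add: vec_eq_iff matrix_matrix_mult_def scaleR_sum_right)

lemma matrix_mult_add_left: "(A + B) ** C = A ** C + B ** (C :: complex ^ 'k ^ 'n)"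
  by (simp add: vec_eq_iff matrix_matrix_mult_def sum.distrib distrib_right)

lemma matrix_mult_scaleR_right: "A ** (r *\<^sub>R B) = r *\<^sub>R (A ** (B :: complex ^ 'k ^ 'n))"
  by (simp add: vec_eq_iff matrix_matrix_mult_def scaleR_sum_right)

lemma matrix_vector_scaleR_left: "(r *\<^sub>R A) *v x = r *\<^sub>R (A *v (x :: complex ^ 'n))"
  by (simp add: vec_eq_iff matrix_vector_mult_def scaleR_sum_right)

lemma matrix_vector_scaleR_right: "A *v (r *\<^sub>R x) = r *\<^sub>R (A *v (x :: complex ^ 'n))"
  by (simp add: vec_eq_iff matrix_vector_mult_def scaleR_sum_right)

lemma bounded_bilinear_matrix_mult:
  "bounded_bilinear ((**) :: complex ^ 'n ^ 'm \<Rightarrow> complex ^ 'k ^ 'n \<Rightarrow> complex ^ 'k ^ 'm)"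
proof (rule bounded_bilinear.intro)
  show "\<exists>K. \<forall>(a :: complex ^ 'n ^ 'm) (b :: complex ^ 'k ^ 'n). norm (a ** b) \<le> norm a * norm b * K"
    by (intro exI[of _ 1]) (simp add: norm_matrix_matrix_mult_le)
qed (simp_all add: matrix_add_ldistrib matrix_mult_add_left matrix_mult_scaleR_left matrix_mult_scaleR_right)

lemma bounded_bilinear_matrix_vector_mult:
  "bounded_bilinear ((*v) :: complex ^ 'n ^ 'm \<Rightarrow> complex ^ 'n \<Rightarrow> complex ^ 'm)"
proof (rule bounded_bilinear.intro)
  show "\<exists>K. \<forall>(a :: complex ^ 'n ^ 'm) (b :: complex ^ 'n). norm (a *v b) \<le> norm a * norm b * K"
    by (intro exI[of _ 1]) (simp add: norm_matrix_vector_mult_le)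
qed (simp_all add: matrix_vector_mult_add_rdistrib matrix_vector_right_distrib
       matrix_vector_scaleR_left matrix_vector_scaleR_right)

interpretation mm: bounded_bilinear "(**) :: complex ^ 'n ^ 'm \<Rightarrow> complex ^ 'k ^ 'n \<Rightarrow> complex ^ 'k ^ 'm"
  by (rule bounded_bilinear_matrix_mult)

interpretation mv: bounded_bilinear "(*v) :: complex ^ 'n ^ 'm \<Rightarrow> complex ^ 'n \<Rightarrow> complex ^ 'm"
  by (rule bounded_bilinear_matrix_vector_mult)

lemma norm_ctranspose: "norm (ctranspose A) = norm (A :: complex ^ 'n ^ 'm)"
proof -
  have "(norm (ctranspose A))\<^sup>2 = (norm A)\<^sup>2"
    unfolding norm_vec_def L2_set_square by (simp add: ctranspose_def) (rule sum.swap)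
  then show ?thesis by simp
qed

text \<open>
  Conjugate-linear over the complex numbers, the adjoint is linear over the reals, and this is the
  linearity that derivatives and integrals in a real variable respect.
\<close>

lemma bounded_linear_ctranspose:
  "bounded_linear (ctranspose :: complex ^ 'n ^ 'm \<Rightarrow> complex ^ 'm ^ 'n)"
  by (rule bounded_linear_intro[where K = 1])
     (simp_all add: norm_ctranspose, simp_all add: ctranspose_def vec_eq_iff)

lemmas ctranspose_add = linear_add[OF bounded_linear.linear, OF bounded_linear_ctranspose]

lemmas ctranspose_diff = linear_diff[OF bounded_linear.linear, OF bounded_linear_ctranspose]

lemmas ctranspose_scaleR = linear_scale[OF bounded_linear.linear, OF bounded_linear_ctranspose]

lemmas ctranspose_continuous_on = bounded_linear.continuous_on[OF bounded_linear_ctranspose]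

lemma ctranspose_mult: "ctranspose (A ** B) = ctranspose B ** ctranspose A"
  by (simp add: ctranspose_def matrix_matrix_mult_def vec_eq_iff mult.commute)

lemma ctranspose_ctranspose [simp]: "ctranspose (ctranspose A) = A"
  by (simp add: ctranspose_def vec_eq_iff)

lemma ctranspose_mat: "ctranspose (mat c) = mat (cnj c)"
  by (simp add: ctranspose_def mat_def vec_eq_iff)

lemma ctranspose_jmat [simp]: "ctranspose jmat = jmat"
  by (auto simp: ctranspose_def jmat_def vec_eq_iff split: sum.splits)

lemma mat_mult_left: "mat c ** A = (\<chi> i k. c * A $ i $ k)" for A :: "complex ^ 'n ^ 'm"
  by (simp add: vec_eq_iff matrix_matrix_mult_def mat_def if_distrib [of "\<lambda>x. x * _"] cong: if_cong)

lemma mat_mult_right: "A ** mat c = (\<chi> i k. c * A $ i $ k)" for A :: "complex ^ 'n ^ 'm"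
  by (simp add: vec_eq_iff matrix_matrix_mult_def mat_def if_distrib [of "\<lambda>x. _ * x"]
        mult.commute cong: if_cong)

lemma mat_commute: "mat c ** A = A ** mat c" for A :: "complex ^ 'n ^ 'm"
  by (simp add: mat_mult_left mat_mult_right)

lemma mat_mult_mat: "mat c ** mat d = (mat (c * d) :: complex ^ 'n ^ 'n)"
  by (simp add: mat_mult_left) (simp add: mat_def vec_eq_iff)

lemma mat_vector_mult: "mat c *v x = c *s (x :: complex ^ 'n)"
  by (simp add: vec_eq_iff matrix_vector_mult_def mat_def if_distrib [of "\<lambda>x. x * _"] cong: if_cong)

lemma matrix_mult_measurable [measurable (raw)]:
  fixes f :: "'a \<Rightarrow> complex ^ 'n ^ 'm" and g :: "'a \<Rightarrow> complex ^ 'k ^ 'n"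
  assumes "f \<in> borel_measurable M" "g \<in> borel_measurable M"
  shows "(\<lambda>x. f x ** g x) \<in> borel_measurable M"
  by (rule borel_measurable_continuous_Pair[OF assms]) (intro mm.continuous_on continuous_intros)

lemma matrix_vector_mult_measurable [measurable (raw)]:
  fixes f :: "'a \<Rightarrow> complex ^ 'n ^ 'm" and g :: "'a \<Rightarrow> complex ^ 'n"
  assumes "f \<in> borel_measurable M" "g \<in> borel_measurable M"
  shows "(\<lambda>x. f x *v g x) \<in> borel_measurable M"
  by (rule borel_measurable_continuous_Pair[OF assms]) (intro mv.continuous_on continuous_intros)

lemma ctranspose_measurable [measurable (raw)]:
  fixes f :: "'a \<Rightarrow> complex ^ 'n ^ 'm"
  assumes "f \<in> borel_measurable M"
  shows "(\<lambda>x. ctranspose (f x)) \<in> borel_measurable M"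
  by (rule measurable_compose[OF assms borel_measurable_continuous_onI])
     (intro ctranspose_continuous_on continuous_intros)

lemma opnorm_le_norm: "opnorm A \<le> norm A"
  unfolding opnorm_def by (rule onorm_le) (rule norm_matrix_vector_mult_le)

lemma sum_UNIV_Plus:
  "(\<Sum>a\<in>(UNIV :: ('a::finite + 'b::finite) set). f a) = (\<Sum>i\<in>UNIV. f (Inl i)) + (\<Sum>i\<in>UNIV. f (Inr i))"
  unfolding UNIV_Plus_UNIV[symmetric] by (subst sum.Plus) auto

text \<open>
  The rows of \<open>b\<close> and \<open>c\<close> together form a square matrix \<open>S\<close>, and the three relations exhibit a
  right inverse \<open>P\<close> of \<open>S\<close>, with block columns \<open>\<i> j c\<^sup>*\<close> and \<open>- \<i> j b\<^sup>*\<close>. Hence \<open>P\<close> is also a left inverse,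
  and \<open>d = d P S\<close> expands every \<open>d\<close> in terms of \<open>b\<close> and \<open>c\<close>.
\<close>

lemma J_frame_completeness:
  fixes b c :: "complex ^ ('p::finite + 'p) ^ 'p" and d :: "complex ^ ('p + 'p) ^ 'm"
  assumes bb: "b ** jmat ** ctranspose b = 0" and cb: "c ** jmat ** ctranspose b = mat \<i>"
    and cc: "c ** jmat ** ctranspose c = 0"
  shows "d = mat \<i> ** (d ** jmat ** ctranspose c ** b) - mat \<i> ** (d ** jmat ** ctranspose b ** c)"
proof -
  have bc: "b ** jmat ** ctranspose c = mat (- \<i>)"
    using arg_cong[OF cb, of ctranspose] by (simp add: ctranspose_mult ctranspose_mat matrix_mul_assoc)
  define X where "X = mat \<i> ** (jmat ** ctranspose c)"
  define Y where "Y = mat (- \<i>) ** (jmat ** ctranspose b)"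
  define S :: "complex ^ ('p + 'p) ^ ('p + 'p)" where
    "S = (\<chi> a. case a of Inl i \<Rightarrow> b $ i | Inr i \<Rightarrow> c $ i)"
  define P :: "complex ^ ('p + 'p) ^ ('p + 'p)" where
    "P = (\<chi> k a. case a of Inl i \<Rightarrow> X $ k $ i | Inr i \<Rightarrow> Y $ k $ i)"
  have *: "M ** (mat z ** (jmat ** N)) = mat z ** (M ** jmat ** N)"
    for M :: "complex ^ ('p + 'p) ^ 'p" and N :: "complex ^ 'p ^ ('p + 'p)" and z
    by (simp only: matrix_mul_assoc mat_commute[of z M])
  have bX: "b ** X = mat 1" and cX: "c ** X = 0" and bY: "b ** Y = 0" and cY: "c ** Y = mat 1"
    unfolding X_def Y_def * bb cb cc bc by (simp_all add: mat_mult_mat mm.zero_right)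
  have "S ** P = mat 1"
  proof -
    have "(S ** P) $ a $ a' = (mat 1 :: complex ^ ('p + 'p) ^ ('p + 'p)) $ a $ a'" for a a'
    proof (cases a; cases a')
      fix i k assume a: "a = Inl i" "a' = Inl k"
      have "(S ** P) $ a $ a' = (b ** X) $ i $ k"
        by (simp add: a S_def P_def matrix_matrix_mult_def)
      then show ?thesis by (simp add: bX a mat_def)
    next
      fix i k assume a: "a = Inl i" "a' = Inr k"
      have "(S ** P) $ a $ a' = (b ** Y) $ i $ k"
        by (simp add: a S_def P_def matrix_matrix_mult_def)
      then show ?thesis by (simp add: bY a mat_def)
    next
      fix i k assume a: "a = Inr i" "a' = Inl k"
      have "(S ** P) $ a $ a' = (c ** X) $ i $ k"
        by (simp add: a S_def P_def matrix_matrix_mult_def)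
      then show ?thesis by (simp add: cX a mat_def)
    next
      fix i k assume a: "a = Inr i" "a' = Inr k"
      have "(S ** P) $ a $ a' = (c ** Y) $ i $ k"
        by (simp add: a S_def P_def matrix_matrix_mult_def)
      then show ?thesis by (simp add: cY a mat_def)
    qed
    then show ?thesis by (simp add: vec_eq_iff)
  qed
  then have "P ** S = mat 1" by (simp add: matrix_left_right_inverse)
  moreover have "P ** S = X ** b + Y ** c"
    by (simp add: vec_eq_iff matrix_matrix_mult_def P_def S_def sum_UNIV_Plus)
  ultimately have "X ** b + Y ** c = mat 1" by simp
  then have "d = d ** (X ** b) + d ** (Y ** c)"
    by (metis matrix_add_ldistrib matrix_mul_rid)
  also have "d ** (X ** b) = mat \<i> ** (d ** jmat ** ctranspose c ** b)"
    unfolding X_def by (simp only: matrix_mul_assoc mat_commute[of \<i> d])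
  also have "d ** (Y ** c) = - (mat \<i> ** (d ** jmat ** ctranspose b ** c))"
  proof -
    have "d ** (Y ** c) = mat (- \<i>) ** (d ** jmat ** ctranspose b ** c)"
      unfolding Y_def by (simp only: matrix_mul_assoc mat_commute[of "-\<i>" d])
    also have "\<dots> = - (mat \<i> ** (d ** jmat ** ctranspose b ** c))"
      by (simp add: mat_mult_left vec_eq_iff)
    finally show ?thesis .
  qed
  finally show ?thesis by simp
qed

section \<open>Absolutely continuous functions\<close>

lemma division_interval_bounds:
  fixes X :: "real set"
  assumes "D division_of X" "k \<in> D"
  obtains u v where "k = {u..v}" "u \<le> v" "Inf k = u" "Sup k = v" "{u..v} \<subseteq> X"
proof -
  obtain u v where "k = cbox u v" "k \<noteq> {}" "k \<subseteq> X"
    using division_ofD[OF assms(1)] assms(2) by metis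
  then show ?thesis using that[of u v] by auto
qed

lemma absolutely_continuous_onD:
  assumes "absolutely_continuous_on S f" "e > 0"
  obtains d where "d > 0"
    "\<And>D X. D division_of X \<Longrightarrow> X \<subseteq> S \<Longrightarrow> (\<Sum>k\<in>D. Sup k - Inf k) < d \<Longrightarrow>
       (\<Sum>k\<in>D. norm (f (Sup k) - f (Inf k))) < e"
  using assms unfolding absolutely_continuous_on_def by metis

lemma absolutely_continuous_imp_continuous_on:
  fixes f :: "real \<Rightarrow> 'a::real_normed_vector"
  assumes "absolutely_continuous_on {a..b} f"
  shows "continuous_on {a..b} f"
  unfolding continuous_on_iff
proof (intro ballI allI impI)
  fix x e :: real assume x: "x \<in> {a..b}" and "0 < e"
  obtain d where d: "d > 0" "\<And>D X. D division_of X \<Longrightarrow> X \<subseteq> {a..b} \<Longrightarrow> (\<Sum>k\<in>D. Sup k - Inf k) < d \<Longrightarrow>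
       (\<Sum>k\<in>D. norm (f (Sup k) - f (Inf k))) < e"
    using absolutely_continuous_onD[OF assms \<open>0 < e\<close>] by blast
  have "norm (f (max x y) - f (min x y)) < e" if "y \<in> {a..b}" "dist y x < d" for y
  proof -
    \<comment> \<open>a division with the single interval between \<open>x\<close> and \<open>y\<close>\<close>
    have "{{min x y..max x y}} division_of {min x y..max x y}"
      by (subst box_real(2)[symmetric])+ (rule division_of_self, auto)
    from d(2)[OF this] show ?thesis using that x by (auto simp: dist_real_def min_def max_def split: if_splits)
  qed
  then have "\<And>y. y \<in> {a..b} \<Longrightarrow> dist y x < d \<Longrightarrow> dist (f y) (f x) < e"
    by (fastforce simp: dist_norm min_def max_def norm_minus_commute split: if_splits)
  with d(1) show "\<exists>d>0. \<forall>y\<in>{a..b}. dist y x < d \<longrightarrow> dist (f y) (f x) < e" by blast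
qed

lemma continuous_on_Icc_bounded:
  fixes f :: "real \<Rightarrow> 'a::real_normed_vector"
  assumes "continuous_on {a..b} f"
  obtains B where "B > 0" "\<And>x. x \<in> {a..b} \<Longrightarrow> norm (f x) \<le> B"
proof -
  have "bounded (f ` {a..b})"
    by (rule compact_imp_bounded[OF compact_continuous_image[OF assms compact_Icc]])
  then show ?thesis using that unfolding bounded_pos by blast
qed

text \<open>
  Products, linear images, differences and Lipschitz functions are all absolutely continuous for
  the same reason: their increments are controlled by the increments of given absolutely continuous
  functions.
\<close>

lemma absolutely_continuous_on_combine:
  fixes f :: "real \<Rightarrow> 'a::real_normed_vector" and g :: "real \<Rightarrow> 'b::real_normed_vector"
    and h :: "real \<Rightarrow> 'c::real_normed_vector"
  assumes f: "absolutely_continuous_on {a..b} f" and g: "absolutely_continuous_on {a..b} g"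
    and h: "\<And>u v. a \<le> u \<Longrightarrow> u \<le> v \<Longrightarrow> v \<le> b \<Longrightarrow>
              norm (h v - h u) \<le> C * norm (f v - f u) + C * norm (g v - g u)"
  shows "absolutely_continuous_on {a..b} h"
  unfolding absolutely_continuous_on_def
proof (intro allI impI)
  fix e :: real assume "e > 0"
  define C' where "C' = max C 1"
  have C': "C' \<ge> 1" "C' \<ge> C" unfolding C'_def by auto
  define e' where "e' = e / (2 * C')"
  have "e' > 0" unfolding e'_def using \<open>e > 0\<close> C' by simp
  obtain d1 where d1: "d1 > 0" "\<And>D X. D division_of X \<Longrightarrow> X \<subseteq> {a..b} \<Longrightarrow> (\<Sum>k\<in>D. Sup k - Inf k) < d1 \<Longrightarrow>
       (\<Sum>k\<in>D. norm (f (Sup k) - f (Inf k))) < e'"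
    using absolutely_continuous_onD[OF f \<open>0 < e'\<close>] by blast
  obtain d2 where d2: "d2 > 0" "\<And>D X. D division_of X \<Longrightarrow> X \<subseteq> {a..b} \<Longrightarrow> (\<Sum>k\<in>D. Sup k - Inf k) < d2 \<Longrightarrow>
       (\<Sum>k\<in>D. norm (g (Sup k) - g (Inf k))) < e'"
    using absolutely_continuous_onD[OF g \<open>0 < e'\<close>] by blast
  have "(\<Sum>k\<in>D. norm (h (Sup k) - h (Inf k))) < e"
    if D: "D division_of X" "X \<subseteq> {a..b}" and sm: "(\<Sum>k\<in>D. Sup k - Inf k) < min d1 d2" for D X
  proof -
    have "(\<Sum>k\<in>D. norm (h (Sup k) - h (Inf k)))
        \<le> (\<Sum>k\<in>D. C' * norm (f (Sup k) - f (Inf k)) + C' * norm (g (Sup k) - g (Inf k)))"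
    proof (rule sum_mono)
      fix k assume "k \<in> D"
      then obtain u v where k: "k = {u..v}" "u \<le> v" "Inf k = u" "Sup k = v" "{u..v} \<subseteq> X"
        using division_interval_bounds D(1) by blast
      have "norm (h v - h u) \<le> C * norm (f v - f u) + C * norm (g v - g u)"
        using k D(2) by (intro h) (auto simp: subset_iff)
      also have "\<dots> \<le> C' * norm (f v - f u) + C' * norm (g v - g u)"
        using C' by (intro add_mono mult_right_mono) auto
      finally show "norm (h (Sup k) - h (Inf k)) \<le> C' * norm (f (Sup k) - f (Inf k)) + C' * norm (g (Sup k) - g (Inf k))"
        using k by simp
    qed
    also have "\<dots> = C' * ((\<Sum>k\<in>D. norm (f (Sup k) - f (Inf k))) + (\<Sum>k\<in>D. norm (g (Sup k) - g (Inf k))))"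
      by (simp add: sum.distrib sum_distrib_left distrib_left)
    also have "\<dots> < C' * (e' + e')"
      using d1(2)[OF D] d2(2)[OF D] sm C' by (intro mult_strict_left_mono add_strict_mono) auto
    also have "\<dots> = e" unfolding e'_def using C' by (simp add: field_simps)
    finally show ?thesis .
  qed
  then show "\<exists>d>0. \<forall>D X. D division_of X \<and> X \<subseteq> {a..b} \<and> (\<Sum>k\<in>D. Sup k - Inf k) < d \<longrightarrow>
      (\<Sum>k\<in>D. norm (h (Sup k) - h (Inf k))) < e"
    using d1(1) d2(1) by (intro exI[of _ "min d1 d2"]) auto
qed

lemma absolutely_continuous_on_ident: "absolutely_continuous_on {a..b} (\<lambda>x::real. x)"
  unfolding absolutely_continuous_on_def
proof (intro allI impI exI conjI)
  fix e :: real and D :: "real set set" and X assume "e > 0"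
    and D: "D division_of X \<and> X \<subseteq> {a..b} \<and> (\<Sum>k\<in>D. Sup k - Inf k) < e"
  have "(\<Sum>k\<in>D. norm (Sup k - Inf k)) = (\<Sum>k\<in>D. Sup k - Inf k)"
  proof (rule sum.cong)
    fix k assume "k \<in> D"
    then obtain u v where "u \<le> v" "Inf k = u" "Sup k = v"
      using division_interval_bounds D by blast
    then show "norm (Sup k - Inf k) = Sup k - Inf k" by simp
  qed simp
  then show "(\<Sum>k\<in>D. norm (Sup k - Inf k)) < e" using D by simp
qed simp

lemma Lipschitz_imp_absolutely_continuous_on:
  fixes h :: "real \<Rightarrow> 'c::real_normed_vector"
  assumes "\<And>u v. a \<le> u \<Longrightarrow> u \<le> v \<Longrightarrow> v \<le> b \<Longrightarrow> norm (h v - h u) \<le> C * (v - u)"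
  shows "absolutely_continuous_on {a..b} h"
proof (rule absolutely_continuous_on_combine[OF absolutely_continuous_on_ident absolutely_continuous_on_ident])
  fix u v assume uv: "a \<le> u" "u \<le> v" "v \<le> b"
  have "norm (h v - h u) \<le> C * (v - u)" using assms[OF uv] .
  also have "\<dots> \<le> max C 0 * (v - u)" using uv by (intro mult_right_mono) auto
  also have "\<dots> \<le> max C 0 * norm (v - u) + max C 0 * norm (v - u)" using uv by simp
  finally show "norm (h v - h u) \<le> max C 0 * norm (v - u) + max C 0 * norm (v - u)" .
qed

lemma C1_imp_absolutely_continuous_on:
  fixes f :: "real \<Rightarrow> 'a::real_normed_vector"
  assumes f: "\<And>x. x \<in> {a..b} \<Longrightarrow> (f has_vector_derivative f' x) (at x within {a..b})"
    and cont: "continuous_on {a..b} f'"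
  shows "absolutely_continuous_on {a..b} f"
proof -
  obtain B where B: "\<And>x. x \<in> {a..b} \<Longrightarrow> norm (f' x) \<le> B"
    using continuous_on_Icc_bounded[OF cont] by metis
  show ?thesis
  proof (rule Lipschitz_imp_absolutely_continuous_on)
    fix u v assume uv: "a \<le> u" "u \<le> v" "v \<le> b"
    have "norm (f v - f u) \<le> B * norm (v - u)"
    proof (rule differentiable_bound[of "{u..v}" f "\<lambda>x h. h *\<^sub>R f' x"])
      fix x assume x: "x \<in> {u..v}"
      show "(f has_derivative (\<lambda>h. h *\<^sub>R f' x)) (at x within {u..v})"
        using f[of x] x uv unfolding has_vector_derivative_def
        by (auto intro: has_derivative_subset)
      show "onorm (\<lambda>h. h *\<^sub>R f' x) \<le> B"
        using B[of x] x uv by (intro onorm_bound) (auto simp: mult.commute[of B] intro!: mult_left_mono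
             intro: order_trans[OF norm_ge_zero])
    qed (use uv in auto)
    then show "norm (f v - f u) \<le> B * (v - u)" using uv by simp
  qed
qed

lemma absolutely_continuous_on_bounded_bilinear:
  assumes bil: "bounded_bilinear mul" and f: "absolutely_continuous_on {a..b} f" and g: "absolutely_continuous_on {a..b} g"
  shows "absolutely_continuous_on {a..b} (\<lambda>x. mul (f x) (g x))"
proof -
  interpret bounded_bilinear mul by (rule bil)
  obtain F where F: "\<And>x. x \<in> {a..b} \<Longrightarrow> norm (f x) \<le> F"
    using continuous_on_Icc_bounded[OF absolutely_continuous_imp_continuous_on[OF f]] by metis
  obtain G where G: "\<And>x. x \<in> {a..b} \<Longrightarrow> norm (g x) \<le> G"
    using continuous_on_Icc_bounded[OF absolutely_continuous_imp_continuous_on[OF g]] by metis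
  obtain K where K: "K > 0" "\<And>x y. norm (mul x y) \<le> norm x * norm y * K"
    using pos_bounded by blast
  define C where "C = max F G * K"
  show ?thesis
  proof (rule absolutely_continuous_on_combine[OF f g])
    fix u v assume uv: "a \<le> u" "u \<le> v" "v \<le> b"
    have "mul (f v) (g v) - mul (f u) (g u) = mul (f v - f u) (g v) + mul (f u) (g v - g u)"
      by (simp add: diff_left diff_right)
    then have "norm (mul (f v) (g v) - mul (f u) (g u)) \<le> norm (mul (f v - f u) (g v)) + norm (mul (f u) (g v - g u))"
      by (simp add: norm_triangle_ineq)
    also have "\<dots> \<le> norm (f v - f u) * norm (g v) * K + norm (f u) * norm (g v - g u) * K"
      by (intro add_mono K)
    also have "\<dots> \<le> norm (f v - f u) * max F G * K + max F G * norm (g v - g u) * K"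
      using F[of u] G[of v] uv K(1)
      by (intro add_mono mult_right_mono mult_left_mono) auto
    finally show "norm (mul (f v) (g v) - mul (f u) (g u)) \<le> C * norm (f v - f u) + C * norm (g v - g u)"
      unfolding C_def by (simp add: mult_ac)
  qed
qed

lemma absolutely_continuous_on_bounded_linear:
  assumes "bounded_linear h" and f: "absolutely_continuous_on {a..b} f"
  shows "absolutely_continuous_on {a..b} (\<lambda>x. h (f x))"
proof -
  interpret bounded_linear h by fact
  obtain K where K: "K > 0" "\<And>x. norm (h x) \<le> norm x * K" using pos_bounded by blast
  show ?thesis
  proof (rule absolutely_continuous_on_combine[OF f f])
    fix u v
    have "norm (h (f v) - h (f u)) \<le> norm (f v - f u) * K" using K(2)[of "f v - f u"] by (simp add: diff)
    also have "\<dots> \<le> K * norm (f v - f u) + K * norm (f v - f u)" using K(1) by simp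
    finally show "norm (h (f v) - h (f u)) \<le> K * norm (f v - f u) + K * norm (f v - f u)" .
  qed
qed

lemma absolutely_continuous_on_diff:
  assumes "absolutely_continuous_on {a..b} f" "absolutely_continuous_on {a..b} g"
  shows "absolutely_continuous_on {a..b} (\<lambda>x. f x - g x)"
proof (rule absolutely_continuous_on_combine[OF assms])
  fix u v
  have "f v - g v - (f u - g u) = (f v - f u) - (g v - g u)" by simp
  then show "norm (f v - g v - (f u - g u)) \<le> 1 * norm (f v - f u) + 1 * norm (g v - g u)"
    using norm_triangle_ineq4[of "f v - f u" "g v - g u"] by (metis mult_1)
qed

text \<open>
  The proof works with Riemann sums for the Henstock--Kurzweil integral. The gauge is chosen by
  differentiability off \<open>N\<close>; on \<open>N\<close>, where the integrand may be replaced by \<open>0\<close>, it keeps the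
  intervals inside an open set of small measure, and absolute continuity bounds the sum of the
  increments of \<open>f\<close> over these intervals.
\<close>

theorem fundamental_theorem_of_calculus_absolutely_continuous:
  fixes f :: "real \<Rightarrow> 'a::banach"
  assumes "a \<le> b" and ac: "absolutely_continuous_on {a..b} f" and N: "negligible N"
    and deriv: "\<And>x. x \<in> {a..b} - N \<Longrightarrow> (f has_vector_derivative f' x) (at x within {a..b})"
  shows "(f' has_integral (f b - f a)) {a..b}"
proof -
  define h where "h x = (if x \<in> N then 0 else f' x)" for x
  have "(h has_integral (f b - f a)) (cbox a b)"
    unfolding has_integral
  proof (intro allI impI)
    fix e :: real assume "e > 0"
    define e1 where "e1 = e / (2 * (b - a + 1))"
    have e1: "e1 > 0" "e1 * (b - a) < e / 2"
      unfolding e1_def using \<open>e > 0\<close> \<open>a \<le> b\<close> by (auto simp: field_simps)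
    have "\<forall>x. \<exists>d>0. x \<in> {a..b} - N \<longrightarrow>
         (\<forall>y\<in>{a..b}. norm (y-x) < d \<longrightarrow> norm (f y - f x - (y-x) *\<^sub>R f' x) \<le> e1 * norm (y-x))"
      using deriv[unfolded has_vector_derivative_def has_derivative_within_alt] e1(1)
      by (meson zero_less_one)
    then obtain d where d: "\<And>x. 0 < d x"
      "\<And>x y. \<lbrakk>x \<in> {a..b} - N; y \<in> {a..b}; norm (y-x) < d x\<rbrakk>
                        \<Longrightarrow> norm (f y - f x - (y-x) *\<^sub>R f' x) \<le> e1 * norm (y-x)"
      by metis
    obtain \<delta> where \<delta>: "\<delta> > 0" "\<And>D X. D division_of X \<Longrightarrow> X \<subseteq> {a..b} \<Longrightarrow> (\<Sum>k\<in>D. Sup k - Inf k) < \<delta> \<Longrightarrow>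
       (\<Sum>k\<in>D. norm (f (Sup k) - f (Inf k))) < e / 2"
      using absolutely_continuous_onD[OF ac, of "e / 2"] \<open>e > 0\<close> by auto
    have Nnull: "N \<in> null_sets lebesgue" using N by (simp add: negligible_iff_null_sets)
    then have "N \<in> sets lebesgue" by blast
    then obtain U where U: "open U" "N \<subseteq> U" "U - N \<in> lmeasurable" "emeasure lebesgue (U - N) < ennreal \<delta>"
      using sets_lebesgue_outer_open[OF _ \<delta>(1)] by metis
    have Um: "U \<in> lmeasurable" "measure lebesgue U < \<delta>"
    proof -
      have em: "emeasure lebesgue U = emeasure lebesgue (U - N)"
        using Nnull U(1) by (intro emeasure_Diff_null_set[symmetric]) auto
      then show 1: "U \<in> lmeasurable"
        using U(1,4) by (intro fmeasurableI) (auto simp: top.not_eq_extremum intro: less_trans[OF _ ennreal_less_top])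
      show "measure lebesgue U < \<delta>"
        using U(4) em emeasure_eq_measure2[OF 1] \<delta>(1)
          ennreal_less_iff[OF measure_nonneg, of lebesgue U \<delta>] by simp
    qed
    define \<gamma> where "\<gamma> x = (if x \<in> N then U else ball x (d x))" for x
    have gauge: "gauge \<gamma>" unfolding gauge_def \<gamma>_def using U(1,2) d(1) by auto
    have fine_sum: "norm ((\<Sum>(x, k)\<in>p. measure lborel k *\<^sub>R h x) - (f b - f a)) < e"
      if ptag: "p tagged_division_of cbox a b" and fine: "\<gamma> fine p" for p
    proof -
      have fin: "finite p" using ptag by blast
      \<comment> \<open>the intervals tagged in \<open>N\<close>, estimated by absolute continuity, and the others\<close>
      define p1 where "p1 = {(x, k) \<in> p. x \<in> N}"
      define p2 where "p2 = p - p1"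
      have p1p: "p1 \<subseteq> p" unfolding p1_def by auto
      have bounds: "\<exists>u v. K = {u..v} \<and> u \<le> x \<and> x \<le> v \<and> a \<le> u \<and> v \<le> b" if xK: "(x, K) \<in> p" for x K
      proof -
        obtain u v where k: "K = cbox u v" "x \<in> K" "K \<subseteq> cbox a b"
          using tagged_division_ofD(2-4)[OF ptag xK] by blast
        then have "u \<in> K" "v \<in> K" by auto
        with k show ?thesis by (intro exI[of _ u] exI[of _ v]) auto
      qed
      have fba: "f b - f a = (\<Sum>(x,K)\<in>p. f(Sup K) - f(Inf K))"
        and ba: "b - a = (\<Sum>(x,K)\<in>p. Sup K - Inf K)"
        using additive_tagged_division_1[where f= f] additive_tagged_division_1[where f= "\<lambda>x. x"]
          \<open>a \<le> b\<close> ptag by auto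
      define t where "t xk = (case xk of (x, K) \<Rightarrow> measure lborel K *\<^sub>R h x - (f (Sup K) - f (Inf K)))" for xk
      have "(\<Sum>(x, k)\<in>p. measure lborel k *\<^sub>R h x) - (f b - f a) = sum t p"
        unfolding fba t_def by (simp add: sum_subtractf split_def)
      also have "\<dots> = sum t p1 + sum t p2"
        unfolding p2_def using fin p1p by (simp add: sum.subset_diff[of p1 p] add.commute)
      finally have split: "norm ((\<Sum>(x, k)\<in>p. measure lborel k *\<^sub>R h x) - (f b - f a)) \<le> norm (sum t p1) + norm (sum t p2)"
        by (simp add: norm_triangle_ineq)
      have "norm (sum t p2) \<le> (\<Sum>(x,K)\<in>p2. e1 * (Sup K - Inf K))"
      proof (rule sum_norm_le, safe)
        fix x K assume "(x, K) \<in> p2"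
        then have xK: "(x, K) \<in> p" "x \<notin> N" unfolding p2_def p1_def by auto
        obtain u v where k: "K = {u..v}" "u \<le> x" "x \<le> v" "a \<le> u" "v \<le> b"
          using bounds[OF xK(1)] by blast
        have "K \<subseteq> \<gamma> x" using fine xK(1) unfolding fine_def by blast
        then have "K \<subseteq> ball x (d x)" using xK(2) by (simp add: \<gamma>_def)
        moreover have "u \<in> K" "v \<in> K" using k by auto
        ultimately have "u \<in> ball x (d x)" "v \<in> ball x (d x)" by blast+
        then have uv: "\<bar>u - x\<bar> < d x" "\<bar>v - x\<bar> < d x"
          by (auto simp: dist_real_def abs_minus_commute)
        have "norm ((v - u) *\<^sub>R f' x - (f v - f u))
            = norm (f u - f x - (u - x) *\<^sub>R f' x - (f v - f x - (v - x) *\<^sub>R f' x))"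
          by (auto simp: algebra_simps)
        also have "\<dots> \<le> norm (f u - f x - (u - x) *\<^sub>R f' x) + norm (f v - f x - (v - x) *\<^sub>R f' x)"
          by (rule norm_triangle_ineq4)
        also have "\<dots> \<le> e1 * norm (u - x) + e1 * norm (v - x)"
          using k uv xK by (intro add_mono d(2)) auto
        also have "\<dots> = e1 * (v - u)" using k by (simp add: algebra_simps)
        finally show "norm (t (x, K)) \<le> e1 * (Sup K - Inf K)"
          using k xK by (simp add: t_def h_def)
      qed
      also have "\<dots> \<le> (\<Sum>(x,K)\<in>p. e1 * (Sup K - Inf K))"
      proof (rule sum_mono2[OF fin], safe)
        fix x K assume "(x, K) \<in> p"
        then show "0 \<le> e1 * (Sup K - Inf K)"
          using bounds e1(1) by fastforce
      qed (auto simp: p2_def)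
      also have "\<dots> = e1 * (b - a)"
        unfolding ba by (simp add: sum_distrib_left split_def)
      finally have n2: "norm (sum t p2) < e / 2" using e1(2) by linarith
      have p1tag: "p1 tagged_division_of \<Union>(snd ` p1)"
        using tagged_partial_division_of_Union_self tagged_partial_division_subset[OF _ p1p]
          ptag[unfolded tagged_division_of_def] by blast
      then have div: "(snd ` p1) division_of \<Union>(snd ` p1)"
        by (rule division_of_tagged_division)
      have norm1: "norm (sum t p1) \<le> (\<Sum>(x,K)\<in>p1. if K = {} then 0 else norm (f (Sup K) - f (Inf K)))"
      proof (rule sum_norm_le, safe)
        fix x K assume "(x, K) \<in> p1"
        then have "x \<in> N" "K \<noteq> {}" using bounds unfolding p1_def by fastforce+
        then show "norm (t (x, K)) \<le> (if K = {} then 0 else norm (f (Sup K) - f (Inf K)))"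
          by (simp add: t_def h_def norm_minus_commute)
      qed
      \<comment> \<open>An interval may carry several tags, but then it is degenerate and contributes nothing; the
        value at the empty set is fixed because \<open>Sup\<close> and \<open>Inf\<close> need not agree there.\<close>
      also have "\<dots> = (\<Sum>K\<in>snd ` p1. if K = {} then 0 else norm (f (Sup K) - f (Inf K)))"
      proof (rule sum.over_tagged_division_lemma[OF p1tag])
        fix u v :: real assume "box u v = {}"
        then have "u \<ge> v" by simp
        then consider "cbox u v = {}" | "u = v" by fastforce
        then show "(if cbox u v = {} then 0 else norm (f (Sup (cbox u v)) - f (Inf (cbox u v)))) = 0"
          by cases auto
      qed
      also have "\<dots> = (\<Sum>K\<in>snd ` p1. norm (f (Sup K) - f (Inf K)))"
        by (rule sum.cong) (use division_ofD(3)[OF div] in auto)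
      also have "\<dots> < e / 2"
      proof (rule \<delta>(2)[OF div])
        have "K \<subseteq> {a..b}" if "(x, K) \<in> p" for x K
          using bounds[OF that] by auto
        then show "\<Union> (snd ` p1) \<subseteq> {a..b}"
          using p1p by (force simp del: atLeastAtMost_iff)
        have "K \<subseteq> U" if "(x, K) \<in> p" "x \<in> N" for x K
        proof -
          have "K \<subseteq> \<gamma> x" using fine that(1) unfolding fine_def by blast
          then show ?thesis using that(2) by (simp add: \<gamma>_def)
        qed
        then have UU: "\<Union> (snd ` p1) \<subseteq> U"
          unfolding p1_def by (simp add: Sup_le_iff image_iff) blast
        have "(\<Sum>K\<in>snd ` p1. Sup K - Inf K) = (\<Sum>K\<in>snd ` p1. measure lebesgue K)"
        proof (rule sum.cong)
          fix K assume "K \<in> snd ` p1"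
          then obtain u v where "K = {u..v}" "u \<le> v"
            using division_interval_bounds[OF div] by metis
          then show "Sup K - Inf K = measure lebesgue K" by simp
        qed simp
        also have "\<dots> = measure lebesgue (\<Union> (snd ` p1))"
          using content_division[OF div] by simp
            also have "\<dots> \<le> measure lebesgue U"
          using UU Um(1) div by (intro measure_mono_fmeasurable) (auto dest: lmeasurable_division)
        finally show "(\<Sum>K\<in>snd ` p1. Sup K - Inf K) < \<delta>" using Um(2) by linarith
      qed
      finally show ?thesis using split n2 by linarith
    qed
    show "\<exists>\<gamma>. gauge \<gamma> \<and> (\<forall>p. p tagged_division_of cbox a b \<and> \<gamma> fine p \<longrightarrow>
       norm ((\<Sum>(x, k)\<in>p. measure lborel k *\<^sub>R h x) - (f b - f a)) < e)"
      using gauge fine_sum by (intro exI[of _ \<gamma>]) simp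
  qed
  then have "(h has_integral (f b - f a)) {a..b}" by simp
  then show ?thesis
    by (rule has_integral_spike[OF N, rotated]) (auto simp: h_def)
qed

lemma absolutely_continuous_on_subset:
  assumes "absolutely_continuous_on S f" "S' \<subseteq> S"
  shows "absolutely_continuous_on S' f"
  unfolding absolutely_continuous_on_def
proof (intro allI impI)
  fix e :: real assume "e > 0"
  then obtain d where "d > 0" "\<And>D X. D division_of X \<Longrightarrow> X \<subseteq> S \<Longrightarrow> (\<Sum>k\<in>D. Sup k - Inf k) < d \<Longrightarrow>
       (\<Sum>k\<in>D. norm (f (Sup k) - f (Inf k))) < e"
    using absolutely_continuous_onD[OF assms(1)] by blast
  then show "\<exists>d>0. \<forall>D X. D division_of X \<and> X \<subseteq> S' \<and> (\<Sum>k\<in>D. Sup k - Inf k) < d \<longrightarrow>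
      (\<Sum>k\<in>D. norm (f (Sup k) - f (Inf k))) < e"
    using assms(2) by (intro exI[of _ d]) (auto dest: order_trans)
qed

lemma integral_absolutely_continuous_eq:
  fixes f :: "real \<Rightarrow> 'a::euclidean_space"
  assumes "a \<le> b" and ac: "absolutely_continuous_on {a..b} f" and N: "negligible N"
    and deriv: "\<And>x. x \<in> {a..b} - N \<Longrightarrow> (f has_vector_derivative f' x) (at x within {a..b})"
    and int: "integrable lborel (\<lambda>x. indicator {a..b} x *\<^sub>R f' x)"
  shows "(LINT x|lborel. indicator {a..b} x *\<^sub>R f' x) = f b - f a"
proof -
  have "(f' has_integral (f b - f a)) {a..b}"
    by (rule fundamental_theorem_of_calculus_absolutely_continuous[OF assms(1) ac N deriv])
  moreover have "(\<lambda>x. indicator {a..b} x *\<^sub>R f' x) = (\<lambda>x. if x \<in> {a..b} then f' x else 0)"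
    by (auto simp: fun_eq_iff)
  ultimately have "((\<lambda>x. indicator {a..b} x *\<^sub>R f' x) has_integral (f b - f a)) UNIV"
    by (simp only: has_integral_restrict_UNIV)
  with has_integral_integral_lborel[OF int] show ?thesis
    by (rule has_integral_unique)
qed

lemma negligible_imp_AE_lborel: "negligible N \<Longrightarrow> AE x in lborel. x \<notin> N"
  using AE_not_in[of N lebesgue] by (simp add: negligible_iff_null_sets AE_completion_iff)

section \<open>Fixed points of Volterra maps\<close>

lemma integral_exp_atLeastAtMost_le:
  fixes l x :: real
  assumes "l > 0"
  shows "integrable lborel (\<lambda>s. indicator {0..x} s * exp (l * s))"
    and "(LINT s|lborel. indicator {0..x} s * exp (l * s)) \<le> exp (l * x) / l"
proof -
  have "set_integrable lborel {0..x} (\<lambda>s. exp (l * s))"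
    by (intro borel_integrable_atLeastAtMost' continuous_intros)
  then show "integrable lborel (\<lambda>s. indicator {0..x} s * exp (l * s))"
    unfolding set_integrable_def by simp
  show "(LINT s|lborel. indicator {0..x} s * exp (l * s)) \<le> exp (l * x) / l"
  proof (cases "0 \<le> x")
    case True
    have "(LINT s|lborel. exp (l * s) * indicator {0..x} s) = exp (l * x) / l - exp (l * 0) / l"
      using assms by (intro integral_FTC_Icc_real[OF True]) (auto intro!: derivative_eq_intros)
    then show ?thesis using assms by (simp add: mult.commute)
  qed (use assms in simp)
qed

text \<open>
  The integral on the left is \<open>exp (l * x)\<close> times a convolution of \<open>w\<close> with a decaying exponential,
  which tends to \<open>0\<close> uniformly in \<open>x\<close> as \<open>l\<close> grows. This is what turns a Volterra map with a square
  integrable weight into a contraction.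
\<close>

lemma exponential_weight_small:
  fixes w :: "real \<Rightarrow> real"
  assumes [measurable]: "w \<in> borel_measurable borel" and w2: "integrable lborel (\<lambda>s. (w s)\<^sup>2)" and "e > 0"
  obtains l where "l > 0"
    "\<And>x. (LINT s|lborel. indicator {0..x} s * (w s * exp (l * s))) \<le> e * exp (l * x)"
proof -
  define P where "P = (LINT s|lborel. (w s)\<^sup>2)"
  have P0: "P \<ge> 0" unfolding P_def by simp
  \<comment> \<open>Young's inequality with parameter \<open>d\<close>, chosen so that the \<open>w\<^sup>2\<close> part costs at most \<open>e/2\<close>;
    then \<open>l\<close> is chosen so that the exponential part costs \<open>e/2\<close> as well.\<close>
  define d where "d = e / (P + 1)"
  have d: "d > 0" "d * P \<le> e" unfolding d_def using P0 \<open>e > 0\<close> by (auto simp: field_simps)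
  define l where "l = 1 / (2 * d * e)"
  have l: "l > 0" unfolding l_def using d \<open>e > 0\<close> by simp
  show thesis
  proof
    fix x
    let ?E = "\<lambda>s. indicator {0..x} s * exp (2 * l * s)"
    let ?R = "\<lambda>s. exp (l * x) * (d / 2) * (w s)\<^sup>2 + exp (- (l * x)) / (2 * d) * ?E s"
    have E: "integrable lborel ?E" "(LINT s|lborel. ?E s) \<le> exp (2 * l * x) / (2 * l)"
      using integral_exp_atLeastAtMost_le[of "2 * l" x] l by auto
    have le: "indicator {0..x} s * (w s * exp (l * s)) \<le> ?R s" for s
    proof (cases "s \<in> {0..x}")
      case True
      define q where "q = exp (l * (s - x))"
      have "0 \<le> (d * w s - q)\<^sup>2" by simp
      then have "w s * q \<le> d / 2 * (w s)\<^sup>2 + q\<^sup>2 / (2 * d)"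
        using d(1) by (simp add: field_simps power2_eq_square)
      then have "exp (l * x) * (w s * q) \<le> exp (l * x) * (d / 2 * (w s)\<^sup>2 + q\<^sup>2 / (2 * d))"
        by (intro mult_left_mono) auto
      moreover have "exp (l * x) * q = exp (l * s)" unfolding q_def by (simp add: exp_add[symmetric] algebra_simps)
      moreover have "exp (l * x) * q\<^sup>2 = exp (- (l * x)) * exp (2 * l * s)"
        unfolding q_def by (simp add: exp_add[symmetric] exp_double[symmetric] algebra_simps)
      ultimately have "w s * exp (l * s) \<le> exp (l * x) * (d / 2) * (w s)\<^sup>2 + exp (- (l * x)) * exp (2 * l * s) / (2 * d)"
        by (simp add: distrib_left mult.left_commute[of _ "w s"] mult.assoc)
      then show ?thesis using True by simp
    qed (use d(1) in simp)
    have "(LINT s|lborel. indicator {0..x} s * (w s * exp (l * s))) \<le> (LINT s|lborel. ?R s)"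
    proof (rule integral_mono')
      show "integrable lborel ?R" using w2 E by auto
      show "0 \<le> ?R s" for s using d(1) by simp
    qed (rule le)
    also have "\<dots> = exp (l * x) * (d / 2) * P + exp (- (l * x)) / (2 * d) * (LINT s|lborel. ?E s)"
      unfolding P_def using w2 E by simp
    also have "\<dots> \<le> exp (l * x) * (d / 2) * P + exp (- (l * x)) / (2 * d) * (exp (2 * l * x) / (2 * l))"
      using E(2) d(1) by (intro add_left_mono mult_left_mono) auto
    also have "exp (- (l * x)) / (2 * d) * (exp (2 * l * x) / (2 * l)) = exp (l * x) * (1 / (4 * d * l))"
      by (simp add: exp_add[symmetric])
    also have "1 / (4 * d * l) = e / 2" unfolding l_def using d \<open>e > 0\<close> by simp
    also have "exp (l * x) * (d / 2) * P + exp (l * x) * (e / 2) = exp (l * x) * ((d * P + e) / 2)"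
      by (simp add: field_simps)
    also have "\<dots> \<le> exp (l * x) * e" using d(2) by (intro mult_left_mono) auto
    finally show "(LINT s|lborel. indicator {0..x} s * (w s * exp (l * s))) \<le> e * exp (l * x)"
      by (simp add: mult.commute)
  qed (rule l)
qed

definition admissible :: "'a measure \<Rightarrow> 'a set \<Rightarrow> ('a \<Rightarrow> 'b::euclidean_space) \<Rightarrow> bool" where
  "admissible M D f \<longleftrightarrow>
     f \<in> borel_measurable M \<and> (\<forall>z. z \<notin> D \<longrightarrow> f z = 0) \<and> (\<exists>C. \<forall>z. norm (f z) \<le> C)"

lemma admissible_add:
  assumes "admissible M D f" "admissible M D g"
  shows "admissible M D (\<lambda>z. f z + g z)"
proof -
  from assms obtain F G where "\<And>z. norm (f z) \<le> F" "\<And>z. norm (g z) \<le> G"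
    unfolding admissible_def by blast
  then have "norm (f z + g z) \<le> F + G" for z by (meson add_mono norm_triangle_le)
  with assms show ?thesis unfolding admissible_def by auto
qed

lemma admissible_scaleR:
  assumes "admissible M D f"
  shows "admissible M D (\<lambda>z. c *\<^sub>R f z)"
proof -
  from assms obtain F where "\<And>z. norm (f z) \<le> F"
    unfolding admissible_def by blast
  then have "norm (c *\<^sub>R f z) \<le> \<bar>c\<bar> * F" for z by (simp add: mult_left_mono)
  with assms show ?thesis unfolding admissible_def by auto
qed

lemma admissible_minus: "admissible M D f \<Longrightarrow> admissible M D (\<lambda>z. - f z)"
  using admissible_scaleR[of M D f "-1"] by simp

lemma admissible_diff: "admissible M D f \<Longrightarrow> admissible M D g \<Longrightarrow> admissible M D (\<lambda>z. f z - g z)"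
  using admissible_add[OF _ admissible_minus, of M D f g] by simp

lemma admissible_zero: "admissible M D (\<lambda>z. 0)"
  unfolding admissible_def by auto

text \<open>
  The function \<open>p\<close> measures time: the value \<open>\<Phi> f z\<close> is controlled by the values of \<open>f\<close> at times up
  to \<open>p z\<close>, with weight \<open>w\<close>. In the norm weighted by \<open>exp (- l * p z)\<close> with \<open>l\<close> large, \<open>\<Phi>\<close> halves
  distances, so the iterates converge geometrically. The lemma is used both for kernels, where \<open>p\<close>
  is the first variable, and through them for a linear differential equation.
\<close>

theorem volterra_fixed_point:
  fixes \<Phi> :: "('a \<Rightarrow> 'b::euclidean_space) \<Rightarrow> 'a \<Rightarrow> 'b" and w :: "real \<Rightarrow> real" and p :: "'a \<Rightarrow> real"
  assumes w: "w \<in> borel_measurable borel" "integrable lborel (\<lambda>s. (w s)\<^sup>2)"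
    and p: "\<And>z. z \<in> D \<Longrightarrow> 0 \<le> p z \<and> p z \<le> T"
    and g: "admissible M D g"
    and adm: "\<And>f. admissible M D f \<Longrightarrow> admissible M D (\<Phi> f)"
    and diff: "\<And>f h. admissible M D f \<Longrightarrow> admissible M D h \<Longrightarrow> \<Phi> (\<lambda>z. f z - h z) = (\<lambda>z. \<Phi> f z - \<Phi> h z)"
    and bound: "\<And>f C l z. admissible M D f \<Longrightarrow> 0 < l \<Longrightarrow> 0 \<le> C \<Longrightarrow>
        (\<And>y. y \<in> D \<Longrightarrow> norm (f y) \<le> C * exp (l * p y)) \<Longrightarrow> z \<in> D \<Longrightarrow>
        norm (\<Phi> f z) \<le> C * (LINT s|lborel. indicator {0..p z} s * (w s * exp (l * s)))"
  obtains f where "admissible M D f" "\<And>z. f z = g z + \<Phi> f z"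
proof -
  obtain l where l: "l > 0" "\<And>x. (LINT s|lborel. indicator {0..x} s * (w s * exp (l * s))) \<le> 1/2 * exp (l * x)"
    using exponential_weight_small[OF w, of "1/2"] by auto
  have half: "norm (\<Phi> f z) \<le> C / 2 * exp (l * p z)"
    if "admissible M D f" "0 \<le> C" "\<And>y. y \<in> D \<Longrightarrow> norm (f y) \<le> C * exp (l * p y)" "z \<in> D" for f C z
    using bound[OF that(1) l(1) that(2,3,4)] mult_left_mono[OF l(2)[of "p z"] that(2)] by simp
  have off: "f z = 0" if "admissible M D f" "z \<notin> D" for f z
    using that unfolding admissible_def by blast
  define F where "F = rec_nat (\<lambda>z. 0) (\<lambda>n f z. g z + \<Phi> f z)"
  have F0: "F 0 = (\<lambda>z. 0)" and FS: "F (Suc n) = (\<lambda>z. g z + \<Phi> (F n) z)" for n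
    unfolding F_def by auto
  have Fadm: "admissible M D (F n)" for n
    by (induction n) (auto simp: F0 FS intro: admissible_zero admissible_add g adm)
  obtain G where G: "\<And>z. norm (g z) \<le> G" using g unfolding admissible_def by blast
  have "G \<ge> 0" using norm_ge_zero[of "g undefined"] G[of undefined] by linarith
  define d where "d n z = F (Suc n) z - F n z" for n z
  have dadm: "admissible M D (d n)" for n
    unfolding d_def by (intro admissible_diff Fadm)
  have dS: "d (Suc n) = \<Phi> (d n)" for n
  proof -
    have "\<Phi> (d n) = (\<lambda>z. \<Phi> (F (Suc n)) z - \<Phi> (F n) z)"
      unfolding d_def by (rule diff[OF Fadm Fadm])
    then show ?thesis by (simp add: d_def FS fun_eq_iff)
  qed
  have \<Phi>0: "\<Phi> (\<lambda>z. 0) z = 0" for z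
    using fun_cong[OF diff[OF admissible_zero admissible_zero], of z] by simp
  let ?e = "\<lambda>z. exp (l * p z)"
  have d_le: "z \<in> D \<Longrightarrow> norm (d n z) \<le> G * (1/2) ^ n * ?e z" for n z
  proof (induction n arbitrary: z)
    case 0
    have "norm (d 0 z) = norm (g z)" by (simp add: d_def FS F0 \<Phi>0)
    also have "\<dots> \<le> G * 1" using G by simp
    also have "\<dots> \<le> G * ?e z" using p[OF 0] l(1) \<open>G \<ge> 0\<close> by (intro mult_left_mono) auto
    finally show ?case by simp
  next
    case (Suc n)
    show ?case
      unfolding dS using half[OF dadm, of "G * (1/2) ^ n"] Suc \<open>G \<ge> 0\<close> by simp
  qed
  have d_le': "norm (d n z) \<le> (G * ?e z) * (1/2) ^ n" for n z
    using d_le[of z n] off[OF dadm, of z n] \<open>G \<ge> 0\<close> by (cases "z \<in> D") (auto simp: mult_ac)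
  have smG: "summable (\<lambda>n. (G * ?e z) * (1/2) ^ n)" for z
    by (intro summable_mult summable_geometric) simp
  have summ: "summable (\<lambda>n. d n z)" for z
    by (rule summable_comparison_test[OF _ smG[of z]]) (use d_le' in auto)
  have F_sum: "F n z = (\<Sum>k<n. d k z)" for n z
    by (induction n) (auto simp: d_def F0)
  define f where "f z = (\<Sum>n. d n z)" for z
  have lim: "(\<lambda>n. F n z) \<longlonglongrightarrow> f z" for z
    unfolding F_sum f_def by (rule summable_LIMSEQ[OF summ])
  have tail: "norm (f z - F n z) \<le> 2 * G * (1/2) ^ n * ?e z" for n z
  proof -
    have "f z - F n z = (\<Sum>k. d (k + n) z)"
      unfolding f_def F_sum by (rule suminf_minus_initial_segment[OF summ, symmetric])
    also have "norm \<dots> \<le> (\<Sum>k. (G * ?e z) * (1/2) ^ n * (1/2) ^ k)"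
    proof (rule order_trans[OF summable_norm suminf_le])
      show "summable (\<lambda>k. (G * ?e z) * (1/2) ^ n * (1/2) ^ k)"
        by (intro summable_mult summable_geometric) simp
      show le: "norm (d (k + n) z) \<le> (G * ?e z) * (1/2) ^ n * (1/2) ^ k" for k
        using d_le'[of "k + n" z] by (simp add: power_add mult_ac)
      show "summable (\<lambda>k. norm (d (k + n) z))"
        by (rule summable_comparison_test[OF _ \<open>summable (\<lambda>k. (G * ?e z) * (1/2) ^ n * (1/2) ^ k)\<close>])
           (use le in auto)
      then show "summable (\<lambda>k. norm (d (k + n) z))" .
    qed
    also have "\<dots> = 2 * G * (1/2) ^ n * ?e z"
      by (subst suminf_mult) (auto simp: suminf_geometric intro: summable_geometric)
    finally show ?thesis .
  qed
  have fadm: "admissible M D f"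
    unfolding admissible_def
  proof (intro conjI allI impI exI)
    show "f \<in> borel_measurable M"
      using Fadm unfolding admissible_def
      by (intro borel_measurable_LIMSEQ_metric[OF _ lim]) auto
    show "f z = 0" if "z \<notin> D" for z
      unfolding f_def using off[OF dadm that] by simp
    then show "norm (f z) \<le> 2 * G * exp (l * \<bar>T\<bar>)" for z
    proof (cases "z \<in> D")
      case True
      have "norm (f z) \<le> 2 * G * ?e z" using tail[of z 0] by (simp add: F0)
      also have "\<dots> \<le> 2 * G * exp (l * \<bar>T\<bar>)"
        using p[OF True] l(1) \<open>G \<ge> 0\<close> by (intro mult_left_mono) auto
      finally show ?thesis .
    qed (use \<open>G \<ge> 0\<close> in auto)
  qed
  have "f z = g z + \<Phi> f z" for z
  proof (cases "z \<in> D")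
    case True
    have le: "norm (\<Phi> f z - \<Phi> (F n) z) \<le> G * ?e z * (1/2) ^ n" for n
    proof -
      have "norm (\<Phi> (\<lambda>z. f z - F n z) z) \<le> 2 * G * (1/2) ^ n / 2 * ?e z"
        using tail \<open>G \<ge> 0\<close> by (intro half admissible_diff fadm Fadm True) auto
      then show ?thesis using fun_cong[OF diff[OF fadm Fadm], of n z] by (simp add: mult_ac)
    qed
    have "(\<lambda>n. G * ?e z * (1/2) ^ n) \<longlonglongrightarrow> 0"
      by (intro tendsto_mult_right_zero LIMSEQ_power_zero) simp
    then have "(\<lambda>n. \<Phi> f z - \<Phi> (F n) z) \<longlonglongrightarrow> 0"
      by (rule Lim_null_comparison[rotated]) (use le in auto)
    then have "(\<lambda>n. g z + (\<Phi> f z - (\<Phi> f z - \<Phi> (F n) z))) \<longlonglongrightarrow> g z + (\<Phi> f z - 0)"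
      by (intro tendsto_intros)
    then have "(\<lambda>n. F (Suc n) z) \<longlonglongrightarrow> g z + \<Phi> f z" by (simp add: FS)
    moreover have "(\<lambda>n. F (Suc n) z) \<longlonglongrightarrow> f z" using lim by (rule LIMSEQ_Suc)
    ultimately show ?thesis by (rule LIMSEQ_unique[rotated])
  next
    case False
    then show ?thesis using off[OF fadm] off[OF g] off[OF adm[OF fadm]] by simp
  qed
  with fadm show thesis by (rule that)
qed

section \<open>Bounded Volterra kernels\<close>

text \<open>
  Every exchange of integrals below is justified by a bound of this product form.
\<close>

lemma (in pair_sigma_finite) integrable_product_bound:
  fixes F :: "'a \<Rightarrow> 'b \<Rightarrow> 'c::{banach, second_countable_topology}"
  assumes F [measurable]: "(\<lambda>(x, y). F x y) \<in> borel_measurable (M1 \<Otimes>\<^sub>M M2)"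
    and le: "\<And>x y. norm (F x y) \<le> p x * q y"
    and p: "integrable M1 p" and q: "integrable M2 (q :: 'b \<Rightarrow> real)"
  shows "integrable (M1 \<Otimes>\<^sub>M M2) (\<lambda>(x, y). F x y)"
proof (rule Fubini_integrable)
  have [measurable]: "p \<in> borel_measurable M1" "q \<in> borel_measurable M2" using p q by auto
  have inner: "integrable M2 (\<lambda>y. F x y)" if "x \<in> space M1" for x
  proof (rule Bochner_Integration.integrable_bound)
    show "integrable M2 (\<lambda>y. p x * q y)" using q by simp
    show "F x \<in> borel_measurable M2" using that by measurable
    show "AE y in M2. norm (F x y) \<le> norm (p x * q y)"
      using le by (intro AE_I2) (smt (verit) real_norm_def)
  qed
  show "integrable M1 (\<lambda>x. LINT y|M2. norm (case (x, y) of (x, y) \<Rightarrow> F x y))"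
  proof (rule Bochner_Integration.integrable_bound)
    show "integrable M1 (\<lambda>x. p x * (LINT y|M2. q y))" using p by simp
    show "AE x in M1. norm (LINT y|M2. norm (case (x, y) of (x, y) \<Rightarrow> F x y)) \<le> norm (p x * (LINT y|M2. q y))"
    proof (rule AE_I2)
      fix x assume x: "x \<in> space M1"
      have "(LINT y|M2. norm (F x y)) \<le> (LINT y|M2. p x * q y)"
        using inner[OF x] q le by (intro integral_mono) auto
      then show "norm (LINT y|M2. norm (case (x, y) of (x, y) \<Rightarrow> F x y)) \<le> norm (p x * (LINT y|M2. q y))"
        by simp
    qed
  qed simp
  show "AE x in M1. integrable M2 (\<lambda>y. case (x, y) of (x, y) \<Rightarrow> F x y)"
    using inner by (intro AE_I2) simp
qed measurable

text \<open>
  The kernels vanish off the triangle, so that all integrals can be taken over the whole line and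
  compositions of kernels need no case distinction on the limits of integration.
\<close>

abbreviation volterra_kernel :: "real \<Rightarrow> (real \<Rightarrow> real \<Rightarrow> 'b::euclidean_space) \<Rightarrow> bool" where
  "volterra_kernel T k \<equiv> admissible (borel \<Otimes>\<^sub>M borel) (volterra_triangle T) (\<lambda>(x, t). k x t)"

lemma volterra_kernelD:
  assumes "volterra_kernel T k"
  shows "(\<lambda>(x, t). k x t) \<in> borel_measurable (borel \<Otimes>\<^sub>M borel)"
    and "\<not> (0 \<le> t \<and> t \<le> x \<and> x \<le> T) \<Longrightarrow> k x t = 0"
    and "\<exists>C\<ge>0. \<forall>x t. norm (k x t) \<le> C"
proof -
  show "(\<lambda>(x, t). k x t) \<in> borel_measurable (borel \<Otimes>\<^sub>M borel)"
    using assms unfolding admissible_def by simp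
  show "\<not> (0 \<le> t \<and> t \<le> x \<and> x \<le> T) \<Longrightarrow> k x t = 0"
    using assms unfolding admissible_def volterra_triangle_def by (auto dest!: spec[of _ x] spec[of _ t])
  obtain C where C: "norm (k x t) \<le> C" for x t using assms unfolding admissible_def by auto
  have "0 \<le> C" using norm_ge_zero C by (rule order_trans)
  with C show "\<exists>C\<ge>0. \<forall>x t. norm (k x t) \<le> C" by blast
qed

lemma volterra_kernelI:
  assumes "(\<lambda>(x, t). k x t) \<in> borel_measurable (borel \<Otimes>\<^sub>M borel)"
    and "\<And>x t. \<not> (0 \<le> t \<and> t \<le> x \<and> x \<le> T) \<Longrightarrow> k x t = 0"
    and "\<And>x t. norm (k x t) \<le> C"
  shows "volterra_kernel T k"
  unfolding admissible_def
proof (intro conjI allI impI exI)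
  show "(case z of (x, t) \<Rightarrow> k x t) = 0" if "z \<notin> volterra_triangle T" for z
    using that assms(2) by (cases z) (auto simp: volterra_triangle_def)
  show "norm (case z of (x, t) \<Rightarrow> k x t) \<le> C" for z
    using assms(3) by (cases z) simp
qed (rule assms(1))

definition kernel_op :: "(real \<Rightarrow> real \<Rightarrow> complex ^ 'n ^ 'n) \<Rightarrow> (real \<Rightarrow> complex ^ 'n) \<Rightarrow> real \<Rightarrow> complex ^ 'n" where
  "kernel_op k f x = (LINT t|lborel. k x t *v f t)"

text \<open>
  The middle factor \<open>c\<close> is the potential sandwiched between two Volterra operators. It is merely
  integrable, yet the composite kernel is again bounded.
\<close>

definition kernel_comp :: "(real \<Rightarrow> complex ^ 'n ^ 'n) \<Rightarrow> (real \<Rightarrow> real \<Rightarrow> complex ^ 'n ^ 'n) \<Rightarrow>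
    (real \<Rightarrow> real \<Rightarrow> complex ^ 'n ^ 'n) \<Rightarrow> real \<Rightarrow> real \<Rightarrow> complex ^ 'n ^ 'n" where
  "kernel_comp c k l x t = (LINT s|lborel. k x s ** (c s ** l s t))"

lemma norm_matrix_mult3_le:
  fixes A :: "complex ^ 'k ^ 'm" and B :: "complex ^ 'l ^ 'k" and C :: "complex ^ 'n ^ 'l"
  assumes "norm A \<le> a" "norm B \<le> b" "norm C \<le> c"
  shows "norm (A ** (B ** C)) \<le> a * (b * c)"
proof -
  have pos: "0 \<le> a" "0 \<le> b" "0 \<le> c" using assms norm_ge_zero order_trans by blast+
  have "norm (B ** C) \<le> b * c"
    by (rule order_trans[OF norm_matrix_matrix_mult_le]) (intro mult_mono assms pos norm_ge_zero)
  then show ?thesis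
    by (intro order_trans[OF norm_matrix_matrix_mult_le] mult_mono assms pos norm_ge_zero)
qed

lemma integrable_kernel_apply:
  fixes f :: "real \<Rightarrow> complex ^ 'n"
  assumes k: "volterra_kernel T k" and f: "integrable lborel f"
  shows "integrable lborel (\<lambda>t. k x t *v f t)"
proof -
  note [measurable] = volterra_kernelD(1)[OF k]
  obtain C where C: "C \<ge> 0" "\<And>x t. norm (k x t) \<le> C" using volterra_kernelD(3)[OF k] by blast
  show ?thesis
  proof (rule Bochner_Integration.integrable_bound)
    show "integrable lborel (\<lambda>t. C * norm (f t))" using f by simp
    show "(\<lambda>t. k x t *v f t) \<in> borel_measurable lborel" using f by measurable
    show "AE t in lborel. norm (k x t *v f t) \<le> norm (C * norm (f t))"
      using C by (intro AE_I2 order_trans[OF norm_matrix_vector_mult_le]) (auto intro: mult_right_mono)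
  qed
qed

lemma kernel_op_bound:
  fixes f :: "real \<Rightarrow> complex ^ 'n"
  assumes k: "volterra_kernel T k" and f: "integrable lborel f" and C: "\<And>x t. norm (k x t) \<le> C"
  shows "norm (kernel_op k f x) \<le> C * (LINT t|lborel. norm (f t))"
proof -
  have "norm (kernel_op k f x) \<le> (LINT t|lborel. norm (k x t *v f t))"
    unfolding kernel_op_def by (rule integral_norm_bound)
  also have "\<dots> \<le> (LINT t|lborel. C * norm (f t))"
    using integrable_kernel_apply[OF k f] f C
    by (intro integral_mono order_trans[OF norm_matrix_vector_mult_le] mult_right_mono) auto
  finally show ?thesis by simp
qed

lemma kernel_op_outside:
  assumes k: "volterra_kernel T k" and "x \<notin> {0..T}"
  shows "kernel_op k f x = 0"
proof -
  have "k x t = 0" for t using volterra_kernelD(2)[OF k, of t x] assms(2) by auto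
  then show ?thesis unfolding kernel_op_def by (simp add: mv.zero_left)
qed

lemma kernel_op_measurable:
  assumes k: "volterra_kernel T k" and f [measurable]: "f \<in> borel_measurable borel"
  shows "kernel_op k f \<in> borel_measurable borel"
proof -
  note [measurable] = volterra_kernelD(1)[OF k]
  have "(\<lambda>x. LINT t|lborel. k x t *v f t) \<in> borel_measurable borel" by measurable
  then show ?thesis unfolding kernel_op_def .
qed

lemma integrable_indicator_Icc: "integrable lborel (indicator {a..b::real} :: real \<Rightarrow> real)"
  by (rule integrable_real_indicator) (auto simp: emeasure_lborel_Icc_eq)

lemma integrable_bounded_Icc:
  fixes f :: "real \<Rightarrow> 'b::{banach, second_countable_topology}"
  assumes [measurable]: "f \<in> borel_measurable borel" and "\<And>x. x \<notin> {0..T} \<Longrightarrow> f x = 0" "\<And>x. norm (f x) \<le> C"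
  shows "integrable lborel f"
proof (rule Bochner_Integration.integrable_bound)
  show "integrable lborel (\<lambda>x. C * indicator {0..T} x)"
    using integrable_indicator_Icc by simp
  show "AE x in lborel. norm (f x) \<le> norm (C * indicator {0..T} x)"
  proof (rule AE_I2)
    fix x show "norm (f x) \<le> norm (C * indicator {0..T} x)"
      using assms(2)[of x] assms(3)[of x] by (cases "x \<in> {0..T}") auto
  qed
qed simp

lemma integrable_kernel_op:
  fixes f :: "real \<Rightarrow> complex ^ 'n"
  assumes k: "volterra_kernel T k" and f: "integrable lborel f"
  shows "integrable lborel (kernel_op k f)"
proof -
  obtain C where C: "C \<ge> 0" "\<And>x t. norm (k x t) \<le> C" using volterra_kernelD(3)[OF k] by blast
  show ?thesis
    using f kernel_op_bound[OF k f C(2)] kernel_op_outside[OF k]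
    by (intro integrable_bounded_Icc[of _ T] kernel_op_measurable[OF k]) auto
qed

lemma kernel_op_add:
  assumes k: "volterra_kernel T k" and "integrable lborel f" "integrable lborel g"
  shows "kernel_op k (\<lambda>t. f t + g t) x = kernel_op k f x + kernel_op k g x"
  unfolding kernel_op_def using assms
  by (simp add: matrix_vector_right_distrib integrable_kernel_apply[OF k])

lemma kernel_op_kernel_add:
  assumes k: "volterra_kernel T k" and l: "volterra_kernel T l" and f: "integrable lborel f"
  shows "kernel_op (\<lambda>x t. k x t + l x t) f x = kernel_op k f x + kernel_op l f x"
  unfolding kernel_op_def using f
  by (simp add: matrix_vector_mult_add_rdistrib integrable_kernel_apply[OF k] integrable_kernel_apply[OF l])

lemma kernel_op_kernel_diff:
  assumes k: "volterra_kernel T k" and l: "volterra_kernel T l" and f: "integrable lborel f"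
  shows "kernel_op (\<lambda>x t. k x t - l x t) f x = kernel_op k f x - kernel_op l f x"
  unfolding kernel_op_def using f
  by (simp add: mv.diff_left integrable_kernel_apply[OF k] integrable_kernel_apply[OF l])

lemma integrable_weighted_kernel_op:
  fixes f :: "real \<Rightarrow> complex ^ 'n"
  assumes l: "volterra_kernel T l" and c: "integrable lborel c" and f: "integrable lborel f"
  shows "integrable lborel (\<lambda>s. c s *v kernel_op l f s)"
proof -
  obtain C where C: "C \<ge> 0" "\<And>x t. norm (l x t) \<le> C" using volterra_kernelD(3)[OF l] by blast
  have m [measurable]: "kernel_op l f \<in> borel_measurable borel" using kernel_op_measurable[OF l] f by auto
  let ?B = "C * (LINT t|lborel. norm (f t))"
  show ?thesis
  proof (rule Bochner_Integration.integrable_bound)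
    show "integrable lborel (\<lambda>s. norm (c s) * ?B)" using c by simp
    show "(\<lambda>s. c s *v kernel_op l f s) \<in> borel_measurable lborel" using c by measurable
    show "AE s in lborel. norm (c s *v kernel_op l f s) \<le> norm (norm (c s) * ?B)"
    proof (intro AE_I2)
      fix s
      have "norm (c s *v kernel_op l f s) \<le> norm (c s) * ?B"
        by (rule order_trans[OF norm_matrix_vector_mult_le])
           (intro mult_left_mono kernel_op_bound[OF l f C(2)] norm_ge_zero)
      then show "norm (c s *v kernel_op l f s) \<le> norm (norm (c s) * ?B)" by simp
    qed
  qed
qed

lemma integrable_kernel_comp:
  fixes k l :: "real \<Rightarrow> real \<Rightarrow> complex ^ 'n ^ 'n"
  assumes k: "volterra_kernel T k" and l: "volterra_kernel T l" and c: "integrable lborel c"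
  shows "integrable lborel (\<lambda>s. k x s ** (c s ** l s t))"
proof -
  note [measurable] = volterra_kernelD(1)[OF k] volterra_kernelD(1)[OF l] borel_measurable_integrable[OF c]
  obtain C where C: "C \<ge> 0" "\<And>x t. norm (k x t) \<le> C" using volterra_kernelD(3)[OF k] by blast
  obtain E where E: "E \<ge> 0" "\<And>x t. norm (l x t) \<le> E" using volterra_kernelD(3)[OF l] by blast
  show ?thesis
  proof (rule Bochner_Integration.integrable_bound)
    show "integrable lborel (\<lambda>s. C * (norm (c s) * E))" using c by simp
    show "AE s in lborel. norm (k x s ** (c s ** l s t)) \<le> norm (C * (norm (c s) * E))"
      using norm_matrix_mult3_le[OF C(2) order_refl E(2)] C(1) E(1) by (intro AE_I2) simp
  qed measurable
qed

lemma kernel_comp_bound: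
  fixes k l :: "real \<Rightarrow> real \<Rightarrow> complex ^ 'n ^ 'n"
  assumes k: "volterra_kernel T k" and l: "volterra_kernel T l" and c: "integrable lborel c"
    and C: "\<And>x t. norm (k x t) \<le> C" and E: "\<And>x t. norm (l x t) \<le> E"
  shows "norm (kernel_comp c k l x t) \<le> C * ((LINT s|lborel. norm (c s)) * E)"
proof -
  have "norm (kernel_comp c k l x t) \<le> (LINT s|lborel. norm (k x s ** (c s ** l s t)))"
    unfolding kernel_comp_def by (rule integral_norm_bound)
  also have "\<dots> \<le> (LINT s|lborel. C * (norm (c s) * E))"
    using integrable_kernel_comp[OF k l c] c norm_matrix_mult3_le[OF C order_refl E]
    by (intro integral_mono) auto
  finally show ?thesis by simp
qed

lemma volterra_kernel_comp:
  fixes k l :: "real \<Rightarrow> real \<Rightarrow> complex ^ 'n ^ 'n"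
  assumes k: "volterra_kernel T k" and l: "volterra_kernel T l" and c: "integrable lborel c"
  shows "volterra_kernel T (kernel_comp c k l)"
proof -
  note [measurable] = volterra_kernelD(1)[OF k] volterra_kernelD(1)[OF l] borel_measurable_integrable[OF c]
  obtain C where C: "C \<ge> 0" "\<And>x t. norm (k x t) \<le> C" using volterra_kernelD(3)[OF k] by blast
  obtain E where E: "E \<ge> 0" "\<And>x t. norm (l x t) \<le> E" using volterra_kernelD(3)[OF l] by blast
  show ?thesis
  proof (rule volterra_kernelI)
    show "(\<lambda>(x, t). kernel_comp c k l x t) \<in> borel_measurable (borel \<Otimes>\<^sub>M borel)"
      unfolding kernel_comp_def by measurable
    show "norm (kernel_comp c k l x t) \<le> C * ((LINT s|lborel. norm (c s)) * E)" for x t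
      by (rule kernel_comp_bound[OF k l c C(2) E(2)])
    fix x t assume "\<not> (0 \<le> t \<and> t \<le> x \<and> x \<le> T)"
    then have "k x s = 0 \<or> l s t = 0" for s
      using volterra_kernelD(2)[OF k, of s x] volterra_kernelD(2)[OF l, of t s] by fastforce
    then have "k x s ** (c s ** l s t) = 0" for s
      by (metis mm.zero_left mm.zero_right)
    then show "kernel_comp c k l x t = 0" unfolding kernel_comp_def by simp
  qed
qed

text \<open>
  Fubini's theorem; it lets identities between operators be checked on kernels.
\<close>

theorem kernel_op_kernel_comp:
  fixes f :: "real \<Rightarrow> complex ^ 'n"
  assumes k: "volterra_kernel T k" and l: "volterra_kernel T l" and c: "integrable lborel c"
    and f: "integrable lborel f"
  shows "kernel_op (kernel_comp c k l) f x = kernel_op k (\<lambda>s. c s *v kernel_op l f s) x"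
proof -
  note [measurable] = volterra_kernelD(1)[OF k] volterra_kernelD(1)[OF l]
    borel_measurable_integrable[OF c] borel_measurable_integrable[OF f]
  obtain C where C: "C \<ge> 0" "\<And>x t. norm (k x t) \<le> C" using volterra_kernelD(3)[OF k] by blast
  obtain E where E: "E \<ge> 0" "\<And>x t. norm (l x t) \<le> E" using volterra_kernelD(3)[OF l] by blast
  let ?F = "\<lambda>t s. (k x s ** (c s ** l s t)) *v f t"
  have int: "integrable (lborel \<Otimes>\<^sub>M lborel) (\<lambda>(t, s). ?F t s)"
  proof (rule lborel_pair.integrable_product_bound)
    fix t s
    have "norm (?F t s) \<le> (C * (norm (c s) * E)) * norm (f t)"
      by (rule order_trans[OF norm_matrix_vector_mult_le])
         (intro mult_right_mono norm_matrix_mult3_le C E order_refl norm_ge_zero)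
    then show "norm (?F t s) \<le> norm (f t) * (C * (norm (c s) * E))" by (simp add: mult_ac)
  qed (use c f in \<open>measurable, auto\<close>)
  have "kernel_op (kernel_comp c k l) f x = (LINT t|lborel. LINT s|lborel. ?F t s)"
    unfolding kernel_op_def kernel_comp_def
    by (intro Bochner_Integration.integral_cong refl
         integral_bounded_linear[OF mv.bounded_linear_left, symmetric] integrable_kernel_comp[OF k l c])
  also have "\<dots> = (LINT s|lborel. LINT t|lborel. ?F t s)"
    by (rule lborel_pair.Fubini_integral[OF int, symmetric])
  also have "\<dots> = kernel_op k (\<lambda>s. c s *v kernel_op l f s) x"
    unfolding kernel_op_def
  proof (intro Bochner_Integration.integral_cong refl)
    fix s
    have "(LINT t|lborel. ?F t s) = (LINT t|lborel. (k x s ** c s) *v (l s t *v f t))"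
      by (simp add: matrix_vector_mul_assoc matrix_mul_assoc)
    also have "\<dots> = (k x s ** c s) *v (LINT t|lborel. l s t *v f t)"
      by (rule integral_bounded_linear[OF mv.bounded_linear_right integrable_kernel_apply[OF l f]])
    finally show "(LINT t|lborel. ?F t s) = k x s *v (c s *v (LINT t|lborel. l s t *v f t))"
      by (simp add: matrix_vector_mul_assoc)
  qed
  finally show ?thesis .
qed

text \<open>
  Plain composition of kernels is composition with this weight: the constant \<open>1\<close> is not integrable
  over the line, but only \<open>{0..T}\<close> matters.
\<close>

definition unit_weight :: "real \<Rightarrow> real \<Rightarrow> complex ^ 'n ^ 'n" where
  "unit_weight T s = indicator {0..T} s *\<^sub>R mat 1"

lemma integrable_unit_weight: "integrable lborel (unit_weight T)"
  unfolding unit_weight_def by (intro integrable_scaleR_left integrable_indicator_Icc)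

lemma kernel_comp_unit_weight:
  assumes k: "volterra_kernel T k"
  shows "kernel_comp (unit_weight T) k l x t = (LINT s|lborel. k x s ** l s t)"
  unfolding kernel_comp_def
proof (intro Bochner_Integration.integral_cong refl)
  fix s show "k x s ** (unit_weight T s ** l s t) = k x s ** l s t"
    using volterra_kernelD(2)[OF k, of s x]
    by (cases "s \<in> {0..T}") (auto simp: unit_weight_def mm.zero_left)
qed

lemma kernel_op_unit_weight:
  assumes k: "volterra_kernel T k"
  shows "kernel_op k (\<lambda>s. unit_weight T s *v h s) x = kernel_op k h x"
  unfolding kernel_op_def
proof (intro Bochner_Integration.integral_cong refl)
  fix s show "k x s *v (unit_weight T s *v h s) = k x s *v h s"
    using volterra_kernelD(2)[OF k, of s x]
    by (cases "s \<in> {0..T}") (auto simp: unit_weight_def mv.zero_left)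
qed

lemmas kernel_op_unit_comp = 
  trans[OF kernel_op_kernel_comp[OF _ _ integrable_unit_weight] kernel_op_unit_weight]

lemma volterra_kernel_equation:
  fixes k g :: "real \<Rightarrow> real \<Rightarrow> complex ^ 'n ^ 'n"
  assumes k: "volterra_kernel T k" and g: "volterra_kernel T g"
  obtains r where "volterra_kernel T r" "\<And>x t. r x t = g x t + (LINT s|lborel. k x s ** r s t)"
proof -
  obtain C where C: "C \<ge> 0" "\<And>x t. norm (k x t) \<le> C" using volterra_kernelD(3)[OF k] by blast
  let ?\<Phi> = "\<lambda>f z. kernel_comp (unit_weight T) k (curry f) (fst z) (snd z)"
  obtain f where f: "admissible (borel \<Otimes>\<^sub>M borel) (volterra_triangle T) f"
    "\<And>z. f z = (case z of (x, t) \<Rightarrow> g x t) + ?\<Phi> f z"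
  proof (rule volterra_fixed_point[where w = "\<lambda>s. C * indicator {0..T} s" and D = "volterra_triangle T"
          and p = fst and T = T and g = "\<lambda>(x, t). g x t" and M = "borel \<Otimes>\<^sub>M borel" and \<Phi> = ?\<Phi>])
    have "(\<lambda>s. (C * indicator {0..T} s)\<^sup>2) = (\<lambda>s. C\<^sup>2 * indicator {0..T} s)"
      by (auto simp: power_mult_distrib indicator_def)
    then show "integrable lborel (\<lambda>s. (C * indicator {0..T} s)\<^sup>2)"
      using integrable_indicator_Icc by simp
    show "0 \<le> fst z \<and> fst z \<le> T" if "z \<in> volterra_triangle T" for z
      using that by (auto simp: volterra_triangle_def)
  next
    fix f :: "real \<times> real \<Rightarrow> complex ^ 'n ^ 'n"
    assume "admissible (borel \<Otimes>\<^sub>M borel) (volterra_triangle T) f"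
    then have "volterra_kernel T (curry f)" by (simp add: curry_def)
    from volterra_kernel_comp[OF k this integrable_unit_weight[of T]]
    show "admissible (borel \<Otimes>\<^sub>M borel) (volterra_triangle T) (?\<Phi> f)"
      by (simp add: case_prod_beta' curry_def)
  next
    fix f h :: "real \<times> real \<Rightarrow> complex ^ 'n ^ 'n"
    assume "admissible (borel \<Otimes>\<^sub>M borel) (volterra_triangle T) f"
      and "admissible (borel \<Otimes>\<^sub>M borel) (volterra_triangle T) h"
    then have "volterra_kernel T (curry f)" "volterra_kernel T (curry h)" by (simp_all add: curry_def)
    note int = this[THEN integrable_kernel_comp[OF k _ integrable_unit_weight]]
    show "?\<Phi> (\<lambda>z. f z - h z) = (\<lambda>z. ?\<Phi> f z - ?\<Phi> h z)"
      using int by (simp add: kernel_comp_def curry_def mm.diff_right)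
  next
    fix f :: "real \<times> real \<Rightarrow> complex ^ 'n ^ 'n" and B l :: real and z
    assume f: "admissible (borel \<Otimes>\<^sub>M borel) (volterra_triangle T) f" and l: "0 < l" and B: "0 \<le> B"
      and le: "\<And>y. y \<in> volterra_triangle T \<Longrightarrow> norm (f y) \<le> B * exp (l * fst y)"
      and z: "z \<in> volterra_triangle T"
    obtain x t where xt: "z = (x, t)" "0 \<le> t" "t \<le> x" "x \<le> T"
      using z unfolding volterra_triangle_def by auto
    have fk: "volterra_kernel T (curry f)" using f by (simp add: curry_def)
    have "norm (?\<Phi> f z) \<le> (LINT s|lborel. norm (k x s ** (unit_weight T s ** curry f s t)))"
      unfolding kernel_comp_def xt by (simp add: integral_norm_bound)
    also have "\<dots> \<le> (LINT s|lborel. B * (indicator {0..x} s * (C * indicator {0..T} s * exp (l * s))))"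
    proof (rule integral_mono)
      show "integrable lborel (\<lambda>s. norm (k x s ** (unit_weight T s ** curry f s t)))"
        using integrable_kernel_comp[OF k fk integrable_unit_weight] by simp
      have "integrable lborel (\<lambda>s. B * C * (indicator {0..x} s * exp (l * s)))"
        using integral_exp_atLeastAtMost_le(1)[OF l] by simp
      also have "(\<lambda>s. B * C * (indicator {0..x} s * exp (l * s)))
          = (\<lambda>s. B * (indicator {0..x} s * (C * indicator {0..T} s * exp (l * s))))"
        using xt by (auto simp: fun_eq_iff indicator_def)
      finally show "integrable lborel \<dots>" .
    next
      fix s
      show "norm (k x s ** (unit_weight T s ** curry f s t))
          \<le> B * (indicator {0..x} s * (C * indicator {0..T} s * exp (l * s)))"
      proof (cases "t \<le> s \<and> s \<le> x")
        case True
        then have s: "s \<in> {0..T}" "s \<in> {0..x}" "(s, t) \<in> volterra_triangle T"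
          using xt by (auto simp: volterra_triangle_def)
        have "norm (k x s ** f (s, t)) \<le> C * (B * exp (l * s))"
          using le[OF s(3)] C
          by (intro order_trans[OF norm_matrix_matrix_mult_le] mult_mono) auto
        then show ?thesis using s by (simp add: unit_weight_def mult_ac)
      next
        case False
        then have "k x s = 0 \<or> curry f s t = 0"
          using volterra_kernelD(2)[OF k, of s x] volterra_kernelD(2)[OF fk, of t s] by auto
        then have "k x s ** (unit_weight T s ** curry f s t) = 0"
          by (auto simp: mm.zero_left mm.zero_right)
        then show ?thesis using B C by simp
      qed
    qed
    also have "\<dots> = B * (LINT s|lborel. indicator {0..fst z} s * (C * indicator {0..T} s * exp (l * s)))"
      unfolding xt by simp
    finally show "norm (?\<Phi> f z) \<le> \<dots>" .
  qed (use g in auto)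
  show thesis
  proof
    show r: "volterra_kernel T (curry f)" using f(1) by (simp add: curry_def)
    show "curry f x t = g x t + (LINT s|lborel. k x s ** curry f s t)" for x t
      using f(2)[of "(x, t)"] kernel_comp_unit_weight[OF k, of "curry f" x t] by simp
  qed
qed

text \<open>
  In operator form the conclusion says \<open>(1 + k) (1 + r) = 1\<close>.
\<close>

lemma kernel_right_inverse:
  fixes k :: "real \<Rightarrow> real \<Rightarrow> complex ^ 'n ^ 'n"
  assumes k: "volterra_kernel T k"
  obtains r where "volterra_kernel T r"
    "\<And>f x. integrable lborel f \<Longrightarrow> kernel_op r f x + kernel_op k f x + kernel_op k (kernel_op r f) x = 0"
proof -
  have k': "volterra_kernel T (\<lambda>x t. - k x t)" using admissible_minus[OF k] by (simp add: case_prod_beta')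
  obtain r where r: "volterra_kernel T r"
    and eq: "\<And>x t. r x t = - k x t + (LINT s|lborel. - k x s ** r s t)"
    using volterra_kernel_equation[OF k' k'] by blast
  have eq': "r x t + k x t + kernel_comp (unit_weight T) k r x t = 0" for x t
    unfolding kernel_comp_unit_weight[OF k] by (subst eq) (simp add: mm.minus_left)
  note kr = volterra_kernel_comp[OF k r integrable_unit_weight]
  have "kernel_op r f x + kernel_op k f x + kernel_op k (kernel_op r f) x = 0"
    if f: "integrable lborel f" for f x
  proof -
    have "kernel_op r f x + kernel_op k f x + kernel_op k (kernel_op r f) x
        = kernel_op r f x + kernel_op k f x + kernel_op (kernel_comp (unit_weight T) k r) f x"
      by (simp add: kernel_op_unit_comp[OF k r f k])
    also have "\<dots> = (LINT t|lborel. (r x t + k x t + kernel_comp (unit_weight T) k r x t) *v f t)"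
      unfolding kernel_op_def
      using integrable_kernel_apply[OF k f] integrable_kernel_apply[OF r f] integrable_kernel_apply[OF kr f]
      by (simp add: matrix_vector_mult_add_rdistrib)
    also have "\<dots> = 0" unfolding eq' by (simp add: mv.zero_left)
    finally show ?thesis .
  qed
  with r show thesis by (rule that)
qed

text \<open>
  A right inverse \<open>1 + r\<close> of \<open>1 + k\<close> itself has a right inverse \<open>1 + r2\<close>, and
  \<open>1 + k = (1 + k) (1 + r) (1 + r2) = 1 + r2\<close>. So the right inverse is two-sided.
\<close>

lemma kernel_two_sided_inverse:
  fixes k :: "real \<Rightarrow> real \<Rightarrow> complex ^ 'n ^ 'n"
  assumes k: "volterra_kernel T k"
  obtains r where "volterra_kernel T r"
    "\<And>f x. integrable lborel f \<Longrightarrow> kernel_op r f x + kernel_op k f x + kernel_op k (kernel_op r f) x = 0"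
    "\<And>f x. integrable lborel f \<Longrightarrow> kernel_op k f x + kernel_op r f x + kernel_op r (kernel_op k f) x = 0"
proof -
  obtain r where r: "volterra_kernel T r"
    and right: "\<And>f x. integrable lborel f \<Longrightarrow> kernel_op r f x + kernel_op k f x + kernel_op k (kernel_op r f) x = 0"
    using kernel_right_inverse[OF k] by metis
  obtain r2 where r2: "volterra_kernel T r2"
    and right2: "\<And>f x. integrable lborel f \<Longrightarrow> kernel_op r2 f x + kernel_op r f x + kernel_op r (kernel_op r2 f) x = 0"
    using kernel_right_inverse[OF r] by metis
  have "kernel_op k f x + kernel_op r f x + kernel_op r (kernel_op k f) x = 0" if f: "integrable lborel f" for f x
  proof -
    \<comment> \<open>\<open>p = (1 + r2) f\<close>, so that \<open>f = (1 + r) p\<close>\<close>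
    define p where "p x = f x + kernel_op r2 f x" for x
    have r2f: "integrable lborel (kernel_op r2 f)" by (rule integrable_kernel_op[OF r2 f])
    have p: "integrable lborel p" unfolding p_def using f r2f by simp
    have rp: "integrable lborel (kernel_op r p)" by (rule integrable_kernel_op[OF r p])
    have "kernel_op r p x = kernel_op r f x + kernel_op r (kernel_op r2 f) x" for x
      unfolding p_def by (rule kernel_op_add[OF r f r2f])
    then have f_eq: "f = (\<lambda>x. p x + kernel_op r p x)"
      using right2[OF f] by (simp add: p_def fun_eq_iff algebra_simps)
    have "kernel_op k f x = kernel_op k p x + kernel_op k (kernel_op r p) x" for x
      by (subst f_eq) (rule kernel_op_add[OF k p rp])
    then have "f x + kernel_op k f x = p x" for x
      using right[OF p, of x] fun_cong[OF f_eq, of x] by (simp add: algebra_simps)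
    then have "kernel_op r2 f = kernel_op k f" by (simp add: p_def fun_eq_iff)
    then show ?thesis using right2[OF f, of x] by simp
  qed
  with r right show thesis by (rule that)
qed

lemma kernel_op_cong_AE:
  assumes k: "volterra_kernel T k" and [measurable]: "g \<in> borel_measurable borel" "g' \<in> borel_measurable borel"
    and ae: "AE x in lborel. g x = g' x"
  shows "kernel_op k g x = kernel_op k g' x"
  unfolding kernel_op_def
proof (rule integral_cong_AE)
  note [measurable] = volterra_kernelD(1)[OF k]
  show "(\<lambda>t. k x t *v g t) \<in> borel_measurable lborel" "(\<lambda>t. k x t *v g' t) \<in> borel_measurable lborel"
    by measurable
  show "AE t in lborel. k x t *v g t = k x t *v g' t" using ae by eventually_elim simp
qed

section \<open>Transmutation between the free and the perturbed wave equation\<close>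

text \<open>
  The kernel of \<open>A\<close>: up to sign the Green function of \<open>d\<^sup>2/dx\<^sup>2\<close> with zero Cauchy data at \<open>0\<close>.
\<close>

definition ramp :: "real \<Rightarrow> real \<Rightarrow> real \<Rightarrow> real" where
  "ramp T x t = (if 0 \<le> t \<and> t \<le> x \<and> x \<le> T then t - x else 0)"

text \<open>
  As a function of \<open>(x, t)\<close> this is the forward fundamental solution of the wave operator
  \<open>d\<^sup>2/dx\<^sup>2 - d\<^sup>2/dt\<^sup>2\<close> with source at \<open>(s, r)\<close>, where \<open>x\<close> plays the role of time, cut off
  to the triangle.
\<close>

definition light_cone :: "real \<Rightarrow> real \<Rightarrow> real \<Rightarrow> real \<Rightarrow> real \<Rightarrow> real" where
  "light_cone T x t s r = (if 0 \<le> t \<and> t \<le> x \<and> x \<le> T \<and> \<bar>t - r\<bar> \<le> x - s then 1 / 2 else 0)"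

lemma ramp_measurable [measurable (raw)]:
  assumes [measurable]: "f \<in> borel_measurable M" "g \<in> borel_measurable M"
  shows "(\<lambda>z. ramp T (f z) (g z)) \<in> borel_measurable M"
  unfolding ramp_def by measurable

lemma light_cone_measurable [measurable (raw)]:
  assumes [measurable]: "f \<in> borel_measurable M" "g \<in> borel_measurable M"
    "h \<in> borel_measurable M" "k \<in> borel_measurable M"
  shows "(\<lambda>z. light_cone T (f z) (g z) (h z) (k z)) \<in> borel_measurable M"
  unfolding light_cone_def by measurable

lemma abs_ramp_le: "\<bar>ramp T x t\<bar> \<le> \<bar>T\<bar>"
  by (auto simp: ramp_def)

lemma abs_light_cone_le: "\<bar>light_cone T x t s r\<bar> \<le> 1"
  by (auto simp: light_cone_def)

lemma integral_linear_Icc: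
  fixes a b c :: real
  shows "(LINT y|lborel. indicator {a..b} y * ((y - c) / 2)) = (if a \<le> b then ((b - c)\<^sup>2 - (a - c)\<^sup>2) / 4 else 0)"
proof (cases "a \<le> b")
  case True
  have "(LINT y|lborel. (y - c) / 2 * indicator {a..b} y) = (b - c)\<^sup>2 / 4 - (a - c)\<^sup>2 / 4"
    by (intro integral_FTC_Icc_real[OF True]) (auto intro!: derivative_eq_intros continuous_intros)
  then show ?thesis using True by (simp add: mult.commute diff_divide_distrib)
qed simp

text \<open>
  Let \<open>A\<close> and \<open>G\<close> be the operators with kernels \<open>ramp\<close> and \<open>light_cone\<close>. The wave equation for the
  kernel of \<open>G\<close> says that \<open>[d\<^sup>2/dx\<^sup>2, G]\<close> is the point source, and multiplication by \<open>A\<close> from both sides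
  gives the identity. The proof checks it directly: the first integrand is a linear function on
  an interval ending at \<open>x\<close>, the second one on an interval centred at \<open>r\<close> and cut off at \<open>t\<close>.
\<close>

lemma light_cone_ramp_commutator:
  assumes "0 \<le> r" "r \<le> s"
  shows "(LINT y|lborel. ramp T x y * light_cone T y t s r) - (LINT y|lborel. light_cone T x y s r * ramp T y t)
       = ramp T x s * ramp T r t"
proof (cases "0 \<le> t \<and> x \<le> T")
  case False
  then have "ramp T x y * light_cone T y t s r = 0" "light_cone T x y s r * ramp T y t = 0" "ramp T x s * ramp T r t = 0" for y
    by (auto simp: ramp_def light_cone_def)
  then show ?thesis by (simp only: integral_zero diff_self)
next
  case True
  have "ramp T x y * light_cone T y t s r = indicator {s + \<bar>t - r\<bar>..x} y * ((y - x) / 2)" for y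
    using True assms by (auto simp: ramp_def light_cone_def indicator_def)
  then have 1: "(LINT y|lborel. ramp T x y * light_cone T y t s r)
      = (if s + \<bar>t - r\<bar> \<le> x then - (s + \<bar>t - r\<bar> - x)\<^sup>2 / 4 else 0)"
    by (simp only: integral_linear_Icc) simp
  have "light_cone T x y s r * ramp T y t = - (indicator {max t (r - (x - s))..r + (x - s)} y * ((y - t) / 2))" for y
    using True assms by (auto simp: ramp_def light_cone_def indicator_def abs_le_iff max_def diff_divide_distrib)
  then have 2: "(LINT y|lborel. light_cone T x y s r * ramp T y t)
      = - (if max t (r - (x - s)) \<le> r + (x - s)
           then ((r + (x - s) - t)\<^sup>2 - (max t (r - (x - s)) - t)\<^sup>2) / 4 else 0)"
    by (simp only: integral_minus integral_linear_Icc)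
  have 3: "ramp T x s * ramp T r t = (if s \<le> x \<and> t \<le> r then (s - x) * (t - r) else 0)"
    using True assms by (auto simp: ramp_def)
  \<comment> \<open>The position of \<open>t\<close> relative to \<open>r - (x - s)\<close> and \<open>r\<close> decides which branches are active.\<close>
  show ?thesis
    unfolding 1 2 3
    by (cases "t \<le> r"; cases "s \<le> x"; cases "s + \<bar>t - r\<bar> \<le> x"; cases "t \<le> r - (x - s)")
       (auto simp: max_def power2_eq_square field_simps, algebra)
qed

text \<open>
  The commutator with the ramp is linear in the source, so the identity for a point source carries
  over to any superposition of sources \<open>(\<sigma> \<omega>, \<rho> \<omega>)\<close> with strengths \<open>c \<omega>\<close>. The index measure is
  left arbitrary because sources on the diagonal and sources spread over the triangle are both
  needed.
\<close>

lemma light_cone_superposition: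
  fixes c :: "'a \<Rightarrow> complex ^ 'n ^ 'n" and \<sigma> \<rho> :: "'a \<Rightarrow> real"
  assumes N: "sigma_finite_measure N" and c: "integrable N c"
    and \<sigma> [measurable]: "\<sigma> \<in> borel_measurable N" and \<rho> [measurable]: "\<rho> \<in> borel_measurable N"
    and supp: "\<And>\<omega>. c \<omega> \<noteq> 0 \<Longrightarrow> 0 \<le> \<rho> \<omega> \<and> \<rho> \<omega> \<le> \<sigma> \<omega>"
    and v: "\<And>x t. v x t = (LINT \<omega>|N. light_cone T x t (\<sigma> \<omega>) (\<rho> \<omega>) *\<^sub>R c \<omega>)"
  shows "volterra_kernel T v"
    and "(LINT y|lborel. ramp T x y *\<^sub>R v y t) - (LINT y|lborel. ramp T y t *\<^sub>R v x y)
       = (LINT \<omega>|N. (ramp T x (\<sigma> \<omega>) * ramp T (\<rho> \<omega>) t) *\<^sub>R c \<omega>)"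
proof -
  interpret N: sigma_finite_measure N by (rule N)
  interpret P: pair_sigma_finite "lborel :: real measure" N ..
  have [measurable]: "c \<in> borel_measurable N" using c by auto
  have int: "integrable N (\<lambda>\<omega>. light_cone T x t (\<sigma> \<omega>) (\<rho> \<omega>) *\<^sub>R c \<omega>)" for x t
  proof (rule Bochner_Integration.integrable_bound[OF c])
    show "AE \<omega> in N. norm (light_cone T x t (\<sigma> \<omega>) (\<rho> \<omega>) *\<^sub>R c \<omega>) \<le> norm (c \<omega>)"
      using abs_light_cone_le by (intro AE_I2) (auto intro: mult_left_le_one_le)
  qed measurable
  show vk: "volterra_kernel T v"
  proof (rule volterra_kernelI)
    show "(\<lambda>(x, t). v x t) \<in> borel_measurable (borel \<Otimes>\<^sub>M borel)"
      unfolding v by measurable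
    show "v x t = 0" if "\<not> (0 \<le> t \<and> t \<le> x \<and> x \<le> T)" for x t
      unfolding v light_cone_def using that by (auto intro!: integral_eq_zero_AE)
    show "norm (v x t) \<le> (LINT \<omega>|N. norm (c \<omega>))" for x t
      unfolding v using c integrable_norm[OF int] abs_light_cone_le
      by (intro order_trans[OF integral_norm_bound] integral_mono) (auto intro: mult_left_le_one_le)
  qed
  note vD = volterra_kernelD[OF vk]
  note [measurable] = vD(1)
  obtain C where C: "C \<ge> 0" "\<And>x t. norm (v x t) \<le> C" using vD(3) by blast
  have int1: "integrable lborel (\<lambda>y. ramp T x y *\<^sub>R v y t)"
  proof (rule integrable_bounded_Icc)
    show "(\<lambda>y. ramp T x y *\<^sub>R v y t) \<in> borel_measurable borel" by measurable
    show "ramp T x y *\<^sub>R v y t = 0" if "y \<notin> {0..T}" for y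
      using that by (auto simp: ramp_def)
    show "norm (ramp T x y *\<^sub>R v y t) \<le> \<bar>T\<bar> * C" for y
      unfolding norm_scaleR by (intro mult_mono abs_ramp_le C) auto
  qed
  have int2: "integrable lborel (\<lambda>y. ramp T y t *\<^sub>R v x y)"
  proof (rule integrable_bounded_Icc)
    show "(\<lambda>y. ramp T y t *\<^sub>R v x y) \<in> borel_measurable borel" by measurable
    show "ramp T y t *\<^sub>R v x y = 0" if "y \<notin> {0..T}" for y
      using that by (auto simp: ramp_def)
    show "norm (ramp T y t *\<^sub>R v x y) \<le> \<bar>T\<bar> * C" for y
      unfolding norm_scaleR by (intro mult_mono abs_ramp_le C) auto
  qed
  let ?h = "\<lambda>y \<omega>. ramp T x y * light_cone T y t (\<sigma> \<omega>) (\<rho> \<omega>) - light_cone T x y (\<sigma> \<omega>) (\<rho> \<omega>) * ramp T y t"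
  have h_le: "\<bar>?h y \<omega>\<bar> \<le> 2 * \<bar>T\<bar> * indicator {0..T} y" for y \<omega>
  proof (cases "y \<in> {0..T}")
    case True
    have "\<bar>ramp T x y * light_cone T y t (\<sigma> \<omega>) (\<rho> \<omega>)\<bar> \<le> \<bar>T\<bar> * 1" "\<bar>light_cone T x y (\<sigma> \<omega>) (\<rho> \<omega>) * ramp T y t\<bar> \<le> 1 * \<bar>T\<bar>"
      unfolding abs_mult by (intro mult_mono abs_ramp_le abs_light_cone_le abs_ge_zero; simp)+
    with True show ?thesis by simp
  qed (auto simp: ramp_def light_cone_def)
  have pint: "integrable (lborel \<Otimes>\<^sub>M N) (\<lambda>(y, \<omega>). ?h y \<omega> *\<^sub>R c \<omega>)"
  proof (rule P.integrable_product_bound)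
    show "integrable lborel (\<lambda>y. 2 * \<bar>T\<bar> * indicator {0..T} y)" using integrable_indicator_Icc by simp
    show "integrable N (\<lambda>\<omega>. norm (c \<omega>))" using c by simp
    show "norm (?h y \<omega> *\<^sub>R c \<omega>) \<le> 2 * \<bar>T\<bar> * indicator {0..T} y * norm (c \<omega>)" for y \<omega>
      unfolding norm_scaleR by (intro mult_right_mono h_le) auto
  qed measurable
  have "(LINT y|lborel. ramp T x y *\<^sub>R v y t) - (LINT y|lborel. ramp T y t *\<^sub>R v x y)
      = (LINT y|lborel. ramp T x y *\<^sub>R v y t - ramp T y t *\<^sub>R v x y)"
    using int1 int2 by simp
  also have "\<dots> = (LINT y|lborel. LINT \<omega>|N. ?h y \<omega> *\<^sub>R c \<omega>)"
  proof (intro Bochner_Integration.integral_cong refl)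
    fix y
    have "ramp T x y *\<^sub>R v y t - ramp T y t *\<^sub>R v x y
       = (LINT \<omega>|N. ramp T x y *\<^sub>R light_cone T y t (\<sigma> \<omega>) (\<rho> \<omega>) *\<^sub>R c \<omega> - ramp T y t *\<^sub>R light_cone T x y (\<sigma> \<omega>) (\<rho> \<omega>) *\<^sub>R c \<omega>)"
      unfolding v using int by (simp del: scaleR_scaleR)
    then show "ramp T x y *\<^sub>R v y t - ramp T y t *\<^sub>R v x y = (LINT \<omega>|N. ?h y \<omega> *\<^sub>R c \<omega>)"
      by (simp add: scaleR_diff_left mult.commute)
  qed
  also have "\<dots> = (LINT \<omega>|N. LINT y|lborel. ?h y \<omega> *\<^sub>R c \<omega>)"
    using P.Fubini_integral[OF pint] by simp
  also have "\<dots> = (LINT \<omega>|N. (ramp T x (\<sigma> \<omega>) * ramp T (\<rho> \<omega>) t) *\<^sub>R c \<omega>)"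
  proof (intro Bochner_Integration.integral_cong refl)
    fix \<omega>
    show "(LINT y|lborel. ?h y \<omega> *\<^sub>R c \<omega>) = (ramp T x (\<sigma> \<omega>) * ramp T (\<rho> \<omega>) t) *\<^sub>R c \<omega>"
    proof (cases "c \<omega> = 0")
      case False
      have i1: "integrable lborel (\<lambda>y. ramp T x y * light_cone T y t (\<sigma> \<omega>) (\<rho> \<omega>))"
      proof (rule integrable_bounded_Icc)
        show "ramp T x y * light_cone T y t (\<sigma> \<omega>) (\<rho> \<omega>) = 0" if "y \<notin> {0..T}" for y
          using that by (auto simp: ramp_def)
        show "norm (ramp T x y * light_cone T y t (\<sigma> \<omega>) (\<rho> \<omega>)) \<le> \<bar>T\<bar> * 1" for y
          unfolding real_norm_def abs_mult by (intro mult_mono abs_ramp_le abs_light_cone_le) auto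
      qed measurable
      have i2: "integrable lborel (\<lambda>y. light_cone T x y (\<sigma> \<omega>) (\<rho> \<omega>) * ramp T y t)"
      proof (rule integrable_bounded_Icc)
        show "light_cone T x y (\<sigma> \<omega>) (\<rho> \<omega>) * ramp T y t = 0" if "y \<notin> {0..T}" for y
          using that by (auto simp: ramp_def)
        show "norm (light_cone T x y (\<sigma> \<omega>) (\<rho> \<omega>) * ramp T y t) \<le> 1 * \<bar>T\<bar>" for y
          unfolding real_norm_def abs_mult by (intro mult_mono abs_ramp_le abs_light_cone_le) auto
      qed measurable
      have "(LINT y|lborel. ?h y \<omega> *\<^sub>R c \<omega>) = (LINT y|lborel. ?h y \<omega>) *\<^sub>R c \<omega>"
        using i1 i2 by (intro integral_scaleR_left) auto
      also have "(LINT y|lborel. ?h y \<omega>) = ramp T x (\<sigma> \<omega>) * ramp T (\<rho> \<omega>) t"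
        using i1 i2 supp[OF False] by (simp add: light_cone_ramp_commutator)
      finally show ?thesis .
    qed simp
  qed
  finally show "(LINT y|lborel. ramp T x y *\<^sub>R v y t) - (LINT y|lborel. ramp T y t *\<^sub>R v x y)
       = (LINT \<omega>|N. (ramp T x (\<sigma> \<omega>) * ramp T (\<rho> \<omega>) t) *\<^sub>R c \<omega>)" .
qed

lemma product_weight_integral_le:
  fixes p q :: "real \<Rightarrow> real"
  assumes p: "integrable lborel p" and q: "integrable lborel q"
  shows "integrable (lborel \<Otimes>\<^sub>M lborel) (\<lambda>(s, r). p s * q r)"
    and "(LINT y|(lborel \<Otimes>\<^sub>M lborel). p (fst y) * q (snd y)) = (LINT s|lborel. p s) * (LINT r|lborel. q r)"
proof -
  have [measurable]: "p \<in> borel_measurable borel" "q \<in> borel_measurable borel" using p q by auto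
  show int: "integrable (lborel \<Otimes>\<^sub>M lborel) (\<lambda>(s, r). p s * q r)"
    using p q by (intro lborel_pair.integrable_product_bound[where p = "\<lambda>s. norm (p s)" and q = "\<lambda>r. norm (q r)"])
      (auto simp: abs_mult)
  have "(LINT y|(lborel \<Otimes>\<^sub>M lborel). (case y of (s, r) \<Rightarrow> p s * q r)) = (LINT s|lborel. LINT r|lborel. p s * q r)"
    by (rule lborel_pair.integral_fst[OF int, symmetric])
  then show "(LINT y|(lborel \<Otimes>\<^sub>M lborel). p (fst y) * q (snd y)) = (LINT s|lborel. p s) * (LINT r|lborel. q r)"
    by (simp add: case_prod_beta')
qed

lemma sigma_finite_lborel_pair: "sigma_finite_measure (lborel \<Otimes>\<^sub>M (lborel :: real measure) :: (real \<times> real) measure)"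
  by (rule lborel_pair.sigma_finite_measure_axioms)

lemma integrable_weight_kernel:
  fixes v :: "real \<Rightarrow> real \<Rightarrow> complex ^ 'n ^ 'n"
  assumes v: "volterra_kernel T v" and a: "integrable lborel a"
  shows "integrable (lborel \<Otimes>\<^sub>M lborel) (\<lambda>(s, r). a s ** v s r)"
proof -
  note [measurable] = volterra_kernelD(1)[OF v] borel_measurable_integrable[OF a]
  obtain C where C: "C \<ge> 0" "\<And>x t. norm (v x t) \<le> C" using volterra_kernelD(3)[OF v] by blast
  show ?thesis
  proof (rule lborel_pair.integrable_product_bound)
    show "integrable lborel (\<lambda>s. norm (a s))" using a by simp
    show "integrable lborel (\<lambda>r. C * indicator {0..T} r)" using integrable_indicator_Icc by simp
    fix s r
    have "norm (v s r) \<le> C * indicator {0..T} r"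
      using C volterra_kernelD(2)[OF v, of r s] by (cases "r \<in> {0..T}") auto
    then show "norm (a s ** v s r) \<le> norm (a s) * (C * indicator {0..T} r)"
      by (intro order_trans[OF norm_matrix_matrix_mult_le] mult_left_mono) auto
  qed measurable
qed

text \<open>
  The equation is the integrated form of \<open>v\<^sub>x\<^sub>x - v\<^sub>t\<^sub>t = a(x) (v + \<delta>(x - t))\<close>. It
  remains meaningful when \<open>a\<close> is only square integrable and \<open>v\<close> has no derivatives.
\<close>

theorem transmutation_kernel_exists:
  fixes a :: "real \<Rightarrow> complex ^ 'n ^ 'n"
  assumes T: "0 < T" and a [measurable]: "a \<in> borel_measurable borel" and a0: "\<And>s. s \<notin> {0..T} \<Longrightarrow> a s = 0"
    and a1: "integrable lborel a" and a2: "integrable lborel (\<lambda>s. (norm (a s))\<^sup>2)"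
  obtains v where "volterra_kernel T v"
    "\<And>x t. v x t = (LINT s|lborel. light_cone T x t s s *\<^sub>R a s)
        + (LINT y|(lborel \<Otimes>\<^sub>M lborel). light_cone T x t (fst y) (snd y) *\<^sub>R (a (fst y) ** v (fst y) (snd y)))"
proof -
  let ?P = "lborel \<Otimes>\<^sub>M lborel :: (real \<times> real) measure"
  let ?D = "volterra_triangle T"
  let ?\<Phi> = "\<lambda>(f :: real \<times> real \<Rightarrow> complex ^ 'n ^ 'n) z. LINT y|?P. light_cone T (fst z) (snd z) (fst y) (snd y) *\<^sub>R (a (fst y) ** f y)"
  let ?g = "\<lambda>x t. LINT s|lborel. light_cone T x t s s *\<^sub>R a s"
  have g: "volterra_kernel T ?g"
    by (rule light_cone_superposition(1)[of lborel a "\<lambda>s. s" "\<lambda>s. s"])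
       (use a1 a0 in \<open>auto intro: lborel.sigma_finite_measure_axioms\<close>)
  have af: "integrable ?P (\<lambda>y. a (fst y) ** f y)"
    if "admissible (borel \<Otimes>\<^sub>M borel) ?D f" for f :: "real \<times> real \<Rightarrow> complex ^ 'n ^ 'n"
    using integrable_weight_kernel[OF _ a1, of T "curry f"] that by (simp add: curry_def case_prod_beta')
  have supp: "0 \<le> snd y \<and> snd y \<le> fst y \<and> fst y \<le> T" if "admissible (borel \<Otimes>\<^sub>M borel) ?D f" "f y \<noteq> 0"
    for f :: "real \<times> real \<Rightarrow> complex ^ 'n ^ 'n" and y
  proof -
    have "y \<in> ?D" using that unfolding admissible_def by blast
    then show ?thesis by (auto simp: volterra_triangle_def)
  qed
  have vk: "volterra_kernel T (\<lambda>x t. ?\<Phi> f (x, t))" if "admissible (borel \<Otimes>\<^sub>M borel) ?D f"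
    for f :: "real \<times> real \<Rightarrow> complex ^ 'n ^ 'n"
  proof (rule light_cone_superposition(1)[OF sigma_finite_lborel_pair af[OF that], of fst snd])
    fix y assume "a (fst y) ** f y \<noteq> 0"
    then have "f y \<noteq> 0" by (metis mm.zero_right)
    then show "0 \<le> snd y \<and> snd y \<le> fst y" using supp[OF that] by blast
  qed auto
  have int: "integrable ?P (\<lambda>y. light_cone T x t (fst y) (snd y) *\<^sub>R (a (fst y) ** f y))"
    if "admissible (borel \<Otimes>\<^sub>M borel) ?D f"
    for f :: "real \<times> real \<Rightarrow> complex ^ 'n ^ 'n" and x t
  proof (rule Bochner_Integration.integrable_bound[OF af[OF that]])
    have [measurable]: "f \<in> borel_measurable (borel \<Otimes>\<^sub>M borel)" using that unfolding admissible_def by simp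
    show "(\<lambda>y. light_cone T x t (fst y) (snd y) *\<^sub>R (a (fst y) ** f y)) \<in> borel_measurable ?P" by measurable
    show "AE y in ?P. norm (light_cone T x t (fst y) (snd y) *\<^sub>R (a (fst y) ** f y)) \<le> norm (a (fst y) ** f y)"
      using abs_light_cone_le by (intro AE_I2) (auto intro: mult_left_le_one_le)
  qed
  obtain f where f: "admissible (borel \<Otimes>\<^sub>M borel) ?D f"
    "\<And>z. f z = (case z of (x, t) \<Rightarrow> ?g x t) + ?\<Phi> f z"
  proof (rule volterra_fixed_point[where w = "\<lambda>s. T * norm (a s)" and D = ?D
          and p = fst and T = T and g = "\<lambda>(x, t). ?g x t" and M = "borel \<Otimes>\<^sub>M borel" and \<Phi> = ?\<Phi>])
    show "(\<lambda>s. T * norm (a s)) \<in> borel_measurable borel" by measurable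
    show "admissible (borel \<Otimes>\<^sub>M borel) ?D (\<lambda>(x, t). ?g x t)" by (rule g)
    show "integrable lborel (\<lambda>s. (T * norm (a s))\<^sup>2)"
      using a2 by (simp add: power_mult_distrib)
    show "0 \<le> fst z \<and> fst z \<le> T" if "z \<in> ?D" for z
      using that by (auto simp: volterra_triangle_def)
    show "admissible (borel \<Otimes>\<^sub>M borel) ?D (?\<Phi> f)" if "admissible (borel \<Otimes>\<^sub>M borel) ?D f"
    for f :: "real \<times> real \<Rightarrow> complex ^ 'n ^ 'n"
      using vk[OF that] by (simp add: case_prod_beta')
    show "?\<Phi> (\<lambda>z. f z - h z) = (\<lambda>z. ?\<Phi> f z - ?\<Phi> h z)"
      if "admissible (borel \<Otimes>\<^sub>M borel) ?D f" "admissible (borel \<Otimes>\<^sub>M borel) ?D h"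
      for f h :: "real \<times> real \<Rightarrow> complex ^ 'n ^ 'n"
      using int[OF that(1)] int[OF that(2)] by (simp add: mm.diff_right scaleR_diff_right)
  next
    fix f :: "real \<times> real \<Rightarrow> complex ^ 'n ^ 'n" and B l :: real and z
    assume f: "admissible (borel \<Otimes>\<^sub>M borel) ?D f" and l: "0 < l" and B: "0 \<le> B"
      and le: "\<And>y. y \<in> ?D \<Longrightarrow> norm (f y) \<le> B * exp (l * fst y)" and z: "z \<in> ?D"
    define x t where "x = fst z" and "t = snd z"
    let ?p = "\<lambda>s. indicator {0..x} s * (norm (a s) * exp (l * s))"
    let ?q = "\<lambda>r. B * indicator {0..T} r :: real"
    have p: "integrable lborel ?p"
    proof (rule Bochner_Integration.integrable_bound)
      show "integrable lborel (\<lambda>s. norm (a s) * exp (l * x))" using a1 by simp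
      show "AE s in lborel. norm (?p s) \<le> norm (norm (a s) * exp (l * x))"
        using l by (intro AE_I2) (auto simp: indicator_def intro!: mult_left_mono)
    qed measurable
    have q: "integrable lborel ?q" using integrable_indicator_Icc by simp
    note pq = product_weight_integral_le[OF p q]
    have "norm (?\<Phi> f z) \<le> (LINT y|?P. norm (light_cone T x t (fst y) (snd y) *\<^sub>R (a (fst y) ** f y)))"
      unfolding x_def t_def by (rule integral_norm_bound)
    also have "\<dots> \<le> (LINT y|?P. ?p (fst y) * ?q (snd y))"
    proof (rule integral_mono)
      show "integrable ?P (\<lambda>y. norm (light_cone T x t (fst y) (snd y) *\<^sub>R (a (fst y) ** f y)))"
        by (rule integrable_norm[OF int[OF f]])
      show "integrable ?P (\<lambda>y. ?p (fst y) * ?q (snd y))" using pq(1) by (simp add: case_prod_beta')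
    next
      fix y
      show "norm (light_cone T x t (fst y) (snd y) *\<^sub>R (a (fst y) ** f y)) \<le> ?p (fst y) * ?q (snd y)"
      proof (cases "light_cone T x t (fst y) (snd y) = 0 \<or> f y = 0")
        case True
        then have "light_cone T x t (fst y) (snd y) *\<^sub>R (a (fst y) ** f y) = 0"
          by (auto simp: mm.zero_right)
        then show ?thesis using B by (simp only: norm_zero) simp
      next
        case False
        then have y: "fst y \<le> x" "0 \<le> snd y" "snd y \<le> fst y" "fst y \<le> T" "y \<in> ?D"
          using supp[OF f, of y] by (auto simp: light_cone_def volterra_triangle_def split: if_splits)
        have "norm (light_cone T x t (fst y) (snd y) *\<^sub>R (a (fst y) ** f y)) \<le> 1 * norm (a (fst y) ** f y)"
          unfolding norm_scaleR by (intro mult_right_mono abs_light_cone_le) auto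
        also have "\<dots> \<le> norm (a (fst y)) * (B * exp (l * fst y))"
          using le[OF y(5)] by (simp, intro order_trans[OF norm_matrix_matrix_mult_le] mult_left_mono) auto
        finally show ?thesis using y by (simp add: mult_ac)
      qed
    qed
    also have "\<dots> = (LINT s|lborel. ?p s) * (B * T)"
      unfolding pq(2) using T by simp
    also have "\<dots> = B * (LINT s|lborel. indicator {0..fst z} s * (T * norm (a s) * exp (l * s)))"
    proof -
      have "(LINT s|lborel. indicator {0..fst z} s * (T * norm (a s) * exp (l * s))) = (LINT s|lborel. T * ?p s)"
        unfolding x_def by (intro Bochner_Integration.integral_cong refl) (simp add: mult_ac)
      then show ?thesis by simp
    qed
    finally show "norm (?\<Phi> f z) \<le> \<dots>" .
  qed (rule that)
  show thesis
  proof
    show "volterra_kernel T (curry f)" using f(1) by (simp add: curry_def)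
    show "curry f x t = (LINT s|lborel. light_cone T x t s s *\<^sub>R a s)
        + (LINT y|(lborel \<Otimes>\<^sub>M lborel). light_cone T x t (fst y) (snd y) *\<^sub>R (a (fst y) ** curry f (fst y) (snd y)))" for x t
      using f(2)[of "(x, t)"] by simp
  qed
qed

definition ramp_kernel :: "real \<Rightarrow> real \<Rightarrow> real \<Rightarrow> complex ^ 'n ^ 'n" where
  "ramp_kernel T x t = ramp T x t *\<^sub>R mat 1"

lemma volterra_kernel_ramp: "volterra_kernel T (ramp_kernel T)"
proof (rule volterra_kernelI)
  show "(\<lambda>(x, t). ramp_kernel T x t :: complex ^ 'n ^ 'n) \<in> borel_measurable (borel \<Otimes>\<^sub>M borel)"
    unfolding ramp_kernel_def by measurable
  show "norm (ramp_kernel T x t :: complex ^ 'n ^ 'n) \<le> \<bar>T\<bar> * norm (mat 1 :: complex ^ 'n ^ 'n)" for x t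
    unfolding ramp_kernel_def norm_scaleR by (intro mult_right_mono abs_ramp_le) auto
qed (auto simp: ramp_kernel_def ramp_def)

lemma ramp_kernel_mult_left: "ramp_kernel T x s ** M = ramp T x s *\<^sub>R M"
  by (simp add: ramp_kernel_def matrix_mult_scaleR_left)

lemma ramp_kernel_mult_right: "M ** ramp_kernel T s t = ramp T s t *\<^sub>R M"
  by (simp add: ramp_kernel_def matrix_mult_scaleR_right)

text \<open>
  With \<open>A\<close> the ramp operator this is \<open>A v - v A = A a (1 + v) A\<close>: the superposition
  principle is applied to the two groups of sources that make up \<open>v\<close>, and the resulting double
  integrals are recognised as compositions of kernels.
\<close>

theorem transmutation_operator_exists:
  fixes a :: "real \<Rightarrow> complex ^ 'n ^ 'n"
  assumes T: "0 < T" and a: "a \<in> borel_measurable borel" and a0: "\<And>s. s \<notin> {0..T} \<Longrightarrow> a s = 0"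
    and a1: "integrable lborel a" and a2: "integrable lborel (\<lambda>s. (norm (a s))\<^sup>2)"
  obtains v :: "real \<Rightarrow> real \<Rightarrow> complex ^ 'n ^ 'n" where "volterra_kernel T v"
    "\<And>f x. integrable lborel f \<Longrightarrow> kernel_op (ramp_kernel T) (kernel_op v f) x
       = kernel_op v (kernel_op (ramp_kernel T) f) x
         + kernel_op (ramp_kernel T) (\<lambda>s. a s *v kernel_op (ramp_kernel T) f s) x
         + kernel_op (ramp_kernel T) (\<lambda>s. a s *v kernel_op v (kernel_op (ramp_kernel T) f) s) x"
proof -
  let ?A = "ramp_kernel T :: real \<Rightarrow> real \<Rightarrow> complex ^ 'n ^ 'n"
  let ?e = "unit_weight T :: real \<Rightarrow> complex ^ 'n ^ 'n"
  obtain v where v: "volterra_kernel T v"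
    and v_eq: "\<And>x t. v x t = (LINT s|lborel. light_cone T x t s s *\<^sub>R a s)
        + (LINT y|(lborel \<Otimes>\<^sub>M lborel). light_cone T x t (fst y) (snd y) *\<^sub>R (a (fst y) ** v (fst y) (snd y)))"
    by (rule transmutation_kernel_exists[OF assms]) (assumption, rule that)
  \<comment> \<open>sources on the diagonal, and sources inside the triangle\<close>
  define v1 where "v1 x t = (LINT s|lborel. light_cone T x t s s *\<^sub>R a s)" for x t
  define v2 where "v2 x t = (LINT y|(lborel \<Otimes>\<^sub>M lborel). light_cone T x t (fst y) (snd y) *\<^sub>R (a (fst y) ** v (fst y) (snd y)))" for x t
  have v12: "v x t = v1 x t + v2 x t" for x t unfolding v1_def v2_def by (rule v_eq)
  have A: "volterra_kernel T ?A" by (rule volterra_kernel_ramp)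
  have e: "integrable lborel ?e" by (rule integrable_unit_weight)
  have av: "integrable (lborel \<Otimes>\<^sub>M lborel) (\<lambda>y. a (fst y) ** v (fst y) (snd y))"
    using integrable_weight_kernel[OF v a1] by (simp add: case_prod_beta')
  have s1: "a s \<noteq> 0 \<Longrightarrow> 0 \<le> s \<and> s \<le> s" for s using a0[of s] by force
  have s2: "0 \<le> snd y \<and> snd y \<le> fst y" if "a (fst y) ** v (fst y) (snd y) \<noteq> 0" for y
  proof -
    have "v (fst y) (snd y) \<noteq> 0" using that by (metis mm.zero_right)
    then show ?thesis using volterra_kernelD(2)[OF v, of "snd y" "fst y"] by blast
  qed
  have id: "(\<lambda>s. s) \<in> borel_measurable (lborel :: real measure)" by simp
  note 1 = light_cone_superposition[OF lborel.sigma_finite_measure_axioms a1 id id s1 v1_def]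
  note 2 = light_cone_superposition[OF sigma_finite_lborel_pair av _ _ s2 v2_def]
  have v1k: "volterra_kernel T v1" by (rule 1(1)) auto
  have v2k: "volterra_kernel T v2" by (rule 2(1)) auto
  have c1: "(LINT y|lborel. ramp T x y *\<^sub>R v1 y t) - (LINT y|lborel. ramp T y t *\<^sub>R v1 x y)
      = kernel_comp a ?A ?A x t" for x t
    by (rule trans[OF 1(2)]) (simp_all add: kernel_comp_def ramp_kernel_mult_left ramp_kernel_mult_right)
  have c2: "(LINT y|lborel. ramp T x y *\<^sub>R v2 y t) - (LINT y|lborel. ramp T y t *\<^sub>R v2 x y)
      = kernel_comp a ?A (kernel_comp ?e v ?A) x t" for x t
  proof -
    have int: "integrable (lborel \<Otimes>\<^sub>M lborel) (\<lambda>(s, r). (ramp T x s * ramp T r t) *\<^sub>R (a s ** v s r))"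
    proof (rule Bochner_Integration.integrable_bound)
      show "integrable (lborel \<Otimes>\<^sub>M lborel) (\<lambda>y. (\<bar>T\<bar> * \<bar>T\<bar>) * norm (a (fst y) ** v (fst y) (snd y)))"
        using av by simp
      note [measurable] = volterra_kernelD(1)[OF v] a
      show "(\<lambda>(s, r). (ramp T x s * ramp T r t) *\<^sub>R (a s ** v s r)) \<in> borel_measurable (lborel \<Otimes>\<^sub>M lborel)"
        by measurable
      show "AE y in lborel \<Otimes>\<^sub>M lborel. norm (case y of (s, r) \<Rightarrow> (ramp T x s * ramp T r t) *\<^sub>R (a s ** v s r))
          \<le> norm ((\<bar>T\<bar> * \<bar>T\<bar>) * norm (a (fst y) ** v (fst y) (snd y)))"
      proof (rule AE_I2)
        fix y :: "real \<times> real"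
        obtain s r where y: "y = (s, r)" by (cases y)
        have "\<bar>ramp T x s * ramp T r t\<bar> \<le> \<bar>T\<bar> * \<bar>T\<bar>"
          unfolding abs_mult by (intro mult_mono abs_ramp_le) auto
        then have "\<bar>ramp T x s * ramp T r t\<bar> * norm (a s ** v s r) \<le> \<bar>T\<bar> * \<bar>T\<bar> * norm (a s ** v s r)"
          by (rule mult_right_mono) simp
        then show "norm (case y of (s, r) \<Rightarrow> (ramp T x s * ramp T r t) *\<^sub>R (a s ** v s r))
          \<le> norm ((\<bar>T\<bar> * \<bar>T\<bar>) * norm (a (fst y) ** v (fst y) (snd y)))"
          by (simp add: y abs_mult)
      qed
    qed
    have "(LINT y|lborel. ramp T x y *\<^sub>R v2 y t) - (LINT y|lborel. ramp T y t *\<^sub>R v2 x y)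
        = (LINT y|(lborel \<Otimes>\<^sub>M lborel). (ramp T x (fst y) * ramp T (snd y) t) *\<^sub>R (a (fst y) ** v (fst y) (snd y)))"
      by (rule 2(2)) auto
    also have "\<dots> = (LINT s|lborel. LINT r|lborel. (ramp T x s * ramp T r t) *\<^sub>R (a s ** v s r))"
      using lborel_pair.integral_fst[OF int] by (simp add: case_prod_beta')
    also have "\<dots> = kernel_comp a ?A (kernel_comp ?e v ?A) x t"
      unfolding kernel_comp_def[of a]
    proof (intro Bochner_Integration.integral_cong refl)
      fix s
      have i: "integrable lborel (\<lambda>r. ramp T r t *\<^sub>R v s r)"
      proof -
        have "integrable lborel (\<lambda>r. v s r ** (?e r ** ?A r t))" by (rule integrable_kernel_comp[OF v A e])
        also have "(\<lambda>r. v s r ** (?e r ** ?A r t)) = (\<lambda>r. ramp T r t *\<^sub>R v s r)"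
        proof
          fix r show "v s r ** (?e r ** ?A r t) = ramp T r t *\<^sub>R v s r"
          proof (cases "r \<in> {0..T}")
            case True
            then show ?thesis by (simp add: unit_weight_def ramp_kernel_mult_right matrix_mult_scaleR_right)
          next
            case False
            then have "?A r t = 0" "ramp T r t = 0" by (auto simp: ramp_kernel_def ramp_def)
            then show ?thesis by (simp add: mm.zero_right)
          qed
        qed
        finally show ?thesis .
      qed
      have "(LINT r|lborel. (ramp T x s * ramp T r t) *\<^sub>R (a s ** v s r))
          = (LINT r|lborel. ramp T x s *\<^sub>R (a s ** (ramp T r t *\<^sub>R v s r)))"
        by (simp add: matrix_mult_scaleR_right)
      also have "\<dots> = ramp T x s *\<^sub>R (LINT r|lborel. a s ** (ramp T r t *\<^sub>R v s r))"
        by (rule integral_scaleR_right)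
      also have "(LINT r|lborel. a s ** (ramp T r t *\<^sub>R v s r)) = a s ** (LINT r|lborel. ramp T r t *\<^sub>R v s r)"
        by (rule integral_bounded_linear[OF mm.bounded_linear_right i])
      also have "(LINT r|lborel. ramp T r t *\<^sub>R v s r) = kernel_comp ?e v ?A s t"
        by (simp add: kernel_comp_unit_weight[OF v] ramp_kernel_mult_right)
      finally show "(LINT r|lborel. (ramp T x s * ramp T r t) *\<^sub>R (a s ** v s r))
          = ?A x s ** (a s ** kernel_comp ?e v ?A s t)"
        by (simp add: ramp_kernel_mult_left)
    qed
    finally show ?thesis .
  qed
  have r1: "(LINT y|lborel. ramp T x y *\<^sub>R k y t) = kernel_comp ?e ?A k x t" for k x t
    by (simp add: kernel_comp_unit_weight[OF A] ramp_kernel_mult_left)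
  have r2: "(LINT y|lborel. ramp T y t *\<^sub>R k x y) = kernel_comp ?e k ?A x t" if "volterra_kernel T k" for k x t
    by (simp add: kernel_comp_unit_weight[OF that] ramp_kernel_mult_right)
  have add1: "kernel_comp ?e ?A v x t = kernel_comp ?e ?A v1 x t + kernel_comp ?e ?A v2 x t" for x t
    unfolding kernel_comp_def v12
    using integrable_kernel_comp[OF A v1k e] integrable_kernel_comp[OF A v2k e]
    by (simp add: matrix_add_ldistrib)
  have add2: "kernel_comp ?e v ?A x t = kernel_comp ?e v1 ?A x t + kernel_comp ?e v2 ?A x t" for x t
    unfolding kernel_comp_def v12
    using integrable_kernel_comp[OF v1k A e] integrable_kernel_comp[OF v2k A e]
    by (simp add: matrix_mult_add_left)
  have key: "kernel_comp ?e ?A v x t = kernel_comp ?e v ?A x t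
      + (kernel_comp a ?A ?A x t + kernel_comp a ?A (kernel_comp ?e v ?A) x t)" for x t
    using c1[of x t] c2[of x t] unfolding r1 r2[OF v1k] r2[OF v2k] add1[of x t] add2[of x t]
    by (simp add: algebra_simps)
  have vA: "volterra_kernel T (kernel_comp ?e v ?A)" by (rule volterra_kernel_comp[OF v A e])
  have aAA: "volterra_kernel T (kernel_comp a ?A ?A)" by (rule volterra_kernel_comp[OF A A a1])
  have aAvA: "volterra_kernel T (kernel_comp a ?A (kernel_comp ?e v ?A))"
    by (rule volterra_kernel_comp[OF A vA a1])
  show thesis
  proof (rule that[OF v])
    fix f :: "real \<Rightarrow> complex ^ 'n" and x assume f: "integrable lborel f"
    have sum: "volterra_kernel T (\<lambda>x t. kernel_comp a ?A ?A x t + kernel_comp a ?A (kernel_comp ?e v ?A) x t)"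
      using admissible_add[OF aAA aAvA] by (simp add: case_prod_beta')
    have "kernel_op ?A (kernel_op v f) x = kernel_op (kernel_comp ?e ?A v) f x"
      by (rule kernel_op_unit_comp[OF A v f A, symmetric])
    also have "\<dots> = kernel_op (\<lambda>x t. kernel_comp ?e v ?A x t
      + (kernel_comp a ?A ?A x t + kernel_comp a ?A (kernel_comp ?e v ?A) x t)) f x"
      unfolding kernel_op_def key ..
    also have "\<dots> = kernel_op (kernel_comp ?e v ?A) f x + (kernel_op (kernel_comp a ?A ?A) f x
        + kernel_op (kernel_comp a ?A (kernel_comp ?e v ?A)) f x)"
      by (simp add: kernel_op_kernel_add[OF vA sum f] kernel_op_kernel_add[OF aAA aAvA f])
    also have "kernel_op (kernel_comp ?e v ?A) f x = kernel_op v (kernel_op ?A f) x"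
      by (rule kernel_op_unit_comp[OF v A f v])
    also have "kernel_op (kernel_comp a ?A ?A) f x = kernel_op ?A (\<lambda>s. a s *v kernel_op ?A f s) x"
      by (rule kernel_op_kernel_comp[OF A A a1 f])
    also have "kernel_op (kernel_comp a ?A (kernel_comp ?e v ?A)) f x
        = kernel_op ?A (\<lambda>s. a s *v kernel_op v (kernel_op ?A f) s) x"
      by (simp add: kernel_op_kernel_comp[OF A vA a1 f] kernel_op_unit_comp[OF v A f v])
    finally show "kernel_op ?A (kernel_op v f) x = kernel_op v (kernel_op ?A f) x
         + kernel_op ?A (\<lambda>s. a s *v kernel_op ?A f s) x
         + kernel_op ?A (\<lambda>s. a s *v kernel_op v (kernel_op ?A f) s) x"
      by (simp add: add.assoc)
  qed
qed

section \<open>Square-integrable functions on an interval\<close>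

text \<open>
  Borel functions on the line that vanish off \<open>{0..T}\<close>: such functions can be multiplied by functions
  known only to be continuous on \<open>{0..T}\<close>, and are integrable.
\<close>

definition square_integrable :: "real \<Rightarrow> (real \<Rightarrow> 'a::euclidean_space) \<Rightarrow> bool" where
  "square_integrable T f \<longleftrightarrow> f \<in> borel_measurable borel \<and> (\<forall>x. x \<notin> {0..T} \<longrightarrow> f x = 0) \<and>
     integrable lborel (\<lambda>x. (norm (f x))\<^sup>2)"

lemma square_integrableD:
  fixes f :: "real \<Rightarrow> 'a::euclidean_space"
  assumes f: "square_integrable T f"
  shows "f \<in> borel_measurable borel" "\<And>x. x \<notin> {0..T} \<Longrightarrow> f x = 0"
    "integrable lborel (\<lambda>x. (norm (f x))\<^sup>2)" "integrable lborel f"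
proof -
  show *: "f \<in> borel_measurable borel" "\<And>x. x \<notin> {0..T} \<Longrightarrow> f x = 0"
    "integrable lborel (\<lambda>x. (norm (f x))\<^sup>2)"
    using f by (auto simp: square_integrable_def)
  show "integrable lborel f"
  proof (rule Bochner_Integration.integrable_bound)
    show "integrable lborel (\<lambda>x. indicator {0..T} x + (norm (f x))\<^sup>2)"
      using * integrable_indicator_Icc by simp
    show "f \<in> borel_measurable lborel" using * by simp
    show "AE x in lborel. norm (f x) \<le> norm (indicator {0..T} x + (norm (f x))\<^sup>2)"
    proof (rule AE_I2)
      fix x
      have "0 \<le> (norm (f x) - 1)\<^sup>2" by simp
      then have "2 * norm (f x) \<le> 1 + (norm (f x))\<^sup>2" by (simp add: power2_diff)
      moreover have "0 \<le> norm (f x)" by simp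
      ultimately have "norm (f x) \<le> 1 + (norm (f x))\<^sup>2" by linarith
      then show "norm (f x) \<le> norm (indicator {0..T} x + (norm (f x))\<^sup>2)"
        using *(2)[of x] by (cases "x \<in> {0..T}") auto
    qed
  qed
qed

lemma square_integrable_dominated:
  fixes f :: "real \<Rightarrow> 'a::euclidean_space" and g :: "real \<Rightarrow> 'b::euclidean_space"
  assumes f: "square_integrable T f" and [measurable]: "g \<in> borel_measurable borel"
    and le: "\<And>x. norm (g x) \<le> C * norm (f x)"
  shows "square_integrable T g"
  unfolding square_integrable_def
proof (intro conjI allI impI)
  show "g x = 0" if "x \<notin> {0..T}" for x using le[of x] square_integrableD(2)[OF f that] by simp
  show "integrable lborel (\<lambda>x. (norm (g x))\<^sup>2)"
  proof (rule Bochner_Integration.integrable_bound)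
    show "integrable lborel (\<lambda>x. C\<^sup>2 * (norm (f x))\<^sup>2)" using square_integrableD(3)[OF f] by simp
    show "AE x in lborel. norm ((norm (g x))\<^sup>2) \<le> norm (C\<^sup>2 * (norm (f x))\<^sup>2)"
      using power_mono[OF le norm_ge_zero, of _ 2] by (intro AE_I2) (simp add: power_mult_distrib)
  qed simp
qed simp

lemma square_integrable_add:
  fixes f g :: "real \<Rightarrow> 'a::euclidean_space"
  assumes f: "square_integrable T f" and g: "square_integrable T g"
  shows "square_integrable T (\<lambda>x. f x + g x)"
  unfolding square_integrable_def
proof (intro conjI allI impI)
  note [measurable] = square_integrableD(1)[OF f] square_integrableD(1)[OF g]
  show "(\<lambda>x. f x + g x) \<in> borel_measurable borel" by measurable
  show "f x + g x = 0" if "x \<notin> {0..T}" for x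
    using square_integrableD(2)[OF f that] square_integrableD(2)[OF g that] by simp
  show "integrable lborel (\<lambda>x. (norm (f x + g x))\<^sup>2)"
  proof (rule Bochner_Integration.integrable_bound)
    show "integrable lborel (\<lambda>x. 2 * (norm (f x))\<^sup>2 + 2 * (norm (g x))\<^sup>2)"
      using square_integrableD(3)[OF f] square_integrableD(3)[OF g] by simp
    show "AE x in lborel. norm ((norm (f x + g x))\<^sup>2) \<le> norm (2 * (norm (f x))\<^sup>2 + 2 * (norm (g x))\<^sup>2)"
    proof (rule AE_I2)
      fix x
      have "(norm (f x + g x))\<^sup>2 \<le> (norm (f x) + norm (g x))\<^sup>2"
        by (intro power_mono norm_triangle_ineq) simp
      also have "\<dots> \<le> 2 * (norm (f x))\<^sup>2 + 2 * (norm (g x))\<^sup>2"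
        using sum_squares_bound[of "norm (f x)" "norm (g x)"] by (simp add: power2_sum)
      finally show "norm ((norm (f x + g x))\<^sup>2) \<le> norm (2 * (norm (f x))\<^sup>2 + 2 * (norm (g x))\<^sup>2)"
        by simp
    qed
  qed simp
qed

lemma square_integrable_diff:
  fixes f g :: "real \<Rightarrow> 'a::euclidean_space"
  shows "square_integrable T f \<Longrightarrow> square_integrable T g \<Longrightarrow> square_integrable T (\<lambda>x. f x - g x)"
  using square_integrable_add[of T f "\<lambda>x. - g x"] by (simp add: square_integrable_def)

lemma square_integrable_bounded:
  fixes f :: "real \<Rightarrow> 'a::euclidean_space"
  assumes "f \<in> borel_measurable borel" and "\<And>x. x \<notin> {0..T} \<Longrightarrow> f x = 0" and le: "\<And>x. norm (f x) \<le> C"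
  shows "square_integrable T f"
proof -
  have "(norm (f x))\<^sup>2 \<le> C\<^sup>2" for x using power_mono[OF le norm_ge_zero] .
  with assms show ?thesis
    unfolding square_integrable_def by (auto intro!: integrable_bounded_Icc[of _ T "C\<^sup>2"])
qed

lemma indicator_continuous_measurable:
  fixes f :: "real \<Rightarrow> 'b::real_normed_vector"
  assumes "continuous_on {0..T} f"
  shows "(\<lambda>x. indicator {0..T} x *\<^sub>R f x) \<in> borel_measurable borel"
  by (rule borel_measurable_continuous_on_indicator[OF _ assms]) simp

lemma indicator_continuous_bounded:
  fixes f :: "real \<Rightarrow> 'b::real_normed_vector"
  assumes f: "continuous_on {0..T} f"
  shows "\<exists>C. \<forall>x. norm (indicator {0..T} x *\<^sub>R f x) \<le> C"
proof -
  obtain C where "C > 0" "\<And>x. x \<in> {0..T} \<Longrightarrow> norm (f x) \<le> C"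
    using continuous_on_Icc_bounded[OF f] by blast
  then show ?thesis by (intro exI[of _ C]) (auto simp: indicator_def)
qed

lemma square_integrable_continuous:
  fixes f :: "real \<Rightarrow> 'a::euclidean_space"
  assumes f: "continuous_on {0..T} f"
  shows "square_integrable T (\<lambda>x. indicator {0..T} x *\<^sub>R f x)"
proof -
  obtain C where "\<And>x. norm (indicator {0..T} x *\<^sub>R f x) \<le> C"
    using indicator_continuous_bounded[OF f] by blast
  then show ?thesis by (intro square_integrable_bounded indicator_continuous_measurable[OF f]) auto
qed

lemma square_integrable_bilinear:
  fixes f :: "real \<Rightarrow> 'a::euclidean_space" and M :: "real \<Rightarrow> 'b::euclidean_space"
    and mul :: "'b \<Rightarrow> 'a \<Rightarrow> 'c::euclidean_space"
  assumes mul: "bounded_bilinear mul" and M: "continuous_on {0..T} M" and f: "square_integrable T f"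
  shows "square_integrable T (\<lambda>x. mul (M x) (f x))"
proof -
  interpret bounded_bilinear mul by (rule mul)
  let ?M = "\<lambda>x. indicator {0..T} x *\<^sub>R M x"
  obtain C where C: "\<And>x. norm (?M x) \<le> C" using indicator_continuous_bounded[OF M] by blast
  obtain K where K: "K > 0" "\<And>x y. norm (mul x y) \<le> norm x * norm y * K" using pos_bounded by blast
  have "square_integrable T (\<lambda>x. mul (?M x) (f x))"
  proof (rule square_integrable_dominated[OF f])
    show "(\<lambda>x. mul (?M x) (f x)) \<in> borel_measurable borel"
      by (rule borel_measurable_continuous_Pair[OF indicator_continuous_measurable[OF M] square_integrableD(1)[OF f]])
         (intro continuous_on continuous_intros)
    show "norm (mul (?M x) (f x)) \<le> (C * K) * norm (f x)" for x
    proof -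
      have "norm (?M x) * norm (f x) * K \<le> C * norm (f x) * K"
        using C K(1) by (intro mult_right_mono) auto
      then show ?thesis using K(2)[of "?M x" "f x"] by (simp add: mult_ac)
    qed
  qed
  also have "(\<lambda>x. mul (?M x) (f x)) = (\<lambda>x. mul (M x) (f x))"
  proof
    fix x show "mul (?M x) (f x) = mul (M x) (f x)"
      using square_integrableD(2)[OF f, of x] by (cases "x \<in> {0..T}") (auto simp: zero_right)
  qed
  finally show ?thesis .
qed

lemmas square_integrable_mult_left = square_integrable_bilinear[OF bounded_bilinear_matrix_mult]

lemmas square_integrable_mult_right =
  square_integrable_bilinear[OF bounded_bilinear.flip[OF bounded_bilinear_matrix_mult]]

lemma square_integrable_ctranspose:
  fixes f :: "real \<Rightarrow> complex ^ 'n ^ 'm"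
  shows "square_integrable T f \<Longrightarrow> square_integrable T (\<lambda>x. ctranspose (f x))"
  by (rule square_integrable_dominated[where C = 1]) (auto simp: square_integrable_def norm_ctranspose)

section \<open>Volterra kernels generated by neutral frames\<close>

definition J_kernel :: "real \<Rightarrow> (real \<Rightarrow> complex ^ ('p::finite + 'p) ^ 'p) \<Rightarrow> real \<Rightarrow> real \<Rightarrow> complex ^ 'p ^ 'p" where
  "J_kernel T b x t = (if 0 \<le> t \<and> t \<le> x \<and> x \<le> T then mat \<i> ** (b x ** jmat ** ctranspose (b t)) else 0)"

lemma volterra_kernel_J_kernel:
  assumes b: "continuous_on {0..T} b"
  shows "volterra_kernel T (J_kernel T b)"
proof -
  let ?b = "\<lambda>x. indicator {0..T} x *\<^sub>R b x"
  have [measurable]: "?b \<in> borel_measurable borel"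
    by (rule borel_measurable_continuous_on_indicator[OF _ b]) simp
  obtain B where B: "B > 0" "\<And>x. x \<in> {0..T} \<Longrightarrow> norm (b x) \<le> B"
    using continuous_on_Icc_bounded[OF b] by blast
  show ?thesis
  proof (rule volterra_kernelI)
    have "(\<lambda>(x, t). if 0 \<le> t \<and> t \<le> x \<and> x \<le> T then mat \<i> ** (?b x ** jmat ** ctranspose (?b t)) else 0)
        \<in> borel_measurable (borel \<Otimes>\<^sub>M borel)"
      by measurable
    also have "(\<lambda>(x, t). if 0 \<le> t \<and> t \<le> x \<and> x \<le> T then mat \<i> ** (?b x ** jmat ** ctranspose (?b t)) else 0)
        = (\<lambda>(x, t). J_kernel T b x t)"
      by (auto simp: J_kernel_def fun_eq_iff)
    finally show "(\<lambda>(x, t). J_kernel T b x t) \<in> borel_measurable (borel \<Otimes>\<^sub>M borel)" .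
    show "norm (J_kernel T b x t) \<le> norm (mat \<i> :: complex ^ 'a ^ 'a) * (B * (norm (jmat :: complex ^ ('a + 'a) ^ ('a + 'a)) * B))" for x t
    proof (cases "0 \<le> t \<and> t \<le> x \<and> x \<le> T")
      case True
      have "norm (b x ** (jmat ** ctranspose (b t))) \<le> B * (norm (jmat :: complex ^ ('a + 'a) ^ ('a + 'a)) * B)"
        using True B by (intro norm_matrix_mult3_le) (auto simp: norm_ctranspose)
      with True show ?thesis
        using order_trans[OF norm_matrix_matrix_mult_le[of "mat \<i>" "b x ** (jmat ** ctranspose (b t))"]
            mult_left_mono[OF _ norm_ge_zero]]
        by (simp add: J_kernel_def matrix_mul_assoc)
    qed (use B in \<open>auto simp: J_kernel_def\<close>)
  qed (auto simp: J_kernel_def)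
qed

text \<open>
  For a normalised frame \<open>b, b'\<close> this is the matrix function \<open>a\<close> with \<open>b'' = a\<^sup>* b\<close> almost everywhere.
\<close>

definition J_potential :: "(real \<Rightarrow> complex ^ ('p::finite + 'p) ^ 'p) \<Rightarrow>
    (real \<Rightarrow> complex ^ ('p + 'p) ^ 'p) \<Rightarrow> real \<Rightarrow> complex ^ 'p ^ 'p" where
  "J_potential b' b'' s = ctranspose (mat \<i> ** (b'' s ** (jmat ** ctranspose (b' s))))"

lemma square_integrable_J_potential:
  assumes "continuous_on {0..T} b'" "square_integrable T b''"
  shows "square_integrable T (J_potential b' b'')"
proof -
  have "continuous_on {0..T} (\<lambda>s. jmat ** ctranspose (b' s))"
    by (intro mm.continuous_on continuous_on_const ctranspose_continuous_on assms(1))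
  from square_integrable_mult_left[OF continuous_on_const square_integrable_mult_right[OF this assms(2)]]
  show ?thesis unfolding J_potential_def by (rule square_integrable_ctranspose)
qed

text \<open>
  In operator form \<open>K = A - K a A\<close>, the resolvent identity for the perturbation of \<open>A\<close> by the
  potential \<open>a\<close>. Differentiating \<open>b' j b\<^sup>* = \<i>\<close> and using \<open>b' j b'\<^sup>* = 0\<close> gives \<open>b'' j b\<^sup>* = 0\<close>, so the
  expansion of \<open>b''\<close> in the frame \<open>b, b'\<close> has no \<open>b'\<close> term and \<open>b'' = a\<^sup>* b\<close>. Taylor's formula for
  \<open>b\<^sup>*\<close> at the point \<open>x\<close> with integral remainder, multiplied by \<open>\<i> b(x) j\<close>, is then the claim.
\<close>

lemma J_kernel_equation:
  fixes b b' b'' :: "real \<Rightarrow> complex ^ ('p::finite + 'p) ^ 'p"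
  assumes T: "0 < T"
    and deriv: "\<And>x. x \<in> {0..T} \<Longrightarrow> (b has_vector_derivative b' x) (at x within {0..T})"
    and ac: "absolutely_continuous_on {0..T} b'"
    and N: "negligible N"
    and deriv2: "\<And>x. x \<in> {0..T} - N \<Longrightarrow> (b' has_vector_derivative b'' x) (at x within {0..T})"
    and b'': "square_integrable T b''"
    and bb: "\<And>x. x \<in> {0..T} \<Longrightarrow> b x ** jmat ** ctranspose (b x) = 0"
    and b'b: "\<And>x. x \<in> {0..T} \<Longrightarrow> b' x ** jmat ** ctranspose (b x) = mat \<i>"
    and b'b': "\<And>x. x \<in> {0..T} \<Longrightarrow> b' x ** jmat ** ctranspose (b' x) = 0"
  shows "J_kernel T b x t = ramp_kernel T x t
      - kernel_comp (J_potential b' b'') (J_kernel T b) (ramp_kernel T) x t"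
proof (cases "0 \<le> t \<and> t \<le> x \<and> x \<le> T")
  case False
  have "J_kernel T b x s = 0 \<or> ramp_kernel T s t = (0 :: complex ^ 'p ^ 'p)" for s
    using False by (auto simp: J_kernel_def ramp_kernel_def ramp_def)
  then have "J_kernel T b x s ** (J_potential b' b'' s ** ramp_kernel T s t) = 0" for s
    by (metis mm.zero_left mm.zero_right)
  then have "kernel_comp (J_potential b' b'') (J_kernel T b) (ramp_kernel T) x t = 0"
    unfolding kernel_comp_def by simp
  moreover have "J_kernel T b x t = 0" using False by (auto simp add: J_kernel_def)
  moreover have "ramp_kernel T x t = (0 :: complex ^ 'p ^ 'p)"
    using False by (auto simp: ramp_kernel_def ramp_def)
  ultimately show ?thesis by simp
next
  case True
  have cont: "continuous_on {0..T} b"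
    using deriv by (intro continuous_on_vector_derivative)
  have cont': "continuous_on {0..T} b'"
    using ac by (rule absolutely_continuous_imp_continuous_on)
  let ?a = "J_potential b' b''"
  let ?K = "J_kernel T b"
  note K = volterra_kernel_J_kernel[OF cont]
  note [measurable] = square_integrableD(1)[OF b''] square_integrableD(1)[OF square_integrable_J_potential[OF cont' b'']]
  note [measurable] = volterra_kernelD(1)[OF K]
  have adj: "ctranspose (b s) ** ?a s = ctranspose (b'' s)" if s: "s \<in> {0..T} - N" for s
  proof -
    have s': "s \<in> {0..T}" using s by blast
    have "((\<lambda>s. b' s ** (jmat ** ctranspose (b s))) has_vector_derivative
        (b' s ** (jmat ** ctranspose (b' s)) + b'' s ** (jmat ** ctranspose (b s)))) (at s within {0..T})"
      by (intro mm.has_vector_derivative deriv2[OF s]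
           bounded_linear.has_vector_derivative[OF mm.bounded_linear_right]
           bounded_linear.has_vector_derivative[OF bounded_linear_ctranspose] deriv[OF s'])
    moreover have "((\<lambda>s. b' s ** (jmat ** ctranspose (b s))) has_vector_derivative 0) (at s within {0..T})"
      by (rule has_vector_derivative_transform[OF s' _ has_vector_derivative_const[of "mat \<i>"]])
         (simp add: b'b matrix_mul_assoc)
    ultimately have "b' s ** (jmat ** ctranspose (b' s)) + b'' s ** (jmat ** ctranspose (b s)) = 0"
      using s' T by (intro vector_derivative_unique_within_closed_interval[of 0 T s]) auto
    then have "b'' s ** jmat ** ctranspose (b s) = 0"
      using b'b'[OF s'] by (simp add: matrix_mul_assoc)
    then have "b'' s = mat \<i> ** (b'' s ** jmat ** ctranspose (b' s) ** b s)"
      using J_frame_completeness[OF bb[OF s'] b'b[OF s'] b'b'[OF s'], of "b'' s"]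
      by (simp add: mm.zero_left mm.zero_right)
    then have "ctranspose (b'' s) = ctranspose (mat \<i> ** (b'' s ** jmat ** ctranspose (b' s)) ** b s)"
      by (simp add: matrix_mul_assoc)
    then show ?thesis by (simp add: J_potential_def ctranspose_mult matrix_mul_assoc)
  qed
  define M where "M = mat \<i> ** (b x ** jmat)"
  \<comment> \<open>The first-order Taylor polynomial of \<open>b\<^sup>*\<close> at \<open>s\<close>, evaluated at \<open>t\<close>: \<open>F t = b(t)\<^sup>*\<close>, and \<open>F'\<close> is the integrand of the remainder.\<close>
  define F where "F s = ctranspose (b s - (s - t) *\<^sub>R b' s)" for s
  have tx: "{t..x} \<subseteq> {0..T}" using True by auto
  let ?g = "\<lambda>s. indicator {t..x} s *\<^sub>R ((t - s) *\<^sub>R ctranspose (b'' s))"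
  have g_int: "integrable lborel ?g"
  proof (rule Bochner_Integration.integrable_bound)
    show "integrable lborel (\<lambda>s. \<bar>T\<bar> * norm (b'' s))" using square_integrableD(4)[OF b''] by simp
    show "AE s in lborel. norm (?g s) \<le> norm (\<bar>T\<bar> * norm (b'' s))"
    proof (rule AE_I2)
      fix s show "norm (?g s) \<le> norm (\<bar>T\<bar> * norm (b'' s))"
      proof (cases "s \<in> {t..x}")
        case s: True
        then have "\<bar>t - s\<bar> * norm (b'' s) \<le> \<bar>T\<bar> * norm (b'' s)"
          using True by (intro mult_right_mono) auto
        then show ?thesis using s by (simp add: norm_ctranspose)
      qed simp
    qed
  qed measurable
  have acF: "absolutely_continuous_on {t..x} F"
  proof -
    have "absolutely_continuous_on {0..T} b"
      by (rule C1_imp_absolutely_continuous_on[OF deriv cont'])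
    moreover have "absolutely_continuous_on {0..T} (\<lambda>s. (s - t) *\<^sub>R b' s)"
      by (rule absolutely_continuous_on_bounded_bilinear[OF bounded_bilinear_scaleR _ ac])
         (rule Lipschitz_imp_absolutely_continuous_on[where C = 1], simp)
    ultimately have "absolutely_continuous_on {0..T} F"
      unfolding F_def
      by (intro absolutely_continuous_on_bounded_linear[OF bounded_linear_ctranspose] absolutely_continuous_on_diff)
    then show ?thesis using tx by (rule absolutely_continuous_on_subset)
  qed
  have dF: "(F has_vector_derivative (t - s) *\<^sub>R ctranspose (b'' s)) (at s within {t..x})" if s: "s \<in> {t..x} - N" for s
  proof -
    have s1: "s \<in> {0..T} - N" and s2: "s \<in> {0..T}" using s tx by auto
    have lin: "((\<lambda>s. s - t) has_field_derivative 1) (at s within {0..T})"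
      by (auto intro!: derivative_eq_intros)
    have "(F has_vector_derivative ctranspose (b' s - ((s - t) *\<^sub>R b'' s + 1 *\<^sub>R b' s))) (at s within {0..T})"
      unfolding F_def
      by (rule bounded_linear.has_vector_derivative[OF bounded_linear_ctranspose])
         (intro has_vector_derivative_diff deriv[OF s2] has_vector_derivative_scaleR deriv2[OF s1] lin)
    moreover have "ctranspose (b' s - ((s - t) *\<^sub>R b'' s + 1 *\<^sub>R b' s)) = (t - s) *\<^sub>R ctranspose (b'' s)"
      by (simp add: ctranspose_diff ctranspose_add ctranspose_scaleR algebra_simps)
    ultimately show ?thesis using tx by (auto intro: has_vector_derivative_within_subset)
  qed
  have "(LINT s|lborel. ?g s) = F x - F t"
    using True by (intro integral_absolutely_continuous_eq[OF _ acF N dF g_int]) auto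
  also have "\<dots> = ctranspose (b x) + (t - x) *\<^sub>R ctranspose (b' x) - ctranspose (b t)"
    by (simp add: F_def ctranspose_diff ctranspose_add ctranspose_scaleR algebra_simps)
  finally have ig: "(LINT s|lborel. ?g s) = ctranspose (b x) + (t - x) *\<^sub>R ctranspose (b' x) - ctranspose (b t)" .
  have "kernel_comp ?a ?K (ramp_kernel T) x t = (LINT s|lborel. M ** ?g s)"
    unfolding kernel_comp_def
  proof (rule integral_cong_AE)
    note [measurable] = volterra_kernelD(1)[OF volterra_kernel_ramp[of T]]
    show "(\<lambda>s. ?K x s ** (?a s ** ramp_kernel T s t)) \<in> borel_measurable lborel" by measurable
    show "(\<lambda>s. M ** ?g s) \<in> borel_measurable lborel" by measurable
    show "AE s in lborel. ?K x s ** (?a s ** ramp_kernel T s t) = M ** ?g s"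
      using negligible_imp_AE_lborel[OF N]
    proof (rule AE_mp, intro AE_I2 impI)
      fix s assume sN: "s \<notin> N"
      show "?K x s ** (?a s ** ramp_kernel T s t) = M ** ?g s"
      proof (cases "s \<in> {t..x}")
        case s: True
        then have "?K x s = M ** ctranspose (b s)"
          using True by (simp add: J_kernel_def M_def matrix_mul_assoc)
        moreover have "?a s ** ramp_kernel T s t = (t - s) *\<^sub>R ?a s"
          using s True by (simp add: ramp_kernel_mult_right ramp_def)
        ultimately have "?K x s ** (?a s ** ramp_kernel T s t) = (t - s) *\<^sub>R (M ** (ctranspose (b s) ** ?a s))"
          by (simp add: matrix_mult_scaleR_right matrix_mul_assoc)
        also have "ctranspose (b s) ** ?a s = ctranspose (b'' s)" using s sN tx by (intro adj) auto
        finally show ?thesis using s by (simp add: matrix_mult_scaleR_right)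
      next
        case False
        then have "?K x s = 0 \<or> ramp_kernel T s t = (0 :: complex ^ 'p ^ 'p)"
          by (auto simp: J_kernel_def ramp_kernel_def ramp_def)
        then show ?thesis using False by (auto simp: mm.zero_left mm.zero_right)
      qed
    qed
  qed
  also have "\<dots> = M ** (LINT s|lborel. ?g s)"
    by (rule integral_bounded_linear[OF mm.bounded_linear_right g_int])
  also have "\<dots> = M ** ctranspose (b x) + (t - x) *\<^sub>R (M ** ctranspose (b' x)) - M ** ctranspose (b t)"
    unfolding ig by (simp add: matrix_add_ldistrib mm.diff_right matrix_mult_scaleR_right)
  also have "M ** ctranspose (b x) = 0"
    using bb[of x] True by (simp add: M_def matrix_mul_assoc[symmetric] mm.zero_right)
  also have "M ** ctranspose (b' x) = mat 1"
  proof -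
    have "b x ** jmat ** ctranspose (b' x) = mat (- \<i>)"
      using arg_cong[OF b'b[of x], of ctranspose] True
      by (simp add: ctranspose_mult ctranspose_mat matrix_mul_assoc)
    then show ?thesis by (simp add: M_def matrix_mul_assoc[symmetric] mat_mult_mat)
  qed
  also have "M ** ctranspose (b t) = ?K x t"
    using True by (simp add: M_def J_kernel_def matrix_mul_assoc)
  also have "(t - x) *\<^sub>R mat 1 = ramp_kernel T x t"
    using True by (simp add: ramp_kernel_def ramp_def)
  finally show ?thesis by simp
qed

text \<open>
  Purely algebraic. Put \<open>W = 1 + v\<close>; the commutator relation reads \<open>A W = (1 + A a) W A\<close>. The
  resolvent identity gives \<open>K = (1 - K a) A\<close> and \<open>(1 - K a) (1 + A a) = 1\<close>, hence
  \<open>K W = (1 - K a) (1 + A a) W A = W A\<close>.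
\<close>

theorem similarity_from_commutator:
  fixes a :: "real \<Rightarrow> complex ^ 'n ^ 'n"
  assumes K: "volterra_kernel T K" and A: "volterra_kernel T A" and v: "volterra_kernel T v"
    and a: "integrable lborel a"
    and K_eq: "\<And>x t. K x t = A x t - kernel_comp a K A x t"
    and comm: "\<And>f x. integrable lborel f \<Longrightarrow> kernel_op A (kernel_op v f) x
       = kernel_op v (kernel_op A f) x + kernel_op A (\<lambda>s. a s *v kernel_op A f s) x
         + kernel_op A (\<lambda>s. a s *v kernel_op v (kernel_op A f) s) x"
    and f: "integrable lborel f"
  shows "kernel_op K (\<lambda>s. f s + kernel_op v f s) x = kernel_op A f x + kernel_op v (kernel_op A f) x"
proof -
  note iop = integrable_kernel_op and iw = integrable_weighted_kernel_op
  have K_op: "kernel_op K h y = kernel_op A h y - kernel_op K (\<lambda>s. a s *v kernel_op A h s) y"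
    if h: "integrable lborel h" for h y
  proof -
    have "kernel_op K h y = kernel_op (\<lambda>x t. A x t - kernel_comp a K A x t) h y"
      unfolding kernel_op_def by (subst K_eq) simp
    then show ?thesis
      by (simp add: kernel_op_kernel_diff[OF A volterra_kernel_comp[OF K A a] h]
            kernel_op_kernel_comp[OF K A a h])
  qed
  define Af where "Af = kernel_op A f"
  have Af: "integrable lborel Af" unfolding Af_def by (rule iop[OF A f])
  \<comment> \<open>\<open>g = W A f\<close> and \<open>h = a g\<close>\<close>
  define g where "g s = Af s + kernel_op v Af s" for s
  define h where "h s = a s *v g s" for s
  have h_split: "h = (\<lambda>s. a s *v Af s + a s *v kernel_op v Af s)"
    by (simp add: h_def g_def matrix_vector_right_distrib fun_eq_iff)
  have i1: "integrable lborel (\<lambda>s. a s *v Af s)" unfolding Af_def by (rule iw[OF A a f])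
  have i2: "integrable lborel (\<lambda>s. a s *v kernel_op v Af s)" by (rule iw[OF v a Af])
  have h: "integrable lborel h" unfolding h_split using i1 i2 by simp
  have vf: "integrable lborel (kernel_op v f)" by (rule iop[OF v f])
  let ?w = "\<lambda>s. f s + kernel_op v f s"
  have w: "integrable lborel ?w" using f vf by simp
  have Aw: "kernel_op A ?w y = g y + kernel_op A h y" for y
    unfolding kernel_op_add[OF A f vf] comm[OF f] h_split kernel_op_add[OF A i1 i2]
    by (simp add: g_def Af_def add.assoc)
  have aAw: "(\<lambda>s. a s *v kernel_op A ?w s) = (\<lambda>s. h s + a s *v kernel_op A h s)"
    by (simp add: Aw h_def matrix_vector_right_distrib)
  have "kernel_op K ?w x = g x + kernel_op A h x - kernel_op K (\<lambda>s. h s + a s *v kernel_op A h s) x"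
    by (simp only: K_op[OF w] aAw) (simp only: Aw)
  also have "\<dots> = g x + kernel_op A h x - (kernel_op K h x + kernel_op K (\<lambda>s. a s *v kernel_op A h s) x)"
    by (simp add: kernel_op_add[OF K h iw[OF A a h]])
  also have "\<dots> = g x" unfolding K_op[OF h] by simp
  finally show ?thesis by (simp add: g_def Af_def)
qed

section \<open>The unitary gauge\<close>

text \<open>
  The fundamental solution \<open>r x t\<close>, normalised at \<open>x = t\<close>, solves a Volterra kernel equation with
  kernel \<open>B(s)\<close>; the column \<open>t = 0\<close> is the required \<open>u\<close>.
\<close>

lemma linear_ode_exists:
  fixes B :: "real \<Rightarrow> complex ^ 'n ^ 'n"
  assumes T: "0 < T" and B: "continuous_on {0..T} B"
  obtains u where "u 0 = mat 1"
    "\<And>x. x \<in> {0..T} \<Longrightarrow> (u has_vector_derivative B x ** u x) (at x within {0..T})"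
proof -
  let ?B = "\<lambda>x. indicator {0..T} x *\<^sub>R B x"
  have [measurable]: "?B \<in> borel_measurable borel"
    by (rule borel_measurable_continuous_on_indicator[OF _ B]) simp
  obtain C where C: "C > 0" "\<And>x. x \<in> {0..T} \<Longrightarrow> norm (B x) \<le> C"
    using continuous_on_Icc_bounded[OF B] by blast
  define k where "k x t = (if 0 \<le> t \<and> t \<le> x \<and> x \<le> T then ?B t else 0)" for x t
  define g where "g x t = (if 0 \<le> t \<and> t \<le> x \<and> x \<le> T then mat 1 else (0 :: complex ^ 'n ^ 'n))" for x t
  have k: "volterra_kernel T k"
  proof (rule volterra_kernelI)
    show "(\<lambda>(x, t). k x t) \<in> borel_measurable (borel \<Otimes>\<^sub>M borel)" unfolding k_def by measurable
    show "norm (k x t) \<le> C" for x t using C by (auto simp: k_def)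
  qed (auto simp: k_def)
  have g: "volterra_kernel T g"
  proof (rule volterra_kernelI)
    show "(\<lambda>(x, t). g x t) \<in> borel_measurable (borel \<Otimes>\<^sub>M borel)" unfolding g_def by measurable
    show "norm (g x t) \<le> norm (mat 1 :: complex ^ 'n ^ 'n)" for x t by (auto simp: g_def)
  qed (auto simp: g_def)
  obtain r where r: "volterra_kernel T r" "\<And>x t. r x t = g x t + (LINT s|lborel. k x s ** r s t)"
    using volterra_kernel_equation[OF k g] by blast
  define u where "u x = r x 0" for x
  have ru: "u \<in> borel_measurable borel" unfolding u_def using volterra_kernelD(1)[OF r(1)] by measurable
  obtain E where E: "E \<ge> 0" "\<And>x t. norm (r x t) \<le> E" using volterra_kernelD(3)[OF r(1)] by blast
  have int: "set_integrable lborel {0..x} (\<lambda>s. B s ** u s)" if "x \<in> {0..T}" for x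
  proof -
    have "integrable lborel (\<lambda>s. indicator {0..x} s *\<^sub>R (?B s ** u s))"
    proof (rule integrable_bounded_Icc)
      show "(\<lambda>s. indicator {0..x} s *\<^sub>R (?B s ** u s)) \<in> borel_measurable borel" using ru by measurable
      show "norm (indicator {0..x} s *\<^sub>R (?B s ** u s)) \<le> C * E" for s
      proof (cases "s \<in> {0..T}")
        case True
        then have "norm (B s ** u s) \<le> C * E"
          using C E by (intro order_trans[OF norm_matrix_matrix_mult_le] mult_mono) (auto simp: u_def)
        then show ?thesis using True C(1) E(1) by (simp add: indicator_def)
      qed (use C E in \<open>auto simp: mm.zero_left\<close>)
      show "indicator {0..x} s *\<^sub>R (?B s ** u s) = 0" if "s \<notin> {0..T}" for s
        using that by (simp add: mm.zero_left)
    qed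
    also have "(\<lambda>s. indicator {0..x} s *\<^sub>R (?B s ** u s)) = (\<lambda>s. indicator {0..x} s *\<^sub>R (B s ** u s))"
      using that by (auto simp: fun_eq_iff indicator_def)
    finally show ?thesis unfolding set_integrable_def .
  qed
  have u_eq: "u x = mat 1 + integral {0..x} (\<lambda>s. B s ** u s)" if "x \<in> {0..T}" for x
  proof -
    have "u x = mat 1 + (LINT s|lborel. k x s ** r s 0)"
      unfolding u_def using r(2)[of x 0] that by (simp add: g_def)
    also have "(LINT s|lborel. k x s ** r s 0) = (LINT s|lborel. indicator {0..x} s *\<^sub>R (B s ** u s))"
      using that by (intro Bochner_Integration.integral_cong refl) (auto simp: k_def u_def mm.zero_left indicator_def)
    also have "\<dots> = integral {0..x} (\<lambda>s. B s ** u s)"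
      using set_borel_integral_eq_integral(2)[OF int[OF that]] by (simp add: set_lebesgue_integral_def)
    finally show ?thesis .
  qed
  have "continuous_on {0..T} (\<lambda>x. mat 1 + integral {0..x} (\<lambda>s. B s ** u s))"
    using T by (intro continuous_intros indefinite_integral_continuous_1
        set_borel_integral_eq_integral(1)[OF int]) auto
  then have cont: "continuous_on {0..T} u"
    by (rule continuous_on_eq) (simp add: u_eq)
  show thesis
  proof
    show "u 0 = mat 1" using u_eq[of 0] T by simp
    fix x assume x: "x \<in> {0..T}"
    have "((\<lambda>x. mat 1 + integral {0..x} (\<lambda>s. B s ** u s)) has_vector_derivative 0 + B x ** u x) (at x within {0..T})"
      by (intro has_vector_derivative_add has_vector_derivative_const integral_has_vector_derivative x
          mm.continuous_on B cont)
    then show "(u has_vector_derivative B x ** u x) (at x within {0..T})"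
      using has_vector_derivative_transform[OF x u_eq] by simp
  qed
qed

lemma linear_ode_unitary:
  fixes u B :: "real \<Rightarrow> complex ^ 'n ^ 'n"
  assumes T: "0 < T" and u0: "u 0 = mat 1"
    and u: "\<And>x. x \<in> {0..T} \<Longrightarrow> (u has_vector_derivative B x ** u x) (at x within {0..T})"
    and skew: "\<And>x. x \<in> {0..T} \<Longrightarrow> ctranspose (B x) = - B x"
    and x: "x \<in> {0..T}"
  shows "unitary_matrix (u x)"
proof -
  have "((\<lambda>x. ctranspose (u x) ** u x) has_vector_derivative 0) (at x within {0..T})" if x: "x \<in> {0..T}" for x
  proof -
    have "((\<lambda>x. ctranspose (u x) ** u x) has_vector_derivative
        (ctranspose (u x) ** (B x ** u x) + ctranspose (B x ** u x) ** u x)) (at x within {0..T})"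
      by (intro mm.has_vector_derivative u[OF x] bounded_linear.has_vector_derivative[OF bounded_linear_ctranspose])
    moreover have "ctranspose (u x) ** (B x ** u x) + ctranspose (B x ** u x) ** u x = 0"
      by (simp add: ctranspose_mult skew[OF x] mm.minus_left mm.minus_right matrix_mul_assoc)
    ultimately show ?thesis by simp
  qed
  then obtain c where c: "\<And>x. x \<in> {0..T} \<Longrightarrow> ctranspose (u x) ** u x = c"
    using has_vector_derivative_zero_constant[of "{0..T}" "\<lambda>x. ctranspose (u x) ** u x"] by auto
  have "c = mat 1" using c[of 0] T u0 by (simp add: ctranspose_mat)
  then have "ctranspose (u x) ** u x = mat 1" using c[OF x] by simp
  then show ?thesis unfolding unitary_matrix_def by (simp add: matrix_left_right_inverse)
qed

text \<open>
  Replacing \<open>\<beta>\<close> by \<open>b = u\<^sup>* \<beta>\<close> with \<open>u' = B u\<close> and \<open>B\<close> skew-Hermitian keeps the two given relations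
  and changes \<open>\<beta>' j \<beta>'\<^sup>*\<close> into \<open>u\<^sup>* (\<beta>' j \<beta>'\<^sup>* + 2 \<i> B) u\<close>, so \<open>B = (\<i>/2) \<beta>' j \<beta>'\<^sup>*\<close> removes it.
\<close>

theorem J_gauge_exists:
  fixes \<beta> \<beta>' \<beta>'' :: "real \<Rightarrow> complex ^ ('p::finite + 'p) ^ 'p"
  assumes T: "0 < T"
    and deriv: "\<And>x. x \<in> {0..T} \<Longrightarrow> (\<beta> has_vector_derivative \<beta>' x) (at x within {0..T})"
    and ac: "absolutely_continuous_on {0..T} \<beta>'"
    and deriv2: "\<And>x. x \<in> {0..T} - N \<Longrightarrow> (\<beta>' has_vector_derivative \<beta>'' x) (at x within {0..T})"
    and sq: "square_integrable T \<beta>''"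
    and bb: "\<And>x. x \<in> {0..T} \<Longrightarrow> \<beta> x ** jmat ** ctranspose (\<beta> x) = 0"
    and b'b: "\<And>x. x \<in> {0..T} \<Longrightarrow> \<beta>' x ** jmat ** ctranspose (\<beta> x) = mat \<i>"
  obtains u b' b'' where
    "\<And>x. x \<in> {0..T} \<Longrightarrow> unitary_matrix (u x)"
    "absolutely_continuous_on {0..T} u"
    "\<And>x. x \<in> {0..T} \<Longrightarrow> ((\<lambda>x. ctranspose (u x) ** \<beta> x) has_vector_derivative b' x) (at x within {0..T})"
    "absolutely_continuous_on {0..T} b'"
    "\<And>x. x \<in> {0..T} - N \<Longrightarrow> (b' has_vector_derivative b'' x) (at x within {0..T})"
    "square_integrable T b''"
    "\<And>x. x \<in> {0..T} \<Longrightarrow> b' x ** jmat ** ctranspose (ctranspose (u x) ** \<beta> x) = mat \<i>"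
    "\<And>x. x \<in> {0..T} \<Longrightarrow> b' x ** jmat ** ctranspose (b' x) = 0"
proof -
  have c\<beta>: "continuous_on {0..T} \<beta>" using deriv by (rule continuous_on_vector_derivative)
  have c\<beta>': "continuous_on {0..T} \<beta>'" using ac by (rule absolutely_continuous_imp_continuous_on)
  have ac\<beta>: "absolutely_continuous_on {0..T} \<beta>" by (rule C1_imp_absolutely_continuous_on[OF deriv c\<beta>'])
  define R where "R x = \<beta>' x ** (jmat ** ctranspose (\<beta>' x))" for x
  define B where "B x = mat (\<i> / 2) ** R x" for x
  have R_herm: "ctranspose (R x) = R x" for x
    by (simp add: R_def ctranspose_mult matrix_mul_assoc)
  have neg_mat: "mat (- z) ** M = - (mat z ** M)" for z and M :: "complex ^ 'k ^ 'p"
    by (simp add: mat_mult_left vec_eq_iff)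
  have skew: "ctranspose (B x) = - B x" for x
  proof -
    have "ctranspose (B x) = mat (- (\<i> / 2)) ** R x"
      by (simp add: B_def ctranspose_mult ctranspose_mat R_herm mat_commute[of "- (\<i> / 2)"])
    then show ?thesis by (simp only: neg_mat B_def)
  qed
  have acR: "absolutely_continuous_on {0..T} R"
    unfolding R_def
    by (intro absolutely_continuous_on_bounded_bilinear[OF bounded_bilinear_matrix_mult] ac
        absolutely_continuous_on_bounded_linear[OF mm.bounded_linear_right]
        absolutely_continuous_on_bounded_linear[OF bounded_linear_ctranspose])
  have acB: "absolutely_continuous_on {0..T} B"
    unfolding B_def by (rule absolutely_continuous_on_bounded_linear[OF mm.bounded_linear_right acR])
  have cB: "continuous_on {0..T} B" using acB by (rule absolutely_continuous_imp_continuous_on)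
  obtain u where u0: "u 0 = mat 1"
    and u: "\<And>x. x \<in> {0..T} \<Longrightarrow> (u has_vector_derivative B x ** u x) (at x within {0..T})"
    using linear_ode_exists[OF T cB] by metis
  have unit: "unitary_matrix (u x)" if "x \<in> {0..T}" for x
    by (rule linear_ode_unitary[OF T u0 u skew that])
  have uu: "ctranspose (u x) ** u x = mat 1" if "x \<in> {0..T}" for x
    using unit[OF that] by (simp add: unitary_matrix_def)
  have cu: "continuous_on {0..T} u" using u by (rule continuous_on_vector_derivative)
  have acu: "absolutely_continuous_on {0..T} u"
    by (rule C1_imp_absolutely_continuous_on[OF u mm.continuous_on[OF cB cu]])
  have acut: "absolutely_continuous_on {0..T} (\<lambda>x. ctranspose (u x))"
    by (rule absolutely_continuous_on_bounded_linear[OF bounded_linear_ctranspose acu])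
  \<comment> \<open>\<open>b' = u\<^sup>* \<gamma>\<close>\<close>
  define \<gamma> where "\<gamma> x = \<beta>' x - B x ** \<beta> x" for x
  have ac\<gamma>: "absolutely_continuous_on {0..T} \<gamma>"
    unfolding \<gamma>_def
    by (intro absolutely_continuous_on_diff ac absolutely_continuous_on_bounded_bilinear[OF bounded_bilinear_matrix_mult] acB ac\<beta>)
  have c\<gamma>: "continuous_on {0..T} \<gamma>" using ac\<gamma> by (rule absolutely_continuous_imp_continuous_on)
  define b' where "b' x = ctranspose (u x) ** \<gamma> x" for x
  define R' where "R' x = \<beta>' x ** (jmat ** ctranspose (\<beta>'' x)) + \<beta>'' x ** (jmat ** ctranspose (\<beta>' x))" for x
  define \<gamma>' where "\<gamma>' x = \<beta>'' x - (indicator {0..T} x *\<^sub>R (B x ** \<beta>' x) + (mat (\<i> / 2) ** R' x) ** \<beta> x)" for x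
  define b'' where "b'' x = ctranspose (u x) ** \<gamma>' x + indicator {0..T} x *\<^sub>R (ctranspose (B x ** u x) ** \<gamma> x)" for x
  have ut: "((\<lambda>x. ctranspose (u x)) has_vector_derivative ctranspose (B x ** u x)) (at x within {0..T})"
    if "x \<in> {0..T}" for x
    by (rule bounded_linear.has_vector_derivative[OF bounded_linear_ctranspose u[OF that]])
  show thesis
  proof (rule that[of u b' b''])
    show "((\<lambda>x. ctranspose (u x) ** \<beta> x) has_vector_derivative b' x) (at x within {0..T})"
      if x: "x \<in> {0..T}" for x
    proof -
      have "((\<lambda>x. ctranspose (u x) ** \<beta> x) has_vector_derivative
          (ctranspose (u x) ** \<beta>' x + ctranspose (B x ** u x) ** \<beta> x)) (at x within {0..T})"
        by (intro mm.has_vector_derivative ut deriv x)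
      also have "ctranspose (u x) ** \<beta>' x + ctranspose (B x ** u x) ** \<beta> x = b' x"
        by (simp add: b'_def \<gamma>_def ctranspose_mult skew mm.minus_left mm.minus_right mm.diff_right matrix_mul_assoc)
      finally show ?thesis .
    qed
    show "absolutely_continuous_on {0..T} b'"
      unfolding b'_def by (rule absolutely_continuous_on_bounded_bilinear[OF bounded_bilinear_matrix_mult acut ac\<gamma>])
    show "(b' has_vector_derivative b'' x) (at x within {0..T})" if x: "x \<in> {0..T} - N" for x
    proof -
      have x': "x \<in> {0..T}" using x by blast
      have dR: "(R has_vector_derivative R' x) (at x within {0..T})"
        unfolding R_def R'_def
        by (intro mm.has_vector_derivative deriv2 x bounded_linear.has_vector_derivative[OF mm.bounded_linear_right]
            bounded_linear.has_vector_derivative[OF bounded_linear_ctranspose])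
      have dB: "(B has_vector_derivative mat (\<i> / 2) ** R' x) (at x within {0..T})"
        unfolding B_def by (rule bounded_linear.has_vector_derivative[OF mm.bounded_linear_right dR])
      have "(\<gamma> has_vector_derivative \<beta>'' x - (B x ** \<beta>' x + (mat (\<i> / 2) ** R' x) ** \<beta> x)) (at x within {0..T})"
        unfolding \<gamma>_def by (intro has_vector_derivative_diff mm.has_vector_derivative deriv2 x deriv x' dB)
      then have d\<gamma>: "(\<gamma> has_vector_derivative \<gamma>' x) (at x within {0..T})" using x' by (simp add: \<gamma>'_def)
      have "(b' has_vector_derivative (ctranspose (u x) ** \<gamma>' x + ctranspose (B x ** u x) ** \<gamma> x)) (at x within {0..T})"
        unfolding b'_def by (intro mm.has_vector_derivative d\<gamma> ut x')
      then show ?thesis using x' by (simp add: b''_def)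
    qed
    show "square_integrable T b''"
    proof -
      note ctc = ctranspose_continuous_on and left = square_integrable_mult_left
        and right = square_integrable_mult_right
      have "continuous_on {0..T} (\<lambda>x. jmat ** ctranspose (\<beta>' x))"
        by (intro mm.continuous_on continuous_on_const ctc c\<beta>')
      then have "square_integrable T R'"
        unfolding R'_def
        by (rule square_integrable_add[OF left[OF c\<beta>' left[OF continuous_on_const square_integrable_ctranspose[OF sq]]]
              right[OF _ sq]])
      then have "square_integrable T \<gamma>'"
        unfolding \<gamma>'_def
        by (intro square_integrable_diff[OF sq square_integrable_add] right[OF c\<beta> left[OF continuous_on_const]]
            square_integrable_continuous mm.continuous_on cB c\<beta>')
      then show ?thesis
        unfolding b''_def
        by (rule square_integrable_add[OF left[OF ctc[OF cu]] square_integrable_continuous])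
           (intro mm.continuous_on ctc cB cu c\<gamma>)
    qed
  next
    fix x assume x: "x \<in> {0..T}"
    have bb': "\<beta> x ** jmat ** ctranspose (\<beta>' x) = mat (- \<i>)"
      using arg_cong[OF b'b[OF x], of ctranspose] by (simp add: ctranspose_mult ctranspose_mat matrix_mul_assoc)
    have \<gamma>b: "\<gamma> x ** jmat ** ctranspose (\<beta> x) = mat \<i>"
    proof -
      have "\<gamma> x ** jmat ** ctranspose (\<beta> x) = \<beta>' x ** jmat ** ctranspose (\<beta> x) - B x ** (\<beta> x ** jmat ** ctranspose (\<beta> x))"
        by (simp add: \<gamma>_def mm.diff_left matrix_mul_assoc)
      then show ?thesis using bb[OF x] b'b[OF x] by (simp add: mm.zero_right)
    qed
    have b\<gamma>: "\<beta> x ** jmat ** ctranspose (\<gamma> x) = mat (- \<i>)"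
      using arg_cong[OF \<gamma>b, of ctranspose] by (simp add: ctranspose_mult ctranspose_mat matrix_mul_assoc)
    have \<gamma>\<gamma>: "\<gamma> x ** jmat ** ctranspose (\<gamma> x) = 0"
    proof -
      have "\<gamma> x ** jmat ** ctranspose (\<gamma> x) = \<beta>' x ** jmat ** ctranspose (\<gamma> x) - B x ** (\<beta> x ** jmat ** ctranspose (\<gamma> x))"
        by (subst (1) \<gamma>_def) (simp add: mm.diff_left matrix_mul_assoc)
      also have "B x ** (\<beta> x ** jmat ** ctranspose (\<gamma> x)) = mat (1 / 2) ** R x"
        unfolding b\<gamma> B_def by (simp only: mat_commute[of "- \<i>", symmetric] matrix_mul_assoc mat_mult_mat) simp
      also have "\<beta>' x ** jmat ** ctranspose (\<gamma> x) = R x - (\<beta>' x ** jmat ** ctranspose (\<beta> x)) ** ctranspose (B x)"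
        by (simp add: \<gamma>_def R_def ctranspose_diff ctranspose_mult mm.diff_right matrix_mul_assoc)
      also have "(\<beta>' x ** jmat ** ctranspose (\<beta> x)) ** ctranspose (B x) = mat (1 / 2) ** R x"
        unfolding b'b[OF x] skew unfolding B_def
        by (simp add: mm.minus_right matrix_mul_assoc mat_mult_mat neg_mat[symmetric])
      finally show ?thesis by (simp add: mat_mult_left vec_eq_iff)
    qed
    have conj: "(ctranspose (u x) ** M) ** jmat ** ctranspose (ctranspose (u x) ** M')
        = ctranspose (u x) ** (M ** jmat ** ctranspose M') ** u x" for M M'
      by (simp add: ctranspose_mult matrix_mul_assoc)
    show "b' x ** jmat ** ctranspose (ctranspose (u x) ** \<beta> x) = mat \<i>"
      unfolding b'_def conj \<gamma>b
      by (simp only: mat_commute[of \<i> "ctranspose (u x)", symmetric])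
         (simp add: matrix_mul_assoc[symmetric] uu[OF x])
    show "b' x ** jmat ** ctranspose (b' x) = 0"
      unfolding b'_def conj \<gamma>\<gamma> by (simp add: mm.zero_left mm.zero_right)
  qed (use unit acu in auto)
qed

text \<open>
  Conjugation by the multiplication operator \<open>u\<close> turns the operator generated by \<open>\<beta>\<close> into the one
  generated by \<open>u\<^sup>* \<beta>\<close>.
\<close>

lemma J_kernel_gauge:
  assumes u: "unitary_matrix (u x)" "unitary_matrix (u t)"
  shows "J_kernel T \<beta> x t ** u t = u x ** J_kernel T (\<lambda>x. ctranspose (u x) ** \<beta> x) x t"
proof (cases "0 \<le> t \<and> t \<le> x \<and> x \<le> T")
  case True
  have "u x ** (mat \<i> ** (ctranspose (u x) ** M)) = mat \<i> ** M" for M :: "complex ^ 'a ^ 'a"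
    using u(1) by (simp only: matrix_mul_assoc mat_commute[of \<i> "u x", symmetric])
      (simp add: unitary_matrix_def matrix_mul_assoc[symmetric])
  from this[of "\<beta> x ** jmat ** ctranspose (\<beta> t) ** u t"] True show ?thesis
    by (simp add: J_kernel_def ctranspose_mult matrix_mul_assoc)
qed (auto simp: J_kernel_def mm.zero_left mm.zero_right)

section \<open>Bounded operators on square-integrable functions\<close>

lemma borel_representative:
  fixes f :: "real \<Rightarrow> 'a::euclidean_space"
  assumes "f \<in> borel_measurable lebesgue"
  obtains g where "g \<in> borel_measurable borel" "AE x in lborel. f x = g x"
proof -
  have "\<exists>g\<in>borel_measurable borel. AE x in lborel. f x \<bullet> i = g x" if "i \<in> Basis" for i
    using completion_ex_borel_measurable_real[of "\<lambda>x. f x \<bullet> i" lborel] assms by simp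
  then obtain g where g: "\<And>i. i \<in> Basis \<Longrightarrow> g i \<in> borel_measurable borel"
      "\<And>i. i \<in> Basis \<Longrightarrow> AE x in lborel. f x \<bullet> i = g i x"
    by metis
  show thesis
  proof
    show "(\<lambda>x. \<Sum>i\<in>Basis. g i x *\<^sub>R i) \<in> borel_measurable borel"
      using g(1) by (intro borel_measurable_sum borel_measurable_scaleR) auto
    have "AE x in lborel. \<forall>i\<in>Basis. f x \<bullet> i = g i x"
      using g(2) by (subst AE_ball_countable) (auto intro: countable_finite)
    then show "AE x in lborel. f x = (\<Sum>i\<in>Basis. g i x *\<^sub>R i)"
    proof (rule AE_mp, intro AE_I2 impI)
      fix x assume "\<forall>i\<in>Basis. f x \<bullet> i = g i x"
      then show "f x = (\<Sum>i\<in>Basis. g i x *\<^sub>R i)"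
        by (subst euclidean_representation[symmetric, of "f x"]) simp
    qed
  qed
qed

lemma AE_lebesgue_on_Ioo:
  "(AE x in lebesgue_on {0<..<T}. P x) \<longleftrightarrow> (AE x in lborel. x \<in> {0<..<T::real} \<longrightarrow> P x)"
  by (subst AE_restrict_space_iff) (auto simp: AE_completion_iff)

lemma AE_lborel_not_endpoints: "AE x in lborel. x \<noteq> 0 \<and> x \<noteq> (T::real)"
  using AE_lborel_singleton[of "0::real"] AE_lborel_singleton[of T] by eventually_elim simp

text \<open>
  Elements of \<open>L2\<close> are Lebesgue measurable and arbitrary outside the interval, whereas Fubini's
  theorem needs functions that are measurable with respect to the Borel product. Each of them is
  therefore replaced by a Borel function on the line that agrees with its extension by zero.
\<close>

definition represents :: "real \<Rightarrow> (real \<Rightarrow> 'a::euclidean_space) \<Rightarrow> (real \<Rightarrow> 'a) \<Rightarrow> bool" where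
  "represents T f g \<longleftrightarrow>
     square_integrable T g \<and> (AE x in lborel. g x = (if x \<in> {0<..<T} then f x else 0))"

lemma representsD:
  assumes "represents T f g"
  shows "square_integrable T g" "g \<in> borel_measurable borel"
    "AE x in lborel. g x = (if x \<in> {0<..<T} then f x else 0)"
  using assms by (auto simp: represents_def square_integrable_def)

lemma represents_integrable:
  assumes "represents T f g"
  shows "integrable lborel g"
  by (rule square_integrableD(4)[OF representsD(1)[OF assms]])

lemma representation_exists:
  fixes f :: "real \<Rightarrow> 'a::euclidean_space"
  assumes "f \<in> L2 T"
  obtains g where "represents T f g"
proof -
  have m: "f \<in> borel_measurable (lebesgue_on {0<..<T})"
    and i: "integrable (lebesgue_on {0<..<T}) (\<lambda>x. (norm (f x))\<^sup>2)"
    using assms by (auto simp: L2_def)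
  let ?f = "\<lambda>x. if x \<in> {0<..<T} then f x else 0"
  have fm: "?f \<in> borel_measurable lebesgue" by (rule borel_measurable_if_I[OF m]) simp
  obtain g' where g' [measurable]: "g' \<in> borel_measurable borel" and ae': "AE x in lborel. ?f x = g' x"
    using borel_representative[OF fm] by blast
  define g where "g x = indicator {0..T} x *\<^sub>R g' x" for x
  have g [measurable]: "g \<in> borel_measurable borel" unfolding g_def by measurable
  have ae: "AE x in lborel. ?f x = g x"
    using ae' by eventually_elim (auto simp: g_def indicator_def split: if_splits)
  have "integrable lebesgue (\<lambda>x. indicator {0<..<T} x *\<^sub>R (norm (f x))\<^sup>2)"
    using i by (subst (asm) integrable_restrict_space) auto
  moreover have "(\<lambda>x. (norm (g x))\<^sup>2) \<in> borel_measurable lebesgue" by (intro measurable_completion) simp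
  moreover have "AE x in lebesgue. indicator {0<..<T} x *\<^sub>R (norm (f x))\<^sup>2 = (norm (g x))\<^sup>2"
    using AE_completion[OF ae] by eventually_elim (auto simp: indicator_def split: if_splits)
  ultimately have "integrable lebesgue (\<lambda>x. (norm (g x))\<^sup>2)" by (rule integrable_cong_AE_imp)
  then have "integrable lborel (\<lambda>x. (norm (g x))\<^sup>2)" by (subst (asm) integrable_completion) auto
  then have "represents T f g"
    unfolding represents_def square_integrable_def using ae g by (auto simp: g_def elim!: eventually_mono)
  then show thesis by (rule that)
qed

lemma represents_imp_L2:
  fixes f :: "real \<Rightarrow> 'a::euclidean_space"
  assumes "represents T f g"
  shows "f \<in> L2 T" and "L2_norm T f = sqrt (LINT x|lborel. (norm (g x))\<^sup>2)"
proof -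
  note r = representsD[OF assms]
  note [measurable] = r(2)
  let ?f = "\<lambda>x. if x \<in> {0<..<T} then f x else 0"
  have ae: "AE x in lebesgue. g x = ?f x" using r(3) by (rule AE_completion)
  have gm: "g \<in> borel_measurable lebesgue" by (intro measurable_completion) simp
  have fm: "?f \<in> borel_measurable lebesgue"
    by (rule borel_measurable_AE[OF gm ae])
  then have m: "f \<in> borel_measurable (lebesgue_on {0<..<T})"
    by (rule borel_measurable_if_D)
  have ng: "(\<lambda>x. (norm (g x))\<^sup>2) \<in> borel_measurable lebesgue" by (intro measurable_completion) simp
  have aen: "AE x in lebesgue. (norm (g x))\<^sup>2 = indicator {0<..<T} x *\<^sub>R (norm (f x))\<^sup>2"
    using ae by eventually_elim (auto simp: indicator_def)
  have nf: "(\<lambda>x. indicator {0<..<T} x *\<^sub>R (norm (f x))\<^sup>2) \<in> borel_measurable lebesgue"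
    by (rule borel_measurable_AE[OF ng aen])
  have "integrable lebesgue (\<lambda>x. (norm (g x))\<^sup>2)"
    using r(1) by (subst integrable_completion) (auto simp: square_integrable_def)
  then have "integrable lebesgue (\<lambda>x. indicator {0<..<T} x *\<^sub>R (norm (f x))\<^sup>2)"
    by (rule integrable_cong_AE_imp[OF _ nf aen])
  then have i: "integrable (lebesgue_on {0<..<T}) (\<lambda>x. (norm (f x))\<^sup>2)"
    by (subst integrable_restrict_space) auto
  with m show "f \<in> L2 T" by (simp add: L2_def)
  have "(LINT x|lebesgue_on {0<..<T}. (norm (f x))\<^sup>2) = (LINT x|lebesgue. indicator {0<..<T} x *\<^sub>R (norm (f x))\<^sup>2)"
    by (rule integral_restrict_space) auto
  also have "\<dots> = (LINT x|lebesgue. (norm (g x))\<^sup>2)"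
    by (rule integral_cong_AE[OF nf ng]) (use aen in eventually_elim, simp)
  also have "\<dots> = (LINT x|lborel. (norm (g x))\<^sup>2)"
    by (rule integral_completion) simp
  finally show "L2_norm T f = sqrt (LINT x|lborel. (norm (g x))\<^sup>2)" by (simp add: L2_norm_def)
qed

lemma AE_eq_represents:
  assumes "represents T f g" "represents T f' g'" "AE_eq T f f'"
  shows "AE x in lborel. g x = g' x"
  using representsD(3)[OF assms(1)] representsD(3)[OF assms(2)] assms(3)[unfolded AE_eq_def AE_lebesgue_on_Ioo]
  by eventually_elim auto

lemma set_integral_represents:
  fixes M :: "real \<Rightarrow> complex ^ 'n ^ 'm"
  assumes f: "represents T f g" and x: "x < T"
    and M: "(\<lambda>t. indicator {0..x} t *\<^sub>R M t) \<in> borel_measurable borel"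
  shows "(LINT t:{0..x}|lebesgue. M t *v f t) = (LINT t|lborel. (indicator {0..x} t *\<^sub>R M t) *v g t)"
proof -
  note r = representsD[OF f]
  note [measurable] = r(2) M
  let ?G = "\<lambda>t. (indicator {0..x} t *\<^sub>R M t) *v g t"
  have Gm: "?G \<in> borel_measurable lebesgue" by (intro measurable_completion) simp
  have ae: "AE t in lebesgue. ?G t = indicator {0..x} t *\<^sub>R (M t *v f t)"
    using AE_completion[OF r(3)] AE_completion[OF AE_lborel_not_endpoints[of T]]
  proof eventually_elim
    case (elim t)
    show ?case
    proof (cases "t \<in> {0..x}")
      case True
      with elim x have "g t = f t" by auto
      then show ?thesis using True by simp
    qed (simp add: mv.zero_left)
  qed
  have Fm: "(\<lambda>t. indicator {0..x} t *\<^sub>R (M t *v f t)) \<in> borel_measurable lebesgue"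
    by (rule borel_measurable_AE[OF Gm ae])
  have "(LINT t:{0..x}|lebesgue. M t *v f t) = (LINT t|lebesgue. ?G t)"
    unfolding set_lebesgue_integral_def
    by (rule integral_cong_AE[OF Fm Gm]) (use ae in eventually_elim, simp)
  also have "\<dots> = (LINT t|lborel. ?G t)"
    by (rule integral_completion) simp
  finally show ?thesis .
qed

lemma V_op_eq:
  assumes k: "volterra_kernel T k" and f: "represents T f g" and x: "x \<in> {0<..<T}"
  shows "V_op U k f x = U x *v (f x + kernel_op k g x)"
proof -
  note [measurable] = volterra_kernelD(1)[OF k]
  have ind: "indicator {0..x} t *\<^sub>R k x t = k x t" for t
    using volterra_kernelD(2)[OF k, of t x] by (auto simp: indicator_def)
  have "(LINT t:{0..x}|lebesgue. k x t *v f t) = kernel_op k g x"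
    unfolding kernel_op_def using x
    by (subst set_integral_represents[OF f]) (auto simp: ind)
  then show ?thesis by (simp add: V_op_def)
qed

lemma A_op_eq:
  fixes f :: "real \<Rightarrow> complex ^ 'n"
  assumes f: "represents T f g" and x: "x \<in> {0<..<T}"
  shows "A_op f x = kernel_op (ramp_kernel T) g x"
proof -
  have ind: "indicator {0..x} t *\<^sub>R ((t - x) *\<^sub>R mat 1) = (ramp_kernel T x t :: complex ^ 'n ^ 'n)" for t
    using x by (auto simp: indicator_def ramp_kernel_def ramp_def)
  have "A_op f x = (LINT t:{0..x}|lebesgue. ((t - x) *\<^sub>R mat 1) *v f t)"
    by (simp add: A_op_def matrix_vector_scaleR_left)
  also have "\<dots> = (LINT t|lborel. (indicator {0..x} t *\<^sub>R ((t - x) *\<^sub>R mat 1)) *v g t)"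
    using x by (intro set_integral_represents[OF f]) auto
  finally show ?thesis unfolding ind kernel_op_def .
qed

lemma K_op_eq:
  assumes \<beta>: "continuous_on {0..T} \<beta>" and f: "represents T f g" and x: "x \<in> {0<..<T}"
  shows "K_op \<beta> f x = kernel_op (J_kernel T \<beta>) g x"
proof -
  have sub: "{0..x} \<subseteq> {0..T}" using x by auto
  have m [measurable]: "(\<lambda>t. indicator {0..x} t *\<^sub>R ctranspose (\<beta> t)) \<in> borel_measurable borel"
    by (rule indicator_continuous_measurable[OF ctranspose_continuous_on[OF continuous_on_subset[OF \<beta> sub]]])
  obtain C where C: "\<And>t. norm (indicator {0..x} t *\<^sub>R ctranspose (\<beta> t)) \<le> C"
    using indicator_continuous_bounded[OF ctranspose_continuous_on[OF continuous_on_subset[OF \<beta> sub]]] by blast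
  let ?h = "\<lambda>t. (indicator {0..x} t *\<^sub>R ctranspose (\<beta> t)) *v g t"
  note [measurable] = representsD(2)[OF f]
  have int: "integrable lborel ?h"
  proof (rule Bochner_Integration.integrable_bound)
    show "integrable lborel (\<lambda>t. C * norm (g t))" using represents_integrable[OF f] by simp
    show "AE t in lborel. norm (?h t) \<le> norm (C * norm (g t))"
    proof (rule AE_I2)
      fix t
      have "norm (?h t) \<le> C * norm (g t)"
        by (rule order_trans[OF norm_matrix_vector_mult_le mult_right_mono[OF C norm_ge_zero]])
      then show "norm (?h t) \<le> norm (C * norm (g t))" by simp
    qed
  qed measurable
  have "K_op \<beta> f x = (mat \<i> ** (\<beta> x ** jmat)) *v (LINT t|lborel. ?h t)"
    unfolding K_op_def using x
    by (subst set_integral_represents[OF f]) (auto simp: m mat_vector_mult matrix_vector_mul_assoc[symmetric])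
  also have "\<dots> = (LINT t|lborel. (mat \<i> ** (\<beta> x ** jmat)) *v ?h t)"
    by (rule integral_bounded_linear[OF mv.bounded_linear_right int, symmetric])
  also have "\<dots> = kernel_op (J_kernel T \<beta>) g x"
    unfolding kernel_op_def
  proof (intro Bochner_Integration.integral_cong refl)
    fix t
    show "(mat \<i> ** (\<beta> x ** jmat)) *v ?h t = J_kernel T \<beta> x t *v g t"
      using x by (cases "t \<in> {0..x}")
        (auto simp: J_kernel_def mv.zero_left mv.zero_right matrix_vector_mul_assoc matrix_mul_assoc)
  qed
  finally show ?thesis .
qed

text \<open>
  Cauchy--Schwarz on an interval of length \<open>T\<close>, from the nonnegativity of the variance.
\<close>

lemma integral_norm_square_le:
  fixes g :: "real \<Rightarrow> 'a::euclidean_space"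
  assumes T: "0 < T" and f: "represents T f g"
  shows "(LINT x|lborel. norm (g x))\<^sup>2 \<le> T * (LINT x|lborel. (norm (g x))\<^sup>2)"
proof -
  have i1: "integrable lborel (\<lambda>x. norm (g x))" using represents_integrable[OF f] by simp
  have i2: "integrable lborel (\<lambda>x. (norm (g x))\<^sup>2)"
    using representsD(1)[OF f] by (simp add: square_integrable_def)
  note [measurable] = representsD(2)[OF f]
  define S where "S = (LINT x|lborel. norm (g x))"
  \<comment> \<open>the mean of \<open>norm g\<close>\<close>
  define m where "m = S / T"
  have "0 \<le> (LINT x|lborel. (norm (g x))\<^sup>2 - 2 * m * norm (g x) + m\<^sup>2 * indicator {0..T} x)"
  proof (rule integral_nonneg_AE)
    show "AE x in lborel. 0 \<le> (norm (g x))\<^sup>2 - 2 * m * norm (g x) + m\<^sup>2 * indicator {0..T} x"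
      using representsD(3)[OF f]
    proof eventually_elim
      case (elim x)
      show ?case
      proof (cases "x \<in> {0<..<T}")
        case True
        have "0 \<le> (norm (g x) - m)\<^sup>2" by simp
        then show ?thesis using True by (simp add: power2_diff algebra_simps)
      next
        case False
        then have "g x = 0" using elim by auto
        then show ?thesis by simp
      qed
    qed
  qed
  also have "\<dots> = (LINT x|lborel. (norm (g x))\<^sup>2) - 2 * m * S + m\<^sup>2 * T"
    unfolding S_def using i1 i2 T integrable_indicator_Icc[of 0 T] by simp
  also have "\<dots> = (LINT x|lborel. (norm (g x))\<^sup>2) - S\<^sup>2 / T"
    using T by (simp add: m_def power2_eq_square)
  finally show ?thesis using T by (simp add: S_def field_simps)
qed

lemma V_op_represents:
  fixes k :: "real \<Rightarrow> real \<Rightarrow> complex ^ 'n ^ 'n"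
  assumes k: "volterra_kernel T k" and U: "continuous_on {0..T} U" and f: "represents T f g"
  shows "represents T (V_op U k f) (\<lambda>x. (indicator {0..T} x *\<^sub>R U x) *v (g x + kernel_op k g x))"
  unfolding represents_def
proof
  note r = representsD[OF f]
  have gi: "integrable lborel g" by (rule represents_integrable[OF f])
  have mU [measurable]: "(\<lambda>x. indicator {0..T} x *\<^sub>R U x) \<in> borel_measurable borel"
    by (rule indicator_continuous_measurable[OF U])
  obtain C where C: "\<And>x. norm (indicator {0..T} x *\<^sub>R U x) \<le> C"
    using indicator_continuous_bounded[OF U] by blast
  obtain M where M: "M \<ge> 0" "\<And>x t. norm (k x t) \<le> M" using volterra_kernelD(3)[OF k] by blast
  have mk [measurable]: "kernel_op k g \<in> borel_measurable borel" by (rule kernel_op_measurable[OF k r(2)])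
  note [measurable] = r(2)
  have "square_integrable T (kernel_op k g)"
    by (rule square_integrable_bounded[OF mk kernel_op_outside[OF k] kernel_op_bound[OF k gi M(2)]])
  then have s: "square_integrable T (\<lambda>x. g x + kernel_op k g x)" by (rule square_integrable_add[OF r(1)])
  show "square_integrable T (\<lambda>x. (indicator {0..T} x *\<^sub>R U x) *v (g x + kernel_op k g x))"
  proof (rule square_integrable_dominated[OF s])
    show "norm ((indicator {0..T} x *\<^sub>R U x) *v (g x + kernel_op k g x)) \<le> C * norm (g x + kernel_op k g x)" for x
      by (rule order_trans[OF norm_matrix_vector_mult_le mult_right_mono[OF C norm_ge_zero]])
  qed measurable
  show "AE x in lborel. (indicator {0..T} x *\<^sub>R U x) *v (g x + kernel_op k g x) =
      (if x \<in> {0<..<T} then V_op U k f x else 0)"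
    using r(3) AE_lborel_not_endpoints[of T]
  proof eventually_elim
    case (elim x)
    show ?case
    proof (cases "x \<in> {0<..<T}")
      case True
      then show ?thesis using elim by (simp add: V_op_eq[OF k f])
    next
      case False
      then have "x \<notin> {0..T}" using elim by auto
      then show ?thesis by (auto simp: mv.zero_left)
    qed
  qed
qed

lemma represents_add:
  assumes f: "represents T f g" and f': "represents T f' g'"
  shows "represents T (\<lambda>x. f x + f' x) (\<lambda>x. g x + g' x)"
  unfolding represents_def
proof
  show "square_integrable T (\<lambda>x. g x + g' x)"
    by (rule square_integrable_add[OF representsD(1)[OF f] representsD(1)[OF f']])
  show "AE x in lborel. g x + g' x = (if x \<in> {0<..<T} then f x + f' x else 0)"
    using representsD(3)[OF f] representsD(3)[OF f'] by eventually_elim auto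
qed

lemma represents_scale:
  fixes f :: "real \<Rightarrow> complex ^ 'n"
  assumes f: "represents T f g"
  shows "represents T (\<lambda>x. c *s f x) (\<lambda>x. c *s g x)"
  unfolding represents_def
proof
  note [measurable] = representsD(2)[OF f]
  have "(\<lambda>x. mat c *v g x) \<in> borel_measurable borel" by measurable
  then show "square_integrable T (\<lambda>x. c *s g x)"
    by (intro square_integrable_dominated[OF representsD(1)[OF f], where C = "norm c"])
       (auto simp: mat_vector_mult norm_vector_scalar_mult)
  show "AE x in lborel. c *s g x = (if x \<in> {0<..<T} then c *s f x else 0)"
    using representsD(3)[OF f] by eventually_elim auto
qed

text \<open>
  One lemma for all factors: multiplication operators have \<open>k = 0\<close>, and the inverse of \<open>1 + v\<close> has
  \<open>U = 1\<close>.
\<close>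

theorem bounded_L2_operator_V_op:
  fixes k :: "real \<Rightarrow> real \<Rightarrow> complex ^ 'n ^ 'n"
  assumes T: "0 < T" and k: "volterra_kernel T k" and U: "continuous_on {0..T} U"
  shows "bounded_L2_operator T (V_op U k)"
  unfolding bounded_L2_operator_def
proof (intro conjI ballI allI impI)
  note rep = V_op_represents[OF k U]
  note eq = V_op_eq[OF k]
  show "V_op U k f \<in> L2 T" if f: "f \<in> L2 T" for f
  proof -
    obtain g where "represents T f g" using representation_exists[OF f] .
    from represents_imp_L2(1)[OF rep[OF this]] show ?thesis .
  qed
  show "AE_eq T (V_op U k f) (V_op U k f')" if f: "f \<in> L2 T" "f' \<in> L2 T" "AE_eq T f f'" for f f'
  proof -
    obtain g where g: "represents T f g" using representation_exists[OF f(1)] .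
    obtain g' where g': "represents T f' g'" using representation_exists[OF f(2)] .
    have eqk: "kernel_op k g x = kernel_op k g' x" for x
      by (rule kernel_op_cong_AE[OF k representsD(2)[OF g] representsD(2)[OF g'] AE_eq_represents[OF g g' f(3)]])
    show ?thesis
      using f(3) unfolding AE_eq_def AE_lebesgue_on_Ioo
      by eventually_elim (auto simp: eq[OF g] eq[OF g'] eqk)
  qed
  show "AE_eq T (V_op U k (\<lambda>x. f x + f' x)) (\<lambda>x. V_op U k f x + V_op U k f' x)"
    if f: "f \<in> L2 T" "f' \<in> L2 T" for f f'
  proof -
    obtain g where g: "represents T f g" using representation_exists[OF f(1)] .
    obtain g' where g': "represents T f' g'" using representation_exists[OF f(2)] .
    have sum: "kernel_op k (\<lambda>x. g x + g' x) x = kernel_op k g x + kernel_op k g' x" for x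
      by (rule kernel_op_add[OF k represents_integrable[OF g] represents_integrable[OF g']])
    show ?thesis
      unfolding AE_eq_def AE_lebesgue_on_Ioo
      by (intro AE_I2 impI)
         (simp only: eq[OF g] eq[OF g'] eq[OF represents_add[OF g g']] sum, simp add: matrix_vector_right_distrib)
  qed
  show "AE_eq T (V_op U k (\<lambda>x. c *s f x)) (\<lambda>x. c *s V_op U k f x)" if f: "f \<in> L2 T" for c f
  proof -
    obtain g where g: "represents T f g" using representation_exists[OF f] .
    have "kernel_op k (\<lambda>x. c *s g x) x = c *s kernel_op k g x" for x
    proof -
      have "kernel_op k (\<lambda>x. c *s g x) x = (LINT t|lborel. mat c *v (k x t *v g t))"
        unfolding kernel_op_def by (simp add: mat_vector_mult vector_scalar_commute)
      also have "\<dots> = mat c *v kernel_op k g x"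
        unfolding kernel_op_def
        by (rule integral_bounded_linear[OF mv.bounded_linear_right integrable_kernel_apply[OF k represents_integrable[OF g]]])
      finally show ?thesis by (simp add: mat_vector_mult)
    qed
    then show ?thesis
      unfolding AE_eq_def AE_lebesgue_on_Ioo
      by (intro AE_I2 impI)
         (simp add: eq[OF g] eq[OF represents_scale[OF g]] vector_scalar_commute[symmetric] vector_add_ldistrib)
  qed
  obtain C where C: "\<And>x. norm (indicator {0..T} x *\<^sub>R U x) \<le> C"
    using indicator_continuous_bounded[OF U] by blast
  have C0: "0 \<le> C" using norm_ge_zero C by (rule order_trans)
  obtain M where M: "M \<ge> 0" "\<And>x t. norm (k x t) \<le> M" using volterra_kernelD(3)[OF k] by blast
  have "L2_norm T (V_op U k f) \<le> sqrt (C\<^sup>2 * (2 + 2 * M\<^sup>2 * T * T)) * L2_norm T f" if f: "f \<in> L2 T" for f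
  proof -
    obtain g where g: "represents T f g" using representation_exists[OF f] .
    let ?I = "LINT x|lborel. (norm (g x))\<^sup>2"
    let ?S = "LINT x|lborel. norm (g x)"
    let ?G = "\<lambda>x. (indicator {0..T} x *\<^sub>R U x) *v (g x + kernel_op k g x)"
    have i2: "integrable lborel (\<lambda>x. (norm (g x))\<^sup>2)"
      using representsD(1)[OF g] by (simp add: square_integrable_def)
    have pt: "(norm (?G x))\<^sup>2 \<le> C\<^sup>2 * (2 * (norm (g x))\<^sup>2 + 2 * (M * ?S)\<^sup>2 * indicator {0..T} x)" for x
    proof -
      have kb: "norm (kernel_op k g x) \<le> M * ?S * indicator {0..T} x"
        using kernel_op_bound[OF k represents_integrable[OF g] M(2), of x] kernel_op_outside[OF k, of x g]
        by (cases "x \<in> {0..T}") auto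
      have "norm (?G x) \<le> C * (norm (g x) + M * ?S * indicator {0..T} x)"
        by (rule order_trans[OF norm_matrix_vector_mult_le])
           (intro mult_mono C C0 order_trans[OF norm_triangle_ineq] add_left_mono kb norm_ge_zero)
      then have "(norm (?G x))\<^sup>2 \<le> (C * (norm (g x) + M * ?S * indicator {0..T} x))\<^sup>2"
        by (rule power_mono) simp
      also have "\<dots> = C\<^sup>2 * (norm (g x) + M * ?S * indicator {0..T} x)\<^sup>2" by (rule power_mult_distrib)
      also have "\<dots> \<le> C\<^sup>2 * (2 * (norm (g x))\<^sup>2 + 2 * (M * ?S * indicator {0..T} x)\<^sup>2)"
        using sum_squares_bound[of "norm (g x)" "M * ?S * indicator {0..T} x"]
        by (intro mult_left_mono) (simp_all add: power2_sum)
      also have "(M * ?S * indicator {0..T} x)\<^sup>2 = (M * ?S)\<^sup>2 * indicator {0..T} x"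
        by (simp add: power_mult_distrib indicator_def)
      finally show ?thesis by (simp only: mult.assoc)
    qed
    have "(LINT x|lborel. (norm (?G x))\<^sup>2) \<le> (LINT x|lborel. C\<^sup>2 * (2 * (norm (g x))\<^sup>2 + 2 * (M * ?S)\<^sup>2 * indicator {0..T} x))"
    proof (rule integral_mono[OF _ _ pt])
      show "integrable lborel (\<lambda>x. (norm (?G x))\<^sup>2)"
        using representsD(1)[OF rep[OF g]] by (simp add: square_integrable_def)
      show "integrable lborel (\<lambda>x. C\<^sup>2 * (2 * (norm (g x))\<^sup>2 + 2 * (M * ?S)\<^sup>2 * indicator {0..T} x))"
        using i2 integrable_indicator_Icc by simp
    qed
    also have "\<dots> = C\<^sup>2 * (2 * ?I + 2 * M\<^sup>2 * T * ?S\<^sup>2)"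
      using i2 T integrable_indicator_Icc[of 0 T] by (simp add: power_mult_distrib mult_ac)
    also have "\<dots> \<le> C\<^sup>2 * (2 * ?I + 2 * M\<^sup>2 * T * (T * ?I))"
      using integral_norm_square_le[OF T g] T by (intro mult_left_mono add_left_mono) auto
    also have "\<dots> = C\<^sup>2 * (2 + 2 * M\<^sup>2 * T * T) * ?I" by (simp add: algebra_simps)
    finally show ?thesis
      unfolding represents_imp_L2(2)[OF g] represents_imp_L2(2)[OF rep[OF g]] real_sqrt_mult[symmetric]
      by (rule real_sqrt_le_mono)
  qed
  then show "\<exists>C. \<forall>f\<in>L2 T. L2_norm T (V_op U k f) \<le> C * L2_norm T f" by blast
qed

lemma AE_eq_trans: "AE_eq T f g \<Longrightarrow> AE_eq T g h \<Longrightarrow> AE_eq T f h"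
  unfolding AE_eq_def by (auto elim: eventually_elim2)

lemma L2_add:
  assumes "f \<in> L2 T" "g \<in> L2 T"
  shows "(\<lambda>x. f x + g x) \<in> L2 T"
proof -
  obtain f' where "represents T f f'" using representation_exists[OF assms(1)] .
  moreover obtain g' where "represents T g g'" using representation_exists[OF assms(2)] .
  ultimately show ?thesis by (rule represents_imp_L2(1)[OF represents_add])
qed

lemma L2_scale:
  fixes f :: "real \<Rightarrow> complex ^ 'n"
  assumes "f \<in> L2 T"
  shows "(\<lambda>x. c *s f x) \<in> L2 T"
proof -
  obtain f' where "represents T f f'" using representation_exists[OF assms] .
  then show ?thesis by (rule represents_imp_L2(1)[OF represents_scale])
qed

lemma bounded_L2_operator_compose:
  fixes F G :: "(real \<Rightarrow> complex ^ 'n) \<Rightarrow> real \<Rightarrow> complex ^ 'n"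
  assumes F: "bounded_L2_operator T F" and G: "bounded_L2_operator T G"
  shows "bounded_L2_operator T (\<lambda>f. F (G f))"
proof -
  obtain C where C: "\<And>f. f \<in> L2 T \<Longrightarrow> L2_norm T (F f) \<le> C * L2_norm T f"
    using F unfolding bounded_L2_operator_def by blast
  obtain D where D: "\<And>f. f \<in> L2 T \<Longrightarrow> L2_norm T (G f) \<le> D * L2_norm T f"
    using G unfolding bounded_L2_operator_def by blast
  have GL: "f \<in> L2 T \<Longrightarrow> G f \<in> L2 T" and FL: "f \<in> L2 T \<Longrightarrow> F f \<in> L2 T" for f
    using F G unfolding bounded_L2_operator_def by blast+
  have Fc: "f \<in> L2 T \<Longrightarrow> g \<in> L2 T \<Longrightarrow> AE_eq T f g \<Longrightarrow> AE_eq T (F f) (F g)"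
    and Gc: "f \<in> L2 T \<Longrightarrow> g \<in> L2 T \<Longrightarrow> AE_eq T f g \<Longrightarrow> AE_eq T (G f) (G g)" for f g
    using F G unfolding bounded_L2_operator_def by blast+
  have Fa: "f \<in> L2 T \<Longrightarrow> g \<in> L2 T \<Longrightarrow> AE_eq T (F (\<lambda>x. f x + g x)) (\<lambda>x. F f x + F g x)"
    and Ga: "f \<in> L2 T \<Longrightarrow> g \<in> L2 T \<Longrightarrow> AE_eq T (G (\<lambda>x. f x + g x)) (\<lambda>x. G f x + G g x)" for f g
    using F G unfolding bounded_L2_operator_def by blast+
  have Fs: "f \<in> L2 T \<Longrightarrow> AE_eq T (F (\<lambda>x. c *s f x)) (\<lambda>x. c *s F f x)"
    and Gs: "f \<in> L2 T \<Longrightarrow> AE_eq T (G (\<lambda>x. c *s f x)) (\<lambda>x. c *s G f x)" for c f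
    using F G unfolding bounded_L2_operator_def by blast+
  have bound: "L2_norm T (F (G f)) \<le> \<bar>C\<bar> * \<bar>D\<bar> * L2_norm T f" if f: "f \<in> L2 T" for f
  proof -
    have "L2_norm T (F (G f)) \<le> \<bar>C\<bar> * L2_norm T (G f)"
      by (rule order_trans[OF C[OF GL[OF f]]]) (simp add: mult_right_mono L2_norm_def)
    also have "\<dots> \<le> \<bar>C\<bar> * (\<bar>D\<bar> * L2_norm T f)"
      by (intro mult_left_mono order_trans[OF D[OF f]]) (simp_all add: mult_right_mono L2_norm_def)
    finally show ?thesis by simp
  qed
  have h1: "F (G f) \<in> L2 T" if "f \<in> L2 T" for f
    by (intro FL GL that)
  have h2: "AE_eq T (F (G f)) (F (G g))" if "f \<in> L2 T" "g \<in> L2 T" "AE_eq T f g" for f g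
    by (intro Fc GL Gc that)
  have h3: "AE_eq T (F (G (\<lambda>x. f x + g x))) (\<lambda>x. F (G f) x + F (G g) x)"
    if f: "f \<in> L2 T" and g: "g \<in> L2 T" for f g
    by (rule AE_eq_trans[OF Fc[OF GL[OF L2_add[OF f g]] L2_add[OF GL[OF f] GL[OF g]] Ga[OF f g]]
          Fa[OF GL[OF f] GL[OF g]]])
  have h4: "AE_eq T (F (G (\<lambda>x. c *s f x))) (\<lambda>x. c *s F (G f) x)" if f: "f \<in> L2 T" for c f
    by (rule AE_eq_trans[OF Fc[OF GL[OF L2_scale[OF f]] L2_scale[OF GL[OF f]] Gs[OF f]] Fs[OF GL[OF f]]])
  show ?thesis
    unfolding bounded_L2_operator_def
    by (intro conjI ballI allI impI exI[of _ "\<bar>C\<bar> * \<bar>D\<bar>"]; (rule h3 h4 h1 h2 bound; assumption))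
qed

section \<open>The similarity\<close>

lemma matrix_L2_componentwise:
  fixes f :: "real \<Rightarrow> complex ^ 'n ^ 'm"
  assumes f: "\<And>i k. (\<lambda>x. f x $ i $ k) \<in> L2 T"
  shows "f \<in> L2 T"
proof -
  let ?M = "lebesgue_on {0<..<T}"
  have m: "(\<lambda>x. f x $ i $ k) \<in> borel_measurable ?M"
    and int: "integrable ?M (\<lambda>x. (norm (f x $ i $ k))\<^sup>2)" for i k
    using f[of i k] by (auto simp: L2_def)
  have "f \<in> borel_measurable ?M"
  proof (rule iffD2[OF borel_measurable_euclidean_space], rule ballI)
    fix b :: "complex ^ 'n ^ 'm" assume "b \<in> Basis"
    then obtain i k c where b: "b = axis i (axis k c)" by (auto simp: Basis_vec_def)
    have "(\<lambda>x. f x \<bullet> b) = (\<lambda>x. f x $ i $ k \<bullet> c)" by (simp add: b inner_axis)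
    then show "(\<lambda>x. f x \<bullet> b) \<in> borel_measurable ?M" using m[of i k] by simp
  qed
  moreover have "(norm (f x))\<^sup>2 = (\<Sum>i\<in>UNIV. \<Sum>k\<in>UNIV. (norm (f x $ i $ k))\<^sup>2)" for x
    unfolding norm_vec_def[of "f x"] L2_set_square by (simp add: norm_vec_def L2_set_square)
  ultimately show ?thesis using int by (simp add: L2_def)
qed

lemma AE_imp_negligible_exception:
  assumes "AE x in lborel. x \<in> {0<..<T::real} \<longrightarrow> P x"
  obtains N where "negligible N" "\<And>x. x \<in> {0..T} - N \<Longrightarrow> x \<in> {0<..<T} \<and> P x"
proof
  let ?N = "{x. \<not> (x \<in> {0..T} \<longrightarrow> x \<in> {0<..<T} \<and> P x)}"
  have "AE x in lborel. x \<in> {0..T} \<longrightarrow> x \<in> {0<..<T} \<and> P x"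
    using assms AE_lborel_not_endpoints[of T] by eventually_elim auto
  then have "AE x in lebesgue. x \<in> {0..T} \<longrightarrow> x \<in> {0<..<T} \<and> P x" by (rule AE_completion)
  then show "negligible ?N"
    unfolding completion.AE_iff_null_sets negligible_iff_null_sets by simp
  show "x \<in> {0<..<T} \<and> P x" if "x \<in> {0..T} - ?N" for x using that by auto
qed

lemma AE_eq_Ioo: "(\<And>x. x \<in> {0<..<T} \<Longrightarrow> f x = g x) \<Longrightarrow> AE_eq T f g"
  unfolding AE_eq_def AE_lebesgue_on_Ioo by simp

theorem theoremC1:
  fixes T :: real
    and \<beta> \<beta>' \<beta>'' :: "real \<Rightarrow> complex ^ ('p::finite + 'p) ^ 'p"
  assumes "0 < T"
    and "\<And>x. x \<in> {0..T} \<Longrightarrow> (\<beta> has_vector_derivative \<beta>' x) (at x within {0..T})"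
    and "absolutely_continuous_on {0..T} \<beta>'"
    and "AE x in lebesgue_on {0<..<T}. (\<beta>' has_vector_derivative \<beta>'' x) (at x)"
    and "\<And>i k. (\<lambda>x. \<beta>'' x $ i $ k) \<in> L2 T"
    and "\<And>x. x \<in> {0..T} \<Longrightarrow> \<beta> x ** jmat ** ctranspose (\<beta> x) = 0"
    and "\<And>x. x \<in> {0..T} \<Longrightarrow> \<beta>' x ** jmat ** ctranspose (\<beta> x) = mat \<i>"
  shows "\<exists>(u :: real \<Rightarrow> complex ^ 'p ^ 'p) (\<V> :: real \<Rightarrow> real \<Rightarrow> complex ^ 'p ^ 'p).
           (\<forall>x\<in>{0..T}. unitary_matrix (u x)) \<and>
           absolutely_continuous_on {0..T} u \<and>
           (\<lambda>(x, t). \<V> x t) \<in> borel_measurable (lebesgue_on (volterra_triangle T)) \<and>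
           bdd_above ((\<lambda>(x, t). opnorm (\<V> x t)) ` volterra_triangle T) \<and>
           linearly_similar_via T (V_op u \<V>) (K_op \<beta>) A_op"
proof -
  note T = assms(1) and d\<beta> = assms(2)
  have c\<beta>: "continuous_on {0..T} \<beta>" using d\<beta> by (rule continuous_on_vector_derivative)
  obtain \<beta>2 where \<beta>2: "represents T \<beta>'' \<beta>2"
    using representation_exists[OF matrix_L2_componentwise[OF assms(5)]] .
  have "AE x in lborel. x \<in> {0<..<T} \<longrightarrow> (\<beta>' has_vector_derivative \<beta>2 x) (at x)"
    using assms(4)[unfolded AE_lebesgue_on_Ioo] representsD(3)[OF \<beta>2] by eventually_elim simp
  then obtain N where N: "negligible N"
    and dN: "\<And>x. x \<in> {0..T} - N \<Longrightarrow> x \<in> {0<..<T} \<and> (\<beta>' has_vector_derivative \<beta>2 x) (at x)"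
    by (rule AE_imp_negligible_exception) (rule that)
  have d\<beta>': "(\<beta>' has_vector_derivative \<beta>2 x) (at x within {0..T})" if "x \<in> {0..T} - N" for x
    using dN[OF that] has_vector_derivative_at_within by blast
  obtain u b' b'' where u: "\<And>x. x \<in> {0..T} \<Longrightarrow> unitary_matrix (u x)"
    and acu: "absolutely_continuous_on {0..T} u"
    and db: "\<And>x. x \<in> {0..T} \<Longrightarrow> ((\<lambda>x. ctranspose (u x) ** \<beta> x) has_vector_derivative b' x) (at x within {0..T})"
    and acb': "absolutely_continuous_on {0..T} b'"
    and db': "\<And>x. x \<in> {0..T} - N \<Longrightarrow> (b' has_vector_derivative b'' x) (at x within {0..T})"
    and b''2: "square_integrable T b''"
    and b'b: "\<And>x. x \<in> {0..T} \<Longrightarrow> b' x ** jmat ** ctranspose (ctranspose (u x) ** \<beta> x) = mat \<i>"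
    and b'b': "\<And>x. x \<in> {0..T} \<Longrightarrow> b' x ** jmat ** ctranspose (b' x) = 0"
    by (rule J_gauge_exists[OF T d\<beta> assms(3) d\<beta>' representsD(1)[OF \<beta>2] assms(6,7)]) (assumption+, rule that)
  define b where "b x = ctranspose (u x) ** \<beta> x" for x
  have cu: "continuous_on {0..T} u" using acu by (rule absolutely_continuous_imp_continuous_on)
  have cut: "continuous_on {0..T} (\<lambda>x. ctranspose (u x))" by (rule ctranspose_continuous_on[OF cu])
  have cb: "continuous_on {0..T} b" unfolding b_def using db by (rule continuous_on_vector_derivative)
  have cb': "continuous_on {0..T} b'" using acb' by (rule absolutely_continuous_imp_continuous_on)
  have bb: "b x ** jmat ** ctranspose (b x) = 0" if "x \<in> {0..T}" for x
  proof -
    have "b x ** jmat ** ctranspose (b x) = ctranspose (u x) ** (\<beta> x ** jmat ** ctranspose (\<beta> x)) ** u x"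
      by (simp add: b_def ctranspose_mult matrix_mul_assoc)
    then show ?thesis by (simp add: assms(6)[OF that] mm.zero_left mm.zero_right)
  qed
  define a where "a = J_potential b' b''"
  have a2: "square_integrable T a" unfolding a_def by (rule square_integrable_J_potential[OF cb' b''2])
  note a1 = square_integrableD(4)[OF a2]
  let ?A = "ramp_kernel T :: real \<Rightarrow> real \<Rightarrow> complex ^ 'p ^ 'p"
  let ?K = "J_kernel T b"
  obtain v where v: "volterra_kernel T v"
    and comm: "\<And>f x. integrable lborel f \<Longrightarrow> kernel_op ?A (kernel_op v f) x
       = kernel_op v (kernel_op ?A f) x + kernel_op ?A (\<lambda>s. a s *v kernel_op ?A f s) x
         + kernel_op ?A (\<lambda>s. a s *v kernel_op v (kernel_op ?A f) s) x"
    by (rule transmutation_operator_exists[OF T square_integrableD(1,2)[OF a2] a1 square_integrableD(3)[OF a2]])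
      (assumption, rule that)
  have A: "volterra_kernel T ?A" by (rule volterra_kernel_ramp)
  have K: "volterra_kernel T ?K" by (rule volterra_kernel_J_kernel[OF cb])
  have "?K x t = ?A x t - kernel_comp a ?K ?A x t" for x t
    unfolding a_def
    by (rule J_kernel_equation[OF T db[folded b_def] acb' N db' b''2 bb b'b[folded b_def] b'b'])
  then have sim: "kernel_op ?K (\<lambda>s. f s + kernel_op v f s) x = kernel_op ?A f x + kernel_op v (kernel_op ?A f) x"
    if "integrable lborel f" for f x
    by (intro similarity_from_commutator[OF K A v a1 _ comm that])
  obtain r where r: "volterra_kernel T r"
    and right: "\<And>f x. integrable lborel f \<Longrightarrow> kernel_op r f x + kernel_op v f x + kernel_op v (kernel_op r f) x = 0"
    and left: "\<And>f x. integrable lborel f \<Longrightarrow> kernel_op v f x + kernel_op r f x + kernel_op r (kernel_op v f) x = 0"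
    using kernel_two_sided_inverse[OF v] by metis
  \<comment> \<open>With the zero kernel, \<open>S\<close> is multiplication by \<open>u\<^sup>*\<close>, and the inverse of \<open>V = u (1 + v)\<close> is \<open>W = (1 + r) u\<^sup>*\<close>.\<close>
  define z :: "real \<Rightarrow> real \<Rightarrow> complex ^ 'p ^ 'p" where "z x t = 0" for x t
  have z: "volterra_kernel T z" by (rule volterra_kernelI[where C = 0]) (auto simp: z_def)
  have z_op: "kernel_op z f x = 0" for f x by (simp add: kernel_op_def z_def mv.zero_left)
  define V where "V = V_op u v"
  define S where "S = V_op (\<lambda>x. ctranspose (u x)) z"
  define R where "R = V_op (\<lambda>x. mat 1) r"
  define W where "W f = R (S f)" for f
  have bV: "bounded_L2_operator T V" unfolding V_def by (rule bounded_L2_operator_V_op[OF T v cu])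
  have bW: "bounded_L2_operator T W"
    unfolding W_def R_def S_def
    by (rule bounded_L2_operator_compose[OF bounded_L2_operator_V_op[OF T r continuous_on_const]
          bounded_L2_operator_V_op[OF T z cut]])
  have main: "AE_eq T (V (W f)) f \<and> AE_eq T (W (V f)) f \<and> AE_eq T (K_op \<beta> f) (V (A_op (W f)))"
    if f: "f \<in> L2 T" for f
  proof -
    have uu: "ctranspose (u x) ** u x = mat 1" "u x ** ctranspose (u x) = mat 1" if "x \<in> {0<..<T}" for x
      using u[of x] that by (auto simp: unitary_matrix_def)
    obtain g where g: "represents T f g" using representation_exists[OF f] .
    note gi = represents_integrable[OF g]
    have S_eq: "S h x = ctranspose (u x) *v h x" if "represents T h h'" "x \<in> {0<..<T}" for h h' x
      unfolding S_def by (simp add: V_op_eq[OF z that] z_op)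
    obtain s where s: "represents T (S f) s" using V_op_represents[OF z cut g] unfolding S_def by blast
    note si = represents_integrable[OF s]
    have ri: "integrable lborel (kernel_op r s)" by (rule integrable_kernel_op[OF r si])
    \<comment> \<open>representative of \<open>W f\<close>\<close>
    define w where "w x = s x + kernel_op r s x" for x
    have wi: "integrable lborel w" unfolding w_def using si ri by simp
    have w: "represents T (W f) w"
    proof -
      have "(indicator {0..T} x *\<^sub>R mat 1) *v (s x + kernel_op r s x) = w x" for x
        using square_integrableD(2)[OF representsD(1)[OF s], of x] kernel_op_outside[OF r, of x s]
        by (cases "x \<in> {0..T}") (auto simp: w_def mv.zero_right)
      then show ?thesis
        using V_op_represents[OF r continuous_on_const[of _ "mat 1"] s] by (simp add: W_def R_def)
    qed
    note wm = representsD(2)[OF w]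
    have W_eq: "W f x = ctranspose (u x) *v f x + kernel_op r s x" if "x \<in> {0<..<T}" for x
      unfolding W_def R_def by (simp add: V_op_eq[OF r s that] S_eq[OF g that])
    have Vw: "V (W f) x = f x" if x: "x \<in> {0<..<T}" for x
    proof -
      have "kernel_op v w x = kernel_op v s x + kernel_op v (kernel_op r s) x"
        unfolding w_def by (rule kernel_op_add[OF v si ri])
      then have "W f x + kernel_op v w x = ctranspose (u x) *v f x"
        using right[OF si, of x] by (simp add: W_eq[OF x] add.assoc)
      then show ?thesis
        unfolding V_def by (simp add: V_op_eq[OF v w x] matrix_vector_mul_assoc uu[OF x])
    qed
    have Wv: "W (V f) x = f x" if x: "x \<in> {0<..<T}" for x
    proof -
      have rV: "represents T (V f) (\<lambda>x. (indicator {0..T} x *\<^sub>R u x) *v (g x + kernel_op v g x))"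
        unfolding V_def by (rule V_op_represents[OF v cu g])
      obtain q where q: "represents T (S (V f)) q" using V_op_represents[OF z cut rV] unfolding S_def by blast
      have SV: "S (V f) x = f x + kernel_op v g x" if x: "x \<in> {0<..<T}" for x
        by (simp add: S_eq[OF rV x]) (simp add: V_def V_op_eq[OF v g x] matrix_vector_mul_assoc uu[OF x])
      have vi: "integrable lborel (kernel_op v g)" by (rule integrable_kernel_op[OF v gi])
      have "AE x in lborel. q x = g x + kernel_op v g x"
        using representsD(3)[OF q] representsD(3)[OF g] AE_lborel_not_endpoints[of T]
      proof eventually_elim
        case (elim x)
        show ?case
        proof (cases "x \<in> {0<..<T}")
          case False
          then have x: "x \<notin> {0..T}" and "q x = 0" "g x = 0" using elim by auto
          then show ?thesis by (simp add: kernel_op_outside[OF v x])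
        qed (use elim in \<open>simp add: SV\<close>)
      qed
      then have "kernel_op r q x = kernel_op r (\<lambda>x. g x + kernel_op v g x) x"
        using kernel_op_measurable[OF v representsD(2)[OF g]] representsD(2)[OF g]
        by (intro kernel_op_cong_AE[OF r representsD(2)[OF q]]) measurable
      also have "\<dots> = kernel_op r g x + kernel_op r (kernel_op v g) x"
        by (rule kernel_op_add[OF r gi vi])
      finally have "S (V f) x + kernel_op r q x = f x"
        using left[OF gi, of x] by (simp add: SV[OF x] add.assoc)
      then show ?thesis
        unfolding W_def R_def by (simp add: V_op_eq[OF r q x])
    qed
    have rVw: "represents T (V (W f)) (\<lambda>x. (indicator {0..T} x *\<^sub>R u x) *v (w x + kernel_op v w x))"
      unfolding V_def by (rule V_op_represents[OF v cu w])
    have vwi: "integrable lborel (\<lambda>x. w x + kernel_op v w x)"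
      using wi integrable_kernel_op[OF v wi] by simp
    have "K_op \<beta> f x = V (A_op (W f)) x" if x: "x \<in> {0<..<T}" for x
    proof -
      have "K_op \<beta> f x = kernel_op (J_kernel T \<beta>) g x" by (rule K_op_eq[OF c\<beta> g x])
      \<comment> \<open>\<open>f = V W f\<close>; then \<open>u\<close> is moved through the kernel, and the similarity for the gauged kernel applies.\<close>
      also have "\<dots> = kernel_op (J_kernel T \<beta>) (\<lambda>x. (indicator {0..T} x *\<^sub>R u x) *v (w x + kernel_op v w x)) x"
        by (rule kernel_op_cong_AE[OF volterra_kernel_J_kernel[OF c\<beta>] representsD(2)[OF g] representsD(2)[OF rVw]])
           (rule AE_eq_represents[OF g rVw AE_eq_Ioo[OF Vw[symmetric]]])
      also have "\<dots> = (LINT t|lborel. u x *v (?K x t *v (w t + kernel_op v w t)))"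
        unfolding kernel_op_def[of "J_kernel T \<beta>"]
      proof (intro Bochner_Integration.integral_cong refl)
        fix t
        show "J_kernel T \<beta> x t *v ((indicator {0..T} t *\<^sub>R u t) *v (w t + kernel_op v w t))
            = u x *v (?K x t *v (w t + kernel_op v w t))"
        proof (cases "t \<in> {0..T}")
          case True
          then have "J_kernel T \<beta> x t ** u t = u x ** ?K x t"
            unfolding b_def using x by (intro J_kernel_gauge u) auto
          then show ?thesis using True by (simp add: matrix_vector_mul_assoc)
        next
          case False
          then show ?thesis using x by (auto simp: J_kernel_def mv.zero_left mv.zero_right)
        qed
      qed
      also have "\<dots> = u x *v kernel_op ?K (\<lambda>t. w t + kernel_op v w t) x"
        unfolding kernel_op_def[of ?K]
        by (rule integral_bounded_linear[OF mv.bounded_linear_right integrable_kernel_apply[OF K vwi]])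
      also have "\<dots> = u x *v (kernel_op ?A w x + kernel_op v (kernel_op ?A w) x)"
        by (simp only: sim[OF wi])
      also have "\<dots> = V (A_op (W f)) x"
      proof -
        have Ai: "kernel_op ?A w \<in> borel_measurable borel" by (rule kernel_op_measurable[OF A wm])
        have Aw: "represents T (A_op (W f)) (kernel_op ?A w)"
          unfolding represents_def
        proof
          obtain M where M: "\<And>x t. norm (?A x t) \<le> M" using volterra_kernelD(3)[OF A] by blast
          show "square_integrable T (kernel_op ?A w)"
            by (rule square_integrable_bounded[OF Ai kernel_op_outside[OF A] kernel_op_bound[OF A wi M]])
          show "AE x in lborel. kernel_op ?A w x = (if x \<in> {0<..<T} then A_op (W f) x else 0)"
            using AE_lborel_not_endpoints[of T]
          proof eventually_elim
            case (elim x)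
            show ?case
            proof (cases "x \<in> {0<..<T}")
              case False
              then have x: "x \<notin> {0..T}" using elim by auto
              show ?thesis unfolding kernel_op_outside[OF A x] using False by auto
            qed (simp add: A_op_eq[OF w])
          qed
        qed
        show ?thesis
          unfolding V_def by (simp add: V_op_eq[OF v Aw x] A_op_eq[OF w x])
      qed
      finally show ?thesis .
    qed
    with Vw Wv show ?thesis by (intro conjI AE_eq_Ioo)
  qed
  obtain M where M: "\<And>x t. norm (v x t) \<le> M" using volterra_kernelD(3)[OF v] by blast
  show ?thesis
  proof (intro exI conjI ballI)
    show "unitary_matrix (u x)" if "x \<in> {0..T}" for x using u that .
    show "absolutely_continuous_on {0..T} u" by (rule acu)
    have "(\<lambda>(x, t). v x t) \<in> borel_measurable (lborel :: (real \<times> real) measure)"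
      using volterra_kernelD(1)[OF v] by (simp add: borel_prod)
    then show "(\<lambda>(x, t). v x t) \<in> borel_measurable (lebesgue_on (volterra_triangle T))"
      by (intro measurable_restrict_space1 measurable_completion)
    have "opnorm (v x t) \<le> M" for x t using opnorm_le_norm M by (rule order_trans)
    then show "bdd_above ((\<lambda>(x, t). opnorm (v x t)) ` volterra_triangle T)"
      by (intro bdd_aboveI[where M = M]) auto
    show "linearly_similar_via T (V_op u v) (K_op \<beta>) A_op"
      unfolding linearly_similar_via_def V_def[symmetric] using bV bW main by blast
  qed
qed

end
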